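(* Let $0<p<q\leq1$ and let $K$ be a compact pointed $q$-metric space. Then $\mathcal F_p(K)$ has the $K_{p,q}$-strong Schur $p$-property, where $$K_{p,q}=\Gamma_p\left(\frac1{1-16^{p-q}}+1+\frac1{1-16^{-p}}\right)^{1/p}.$$ In particular, for every compact metric space $K$, $\mathcal F_p(K)$ has the $K_{p,1}$-strong Schur $p$-property.
   Context: All vector spaces are real. For $0<s\le 1$, an $s$-Banach space is a complete quasi-normed space $X$ with $\|x+y\|^s\le\|x\|^s+\|y\|^s$ for all $x,y\in X$. For $0<s\le1$, an $s$-metric on a set $M$ is a function $d\colon M\times M\to[0,\infty)$ such that $d^s$ is a metric; topological notions refer to the metric $d^s$. A pointed $s$-metric space is an $s$-metric space with a distinguished base point $0$; a map is pointed if it sends base point to base point (the base point of a vector space being $0$). If $0<p\le q\le1$, every $q$-metric space is a $p$-metric space. For a pointed $p$-metric space $(M,d,0)$, the Lipschitz-free $p$-space $\mathcal F_p(M)$ is the (unique up to linear isometry) $p$-Banach space equipped with an isometric pointed map $\delta_M\colon M\to\mathcal F_p(M)$ whose linear span is dense, such that every pointed Lipschitz map $f\colon M\to Y$ into a $p$-Banach space $Y$ has a unique bounded linear extension $\widehat f\colon\mathcal F_p(M)\to Y$ with $\widehat f\,\delta_M=f$, and $\|\widehat f\|=\operatorname{Lip}(f)$. $\Gamma_p\ge1$ denotes a constant, depending only on $p$ (its existence is a known theorem of Albiac and Ansorena), such that for every inclusion $0\in A\subseteq M$ of pointed $p$-metric spaces the canonical map $\mathcal F_p(A)\to\mathcal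 F_p(M)$ (the linearization of the inclusion) is an isomorphism onto the closed linear span of $\delta_M(A)$, has norm at most $1$, and its inverse on that range has norm at most $\Gamma_p$. For $\mathsf K\ge1$, a $p$-Banach space $X$ with unit sphere $S_X$ has the $\mathsf K$-strong Schur $p$-property if for every $\delta>0$, every $\mathsf K_0>\mathsf K$ and every infinite $\delta$-separated set $A\subseteq S_X$ (i.e. $\|x-y\|\ge\delta$ for distinct $x,y\in A$) there is an infinite subset $B\subseteq A$ such that $$\Big\|\sum_{x\in B}a_x x\Big\|\ge\frac{\delta}{\mathsf K_0\,2^{1/p}}\Big(\sum_{x\in B}|a_x|^p\Big)^{1/p}$$ for every finitely supported scalar family $(a_x)_{x\in B}$. *)

theory Defs
  imports "HOL-Analysis.Analysis" "HOL-Library.Poly_Mapping"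
begin

section \<open>s-metric spaces\<close>

text \<open>As in the locale \<^locale>\<open>Metric_space\<close>, points range over a carrier set, while
  nonnegativity (and, through \<^locale>\<open>Metric_space\<close>, symmetry) is required off the carrier too;
  values off the carrier are otherwise irrelevant.\<close>

definition s_metric :: "real \<Rightarrow> 'm set \<Rightarrow> ('m \<Rightarrow> 'm \<Rightarrow> real) \<Rightarrow> bool" where
  "s_metric s M d \<longleftrightarrow>
     0 < s \<and> s \<le> 1 \<and> (\<forall>x y. 0 \<le> d x y) \<and> Metric_space M (\<lambda>x y. d x y powr s)"

definition pointed_s_metric :: "real \<Rightarrow> 'm set \<Rightarrow> ('m \<Rightarrow> 'm \<Rightarrow> real) \<Rightarrow> 'm \<Rightarrow> bool" where
  "pointed_s_metric s M d b \<longleftrightarrow> s_metric s M d \<and> b \<in> M"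

definition s_compact :: "real \<Rightarrow> 'm set \<Rightarrow> ('m \<Rightarrow> 'm \<Rightarrow> real) \<Rightarrow> bool" where
  "s_compact s M d \<longleftrightarrow> compact_space (Metric_space.mtopology M (\<lambda>x y. d x y powr s))"


section \<open>s-Banach spaces\<close>

text \<open>A quasi-normed space is a linear subspace \<open>V\<close> of some real vector space together with a
  function \<open>N\<close>, of which only the values on \<open>V\<close> matter.\<close>

definition quasi_norm_on :: "'x::real_vector set \<Rightarrow> ('x \<Rightarrow> real) \<Rightarrow> bool" where
  "quasi_norm_on V N \<longleftrightarrow>
     subspace V \<and>
     (\<forall>x\<in>V. 0 \<le> N x) \<and>
     (\<forall>x\<in>V. N x = 0 \<longleftrightarrow> x = 0) \<and>
     (\<forall>c. \<forall>x\<in>V. N (c *\<^sub>R x) = \<bar>c\<bar> * N x) \<and>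
     (\<exists>C. \<forall>x\<in>V. \<forall>y\<in>V. N (x + y) \<le> C * (N x + N y))"

definition complete_on :: "'x::real_vector set \<Rightarrow> ('x \<Rightarrow> real) \<Rightarrow> bool" where
  "complete_on V N \<longleftrightarrow>
     (\<forall>u. (\<forall>n. u n \<in> V) \<longrightarrow>
          (\<forall>\<epsilon>>0. \<exists>n0::nat. \<forall>m\<ge>n0. \<forall>n\<ge>n0. N (u m - u n) < \<epsilon>) \<longrightarrow>
          (\<exists>x\<in>V. (\<lambda>n. N (u n - x)) \<longlonglongrightarrow> 0))"

definition s_banach :: "real \<Rightarrow> 'x::real_vector set \<Rightarrow> ('x \<Rightarrow> real) \<Rightarrow> bool" where
  "s_banach s V N \<longleftrightarrow>
     0 < s \<and> s \<le> 1 \<and> quasi_norm_on V N \<and> complete_on V N \<and>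
     (\<forall>x\<in>V. \<forall>y\<in>V. N (x + y) powr s \<le> N x powr s + N y powr s)"

definition closed_span_in :: "'x::real_vector set \<Rightarrow> ('x \<Rightarrow> real) \<Rightarrow> 'x set \<Rightarrow> 'x set" where
  "closed_span_in V N S = {v \<in> V. \<forall>\<epsilon>>0. \<exists>u \<in> span S. N (v - u) < \<epsilon>}"

definition bounded_linear_on ::
  "'x::real_vector set \<Rightarrow> ('x \<Rightarrow> real) \<Rightarrow> 'y::real_vector set \<Rightarrow> ('y \<Rightarrow> real) \<Rightarrow> ('x \<Rightarrow> 'y) \<Rightarrow> bool"
  where
  "bounded_linear_on V N W N' T \<longleftrightarrow>
     T ` V \<subseteq> W \<and>
     (\<forall>x\<in>V. \<forall>y\<in>V. T (x + y) = T x + T y) \<and>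
     (\<forall>c. \<forall>x\<in>V. T (c *\<^sub>R x) = c *\<^sub>R T x) \<and>
     (\<exists>C. \<forall>x\<in>V. N' (T x) \<le> C * N x)"

text \<open>In the next two suprema the degenerate quotients (\<open>x = 0\<close>, resp. \<open>x = y\<close>) are \<open>0 / 0 = 0\<close>,
  so that they only serve to make the suprema range over a nonempty set
  (cf. \<^const>\<open>onorm\<close>).\<close>

definition op_norm_on :: "'x set \<Rightarrow> ('x \<Rightarrow> real) \<Rightarrow> ('y \<Rightarrow> real) \<Rightarrow> ('x \<Rightarrow> 'y) \<Rightarrow> real" where
  "op_norm_on V N N' T = (SUP x\<in>V. N' (T x) / N x)"

definition lip_const ::
  "'m set \<Rightarrow> ('m \<Rightarrow> 'm \<Rightarrow> real) \<Rightarrow> ('y::real_vector \<Rightarrow> real) \<Rightarrow> ('m \<Rightarrow> 'y) \<Rightarrow> real" where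
  "lip_const M d N f = (SUP (x, y) \<in> M \<times> M. N (f x - f y) / d x y)"

definition pointed_lipschitz ::
  "'m set \<Rightarrow> ('m \<Rightarrow> 'm \<Rightarrow> real) \<Rightarrow> 'm \<Rightarrow> 'y::real_vector set \<Rightarrow> ('y \<Rightarrow> real) \<Rightarrow> ('m \<Rightarrow> 'y) \<Rightarrow> bool"
  where
  "pointed_lipschitz M d b W N f \<longleftrightarrow>
     f ` M \<subseteq> W \<and> f b = 0 \<and> (\<exists>L. \<forall>x\<in>M. \<forall>y\<in>M. N (f x - f y) \<le> L * d x y)"


section \<open>Lipschitz-free p-spaces\<close>

instantiation poly_mapping :: (type, real_vector) real_vector
begin

definition scaleR_poly_mapping :: "real \<Rightarrow> ('a, 'b) poly_mapping \<Rightarrow> ('a, 'b) poly_mapping" where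
  "scaleR_poly_mapping c f = Poly_Mapping.map (\<lambda>x. c *\<^sub>R x) f"

lemma lookup_scaleR [simp]:
  fixes f :: "('a, 'b) poly_mapping"
  shows "Poly_Mapping.lookup (c *\<^sub>R f) i = c *\<^sub>R Poly_Mapping.lookup f i"
  by (simp add: scaleR_poly_mapping_def Poly_Mapping.map.rep_eq when_def)

instance
  by standard (auto intro!: poly_mapping_eqI simp: lookup_add algebra_simps)

end

text \<open>The universal property quantifies over all p-Banach spaces \<open>Y\<close>. HOL cannot quantify over
  types, so \<open>Y\<close> ranges over the p-Banach spaces carried by subspaces of one large vector space:
  the free real vector space on the set of all sequences of functions \<open>'m \<Rightarrow> real\<close>. This is no
  restriction. Only the closed linear span of \<open>f(M)\<close> in \<open>Y\<close> matters; its elements are limits of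
  sequences of finite linear combinations of points \<open>f(x)\<close>, so it has at most as many elements as
  there are such sequences, and by choosing a Hamel basis it is linearly isomorphic to a subspace
  of \<open>'m test_univ\<close>, to which its quasi-norm can be transported.\<close>

type_synonym 'm test_univ = "(nat \<Rightarrow> 'm \<Rightarrow> real, real) poly_mapping"

definition lipschitz_free_space ::
  "real \<Rightarrow> 'm set \<Rightarrow> ('m \<Rightarrow> 'm \<Rightarrow> real) \<Rightarrow> 'm \<Rightarrow>
   'x::real_vector set \<Rightarrow> ('x \<Rightarrow> real) \<Rightarrow> ('m \<Rightarrow> 'x) \<Rightarrow> bool" where
  "lipschitz_free_space p M d b V N \<delta> \<longleftrightarrow>
     s_banach p V N \<and>
     \<delta> ` M \<subseteq> V \<and> \<delta> b = 0 \<and>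
     (\<forall>x\<in>M. \<forall>y\<in>M. N (\<delta> x - \<delta> y) = d x y) \<and>
     closed_span_in V N (\<delta> ` M) = V \<and>
     (\<forall>(W :: 'm test_univ set) N' f.
        s_banach p W N' \<and> pointed_lipschitz M d b W N' f \<longrightarrow>
        (\<exists>T. bounded_linear_on V N W N' T \<and> (\<forall>x\<in>M. T (\<delta> x) = f x) \<and>
             op_norm_on V N N' T = lip_const M d N' f \<and>
             (\<forall>S. bounded_linear_on V N W N' S \<and> (\<forall>x\<in>M. S (\<delta> x) = f x) \<longrightarrow>
                  (\<forall>v\<in>V. S v = T v))))"

text \<open>\<open>amenability_constant p \<Gamma>\<close> says that \<open>\<Gamma>\<close> is an admissible value of the constant of Albiac
  and Ansorena. To make this depend on \<open>p\<close> alone, the point sets \<open>A \<subseteq> M\<close> are sets of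
  reals, used merely as labels (the p-metric is arbitrary), and the free spaces are carried by
  subspaces of \<^typ>\<open>real test_univ\<close>, which is large enough to contain them. So \<open>M\<close> ranges, up to
  isometry, over all pointed p-metric spaces of cardinality at most that of the continuum, such as
  all compact ones. Hence a constant that works for all p-metric spaces satisfies this
  predicate. The converse holds as well: the quasi-norms of finitely supported elements of free
  p-spaces are infima of quantities that involve finitely many points only, so that finite \<open>M\<close>
  determine the admissible constants.\<close>

definition amenability_constant :: "real \<Rightarrow> real \<Rightarrow> bool" where
  "amenability_constant p \<Gamma> \<longleftrightarrow>
     1 \<le> \<Gamma> \<and>
     (\<forall>(M :: real set) d b A
        (V :: real test_univ set) N \<delta> (V' :: real test_univ set) N' \<delta>' T.
        pointed_s_metric p M d b \<and> b \<in> A \<and> A \<subseteq> M \<and>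
        lipschitz_free_space p A d b V N \<delta> \<and>
        lipschitz_free_space p M d b V' N' \<delta>' \<and>
        bounded_linear_on V N V' N' T \<and> (\<forall>x\<in>A. T (\<delta> x) = \<delta>' x) \<longrightarrow>
        (let R = closed_span_in V' N' (\<delta>' ` A) in
           bij_betw T V R \<and> op_norm_on V N N' T \<le> 1 \<and>
           bounded_linear_on R N' V N (inv_into V T) \<and>
           op_norm_on R N' N (inv_into V T) \<le> \<Gamma>))"


section \<open>The strong Schur p-property\<close>

definition strong_schur ::
  "real \<Rightarrow> real \<Rightarrow> 'x::real_vector set \<Rightarrow> ('x \<Rightarrow> real) \<Rightarrow> bool" where
  "strong_schur p K V N \<longleftrightarrow>
     1 \<le> K \<and> s_banach p V N \<and>
     (\<forall>\<delta>>0. \<forall>K\<^sub>0>K. \<forall>A.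
        infinite A \<and> A \<subseteq> {x \<in> V. N x = 1} \<and>
        (\<forall>x\<in>A. \<forall>y\<in>A. x \<noteq> y \<longrightarrow> \<delta> \<le> N (x - y)) \<longrightarrow>
        (\<exists>B\<subseteq>A. infinite B \<and>
           (\<forall>F a. finite F \<and> F \<subseteq> B \<longrightarrow>
              N (\<Sum>x\<in>F. a x *\<^sub>R x) \<ge>
                \<delta> / (K\<^sub>0 * 2 powr (1 / p)) * (\<Sum>x\<in>F. \<bar>a x\<bar> powr p) powr (1 / p))))"

definition schur_const :: "real \<Rightarrow> real \<Rightarrow> real \<Rightarrow> real" where
  "schur_const \<Gamma> p q =
     \<Gamma> * (1 / (1 - 16 powr (p - q)) + 1 + 1 / (1 - 16 powr (- p))) powr (1 / p)"

end

theory Submission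
  imports Defs "HOL-Library.Diagonal_Subsequence"
begin

text \<open>Put \<open>D = d\<^sup>q\<close> and \<open>\<alpha> = p / q < 1\<close>, so that \<open>D\<close> is a metric and \<open>d\<^sup>p = D\<^sup>\<alpha>\<close>. By the universal property
  the \<open>p\<close>-th power \<open>c\<close> of the norm of a finitely supported element is the least cost
  \<open>\<Sum> |a\<^sub>i|\<^sup>p D(u\<^sub>i, v\<^sub>i)\<^sup>\<alpha>\<close> of a flow representing it. The cheaper costs in which \<open>D\<^sup>\<alpha>\<close> is replaced by
  \<open>min (D\<^sup>\<alpha>) (R D)\<close> define a weaker topology as \<open>R\<close> ranges over the positive reals. It is Hausdorff,
  since optimal flows can be taken to be forests with a bounded number of edges, and by compactness
  of the space every bounded sequence has a subsequence that is almost convergent in it. The terms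
  of a decomposition that survive in the limit and those that vanish share the cost, whence
  \<open>c(z + u\<^sub>n) \<approx> c(z) + c(u\<^sub>n)\<close> for null sequences \<open>u\<^sub>n\<close> of the weak topology. A gliding hump
  argument turns this into a lower \<open>\<ell>\<^sub>p\<close> estimate, even with constant 1 in place of \<open>K\<^sub>p\<^sub>,\<^sub>q\<close>: if
  \<open>x\<^sub>n\<close> is \<open>\<delta>\<close>-separated and \<open>x\<^sub>n = \<eta> + u\<^sub>n\<close> with \<open>u\<^sub>n\<close> null, then \<open>c(u\<^sub>n) \<ge> \<delta>\<^sup>p / 2\<close> for all but
  one \<open>n\<close>.\<close>

section \<open>Flows and their cost\<close>

text \<open>For p < 1 a p-Banach space may have too few functionals, so the weak topology is built
  from smaller costs instead of a dual. Truncating D^\<alpha> to min(D^\<alpha>, R D) leaves long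
  edges alone and makes short ones cheap: the ratio of the truncated to the full price of an edge is
  at most R D^(1-\<alpha>), and \<alpha> < 1. Cost carried by ever shorter edges thus disappears
  weakly. Cost spread over many tiny terms disappears too, because p < 1: moved to a finite net such
  terms add up linearly, and their l_1 sum is negligible against their l_p sum. What remains
  converges by compactness. The obstacle is that nothing nonzero may be invisible to all truncated
  costs. Passing to the limit in flows needs a number of edges bounded in terms of the support
  alone; concavity of t^p together with the triangle inequality supplies it. The factor 2^(1/p) in
  the Schur property reflects the half that is lost when the separation of u_m and u_n is divided
  between the two.\<close>

lemma powr_Bernoulli:
  fixes x p :: real
  assumes "0 \<le> x" "0 < p" "p \<le> 1"
  shows "x powr p \<le> 1 + p * (x - 1)"
proof (cases "x = 0")
  case False
  then have x: "0 < x" using assms by simp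
  have "exp ((1 - p) *\<^sub>R 0 + p *\<^sub>R ln x) \<le> (1 - p) * exp 0 + p * exp (ln x)"
    using assms by (intro convex_onD[OF exp_convex]) auto
  then show ?thesis using x by (simp add: powr_def algebra_simps)
qed (use assms in auto)

text \<open>Split \<phi>(x + y) in the proportion x : y and compare each share with the larger ratio
  at the smaller argument. This form serves both for powers and for the truncated weights
  \<open>\<omega>R\<close>.\<close>

lemma subadditive_of_ratio_decreasing:
  fixes \<phi> :: "real \<Rightarrow> real"
  assumes "\<phi> 0 = 0" and ratio: "\<And>s t. 0 < s \<Longrightarrow> s \<le> t \<Longrightarrow> \<phi> t / t \<le> \<phi> s / s"
    and "0 \<le> x" "0 \<le> y"
  shows "\<phi> (x + y) \<le> \<phi> x + \<phi> y"
proof (cases "x = 0 \<or> y = 0")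
  case False
  define s where "s = x + y"
  have xy: "0 < x" "0 < y" using False assms by auto
  have "\<phi> s = x * (\<phi> s / s) + y * (\<phi> s / s)"
    using xy by (simp add: s_def flip: distrib_right add_divide_distrib)
  also have "\<dots> \<le> x * (\<phi> x / x) + y * (\<phi> y / y)"
    using xy by (intro add_mono mult_left_mono ratio) (auto simp: s_def)
  finally show ?thesis using xy by (simp add: s_def)
qed (use assms in auto)

lemma powr_ratio_decreasing:
  fixes s t p :: real
  assumes "0 < s" "s \<le> t" "p \<le> 1"
  shows "t powr p / t \<le> s powr p / s"
proof -
  have "t powr (p - 1) \<le> s powr (p - 1)"
    using assms by (intro powr_mono2') auto
  then show ?thesis using assms by (simp add: powr_diff)
qed

lemma powr_subadditive:
  fixes x y p :: real
  assumes "0 < p" "p \<le> 1" "0 \<le> x" "0 \<le> y"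
  shows "(x + y) powr p \<le> x powr p + y powr p"
  using assms powr_ratio_decreasing
  by (intro subadditive_of_ratio_decreasing[where \<phi> = "\<lambda>t. t powr p"]) auto

lemma abs_powr_triangle:
  fixes x y p :: real
  assumes "0 < p" "p \<le> 1"
  shows "\<bar>x + y\<bar> powr p \<le> \<bar>x\<bar> powr p + \<bar>y\<bar> powr p"
proof -
  have "\<bar>x + y\<bar> powr p \<le> (\<bar>x\<bar> + \<bar>y\<bar>) powr p"
    using assms by (intro powr_mono2) auto
  also have "\<dots> \<le> \<bar>x\<bar> powr p + \<bar>y\<bar> powr p"
    using assms by (intro powr_subadditive) auto
  finally show ?thesis .
qed

abbreviation "lookup \<equiv> Poly_Mapping.lookup"
abbreviation "keys \<equiv> Poly_Mapping.keys"

definition dipole :: "'m \<Rightarrow> 'm \<Rightarrow> 'm \<Rightarrow>\<^sub>0 real" where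
  "dipole u v = Poly_Mapping.single u 1 - Poly_Mapping.single v 1"

text \<open>The boundary map of the complete directed graph: a weighting of edges is sent to its
  divergence, and its kernel consists of the circulations.\<close>

definition flow :: "('m \<times> 'm \<Rightarrow>\<^sub>0 real) \<Rightarrow> 'm \<Rightarrow>\<^sub>0 real" where
  "flow g = (\<Sum>e\<in>keys g. lookup g e *\<^sub>R dipole (fst e) (snd e))"

definition cost :: "real \<Rightarrow> ('e \<Rightarrow> real) \<Rightarrow> ('e \<Rightarrow>\<^sub>0 real) \<Rightarrow> real" where
  "cost p w g = (\<Sum>e\<in>keys g. \<bar>lookup g e\<bar> powr p * w e)"

definition flows :: "'m set \<Rightarrow> ('m \<Rightarrow>\<^sub>0 real) \<Rightarrow> ('m \<times> 'm \<Rightarrow>\<^sub>0 real) set" where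
  "flows M \<xi> = {g. keys g \<subseteq> M \<times> M \<and> flow g = \<xi>}"

text \<open>The \<open>p\<close>-th power of the free \<open>p\<close>-norm when \<open>w\<close> is the \<open>p\<close>-th power of the \<open>p\<close>-metric.\<close>

definition tcost :: "real \<Rightarrow> ('m \<times> 'm \<Rightarrow> real) \<Rightarrow> 'm set \<Rightarrow> ('m \<Rightarrow>\<^sub>0 real) \<Rightarrow> real" where
  "tcost p w M \<xi> = Inf (cost p w ` flows M \<xi>)"

text \<open>These are the combinations of dipoles on \<open>M\<close>. Working with them removes the
  base point: in a free space the point x is represented by \<open>dipole x b\<close>.\<close>

definition molecules :: "'m set \<Rightarrow> ('m \<Rightarrow>\<^sub>0 real) set" where
  "molecules M = flow ` {g. keys g \<subseteq> M \<times> M}"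

lemma keys_scaleR_subset: "keys (c *\<^sub>R g) \<subseteq> keys (g :: 'a \<Rightarrow>\<^sub>0 'b::real_vector)"
  by (auto simp: in_keys_iff)

lemma flow_superset:
  assumes "finite S" "keys g \<subseteq> S"
  shows "flow g = (\<Sum>e\<in>S. lookup g e *\<^sub>R dipole (fst e) (snd e))"
  unfolding flow_def using assms
  by (intro sum.mono_neutral_left) (auto simp: in_keys_iff)

lemma cost_superset:
  assumes "finite S" "keys g \<subseteq> S"
  shows "cost p w g = (\<Sum>e\<in>S. \<bar>lookup g e\<bar> powr p * w e)"
  unfolding cost_def using assms
  by (intro sum.mono_neutral_left) (auto simp: in_keys_iff)

lemma flow_add: "flow (g + h) = flow g + flow h"
proof -
  let ?S = "keys g \<union> keys h"
  have "keys (g + h) \<subseteq> ?S" by (rule keys_add)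
  then show ?thesis
    by (simp add: flow_superset[of ?S] lookup_add scaleR_add_left sum.distrib)
qed

lemma flow_scaleR: "flow (c *\<^sub>R g) = c *\<^sub>R flow g"
  using keys_scaleR_subset[of c g]
  by (simp add: flow_superset[of "keys g"] scaleR_sum_right)

lemma linear_flow: "linear flow"
  by (rule linearI) (auto simp: flow_add flow_scaleR)

lemma flow_0 [simp]: "flow 0 = 0"
  by (simp add: flow_def)

lemma flow_single: "flow (Poly_Mapping.single (u, v) c) = c *\<^sub>R dipole u v"
  by (simp add: flow_def)

lemma lookup_flow:
  "lookup (flow g) x = (\<Sum>e\<in>keys g. lookup g e * ((if fst e = x then 1 else 0) - (if snd e = x then 1 else 0)))"
  unfolding flow_def lookup_sum
  by (intro sum.cong) (auto simp: dipole_def lookup_minus lookup_single when_def)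

lemma molecules_iff: "\<xi> \<in> molecules M \<longleftrightarrow> flows M \<xi> \<noteq> {}"
  by (auto simp: molecules_def flows_def)

lemma flows_add: "g \<in> flows M \<xi> \<Longrightarrow> h \<in> flows M \<eta> \<Longrightarrow> g + h \<in> flows M (\<xi> + \<eta>)"
  using keys_add[of g h] by (auto simp: flows_def flow_add)

lemma flows_scaleR: "g \<in> flows M \<xi> \<Longrightarrow> c *\<^sub>R g \<in> flows M (c *\<^sub>R \<xi>)"
  using keys_scaleR_subset[of c g] by (auto simp: flows_def flow_scaleR)

lemma subspace_molecules: "subspace (molecules M)"
proof (rule subspaceI)
  have "(0 :: 'a \<times> 'a \<Rightarrow>\<^sub>0 real) \<in> flows M 0" by (simp add: flows_def)
  then show "0 \<in> molecules M" by (auto simp: molecules_iff)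
qed (auto simp: molecules_iff dest: flows_add flows_scaleR)

lemma dipole_in_molecules: "u \<in> M \<Longrightarrow> v \<in> M \<Longrightarrow> dipole u v \<in> molecules M"
  unfolding molecules_def
  by (intro image_eqI[of _ _ "Poly_Mapping.single (u, v) 1"]) (auto simp: flow_single)

text \<open>The weight is abstract because the same p-seminorm calculus is needed for
  \<open>\<omega>\<close>, for every truncation \<open>\<omega>R R\<close>, and for the p-th power
  of the p-metric of a free space.\<close>

locale transport =
  fixes p :: real and w :: "'m \<times> 'm \<Rightarrow> real" and M :: "'m set"
  assumes p: "0 < p" "p \<le> 1" and w_nonneg: "\<And>e. 0 \<le> w e"
begin

lemma cost_nonneg: "0 \<le> cost p w g"
  unfolding cost_def using w_nonneg by (intro sum_nonneg) auto

lemma cost_add: "cost p w (g + h) \<le> cost p w g + cost p w h"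
proof -
  let ?S = "keys g \<union> keys h"
  have "cost p w (g + h) = (\<Sum>e\<in>?S. \<bar>lookup g e + lookup h e\<bar> powr p * w e)"
    using keys_add[of g h] by (simp add: cost_superset[of ?S] lookup_add)
  also have "\<dots> \<le> (\<Sum>e\<in>?S. \<bar>lookup g e\<bar> powr p * w e + \<bar>lookup h e\<bar> powr p * w e)"
    using abs_powr_triangle[OF p] w_nonneg
    by (intro sum_mono) (metis distrib_right mult_right_mono)
  also have "\<dots> = cost p w g + cost p w h"
    by (simp add: cost_superset[of ?S] sum.distrib)
  finally show ?thesis .
qed

lemma cost_scaleR: "cost p w (c *\<^sub>R g) = \<bar>c\<bar> powr p * cost p w g"
  using keys_scaleR_subset[of c g]
  by (simp add: cost_superset[of "keys g"] sum_distrib_left abs_mult powr_mult mult_ac)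

lemma cost_single: "cost p w (Poly_Mapping.single e c) = \<bar>c\<bar> powr p * w e"
  using p by (simp add: cost_def)

abbreviation "c \<equiv> tcost p w M"

lemma c_nonneg: "\<xi> \<in> molecules M \<Longrightarrow> 0 \<le> c \<xi>"
  unfolding tcost_def molecules_iff by (intro cInf_greatest) (auto simp: cost_nonneg)

lemma c_le_cost: "g \<in> flows M \<xi> \<Longrightarrow> c \<xi> \<le> cost p w g"
  unfolding tcost_def
  by (intro cInf_lower bdd_belowI[of _ 0]) (auto simp: cost_nonneg)

lemma c_approx:
  assumes "\<xi> \<in> molecules M" "c \<xi> < t"
  obtains g where "g \<in> flows M \<xi>" "cost p w g < t"
  using assms cInf_lessD[of "cost p w ` flows M \<xi>" t] by (auto simp: tcost_def molecules_iff)

lemma c_add: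
  assumes "\<xi> \<in> molecules M" "\<eta> \<in> molecules M"
  shows "c (\<xi> + \<eta>) \<le> c \<xi> + c \<eta>"
proof (rule field_le_epsilon)
  fix e :: real assume e: "0 < e"
  obtain g where g: "g \<in> flows M \<xi>" "cost p w g < c \<xi> + e / 2"
    using c_approx[OF assms(1), of "c \<xi> + e / 2"] e by auto
  obtain h where h: "h \<in> flows M \<eta>" "cost p w h < c \<eta> + e / 2"
    using c_approx[OF assms(2), of "c \<eta> + e / 2"] e by auto
  have "c (\<xi> + \<eta>) \<le> cost p w (g + h)" using g h by (intro c_le_cost flows_add)
  also have "\<dots> \<le> cost p w g + cost p w h" by (rule cost_add)
  finally show "c (\<xi> + \<eta>) \<le> c \<xi> + c \<eta> + e" using g h by simp
qed

lemma c_scaleR_le: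
  assumes "\<xi> \<in> molecules M"
  shows "c (t *\<^sub>R \<xi>) \<le> \<bar>t\<bar> powr p * c \<xi>"
proof (cases "t = 0")
  case True
  have "(0 :: 'm \<times> 'm \<Rightarrow>\<^sub>0 real) \<in> flows M 0" by (simp add: flows_def)
  from c_le_cost[OF this] show ?thesis using True by (simp add: cost_def)
next
  case False
  then have t: "\<bar>t\<bar> powr p > 0" by simp
  have "c (t *\<^sub>R \<xi>) / \<bar>t\<bar> powr p \<le> c \<xi>"
  proof (rule field_le_epsilon)
    fix e :: real assume e: "0 < e"
    obtain g where g: "g \<in> flows M \<xi>" "cost p w g < c \<xi> + e"
      using c_approx[OF assms, of "c \<xi> + e"] e by auto
    have "c (t *\<^sub>R \<xi>) \<le> \<bar>t\<bar> powr p * cost p w g"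
      using c_le_cost[OF flows_scaleR[OF g(1)]] cost_scaleR by metis
    also have "\<dots> \<le> \<bar>t\<bar> powr p * (c \<xi> + e)"
      using g(2) by (intro mult_left_mono) auto
    finally show "c (t *\<^sub>R \<xi>) / \<bar>t\<bar> powr p \<le> c \<xi> + e"
      using t by (simp add: field_simps)
  qed
  then show ?thesis using t by (simp add: field_simps)
qed

lemma c_0 [simp]: "c 0 = 0"
  using c_scaleR_le[of 0 0] c_nonneg[of 0] subspace_0[OF subspace_molecules, of M] by simp

lemma c_scaleR:
  assumes "\<xi> \<in> molecules M"
  shows "c (t *\<^sub>R \<xi>) = \<bar>t\<bar> powr p * c \<xi>"
proof (cases "t = 0")
  case False
  have "c \<xi> = c ((1 / t) *\<^sub>R (t *\<^sub>R \<xi>))" using False by simp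
  also have "\<dots> \<le> \<bar>1 / t\<bar> powr p * c (t *\<^sub>R \<xi>)"
    by (intro c_scaleR_le subspace_scale subspace_molecules assms)
  finally have "\<bar>t\<bar> powr p * c \<xi> \<le> c (t *\<^sub>R \<xi>)"
    using False by (simp add: powr_divide field_simps)
  then show ?thesis using c_scaleR_le[OF assms, of t] by simp
qed simp

lemma c_uminus: "\<xi> \<in> molecules M \<Longrightarrow> c (- \<xi>) = c \<xi>"
  using c_scaleR[of \<xi> "-1"] by simp

lemma c_diff:
  "\<xi> \<in> molecules M \<Longrightarrow> \<eta> \<in> molecules M \<Longrightarrow> c (\<xi> - \<eta>) \<le> c \<xi> + c \<eta>"
  using c_add[of \<xi> "- \<eta>"] c_uminus[of \<eta>] subspace_neg[OF subspace_molecules, of \<eta> M] by simp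

lemma c_diff_commute:
  "\<xi> \<in> molecules M \<Longrightarrow> \<eta> \<in> molecules M \<Longrightarrow> c (\<xi> - \<eta>) = c (\<eta> - \<xi>)"
  using c_uminus[of "\<xi> - \<eta>"] subspace_diff[OF subspace_molecules, of \<xi> M \<eta>] by simp

lemma c_le_diff:
  "\<xi> \<in> molecules M \<Longrightarrow> \<eta> \<in> molecules M \<Longrightarrow> c \<xi> \<le> c (\<xi> - \<eta>) + c \<eta>"
  using c_add[of "\<xi> - \<eta>" \<eta>] subspace_diff[OF subspace_molecules, of \<xi> M \<eta>] by simp

lemma c_dipole: "u \<in> M \<Longrightarrow> v \<in> M \<Longrightarrow> c (t *\<^sub>R dipole u v) \<le> \<bar>t\<bar> powr p * w (u, v)"
  using c_le_cost[of "Poly_Mapping.single (u, v) t" "t *\<^sub>R dipole u v"]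
    cost_single[of "(u, v)" t]
  by (cases "t = 0") (auto simp: flows_def flow_single)

lemma c_sum:
  "(\<And>i. i \<in> I \<Longrightarrow> f i \<in> molecules M) \<Longrightarrow> c (\<Sum>i\<in>I. f i) \<le> (\<Sum>i\<in>I. c (f i))"
proof (induction I rule: infinite_finite_induct)
  case (insert i I)
  have "c (\<Sum>i\<in>insert i I. f i) \<le> c (f i) + c (\<Sum>i\<in>I. f i)"
    using insert by (simp add: c_add subspace_sum[OF subspace_molecules])
  then show ?case using insert by simp
qed auto

end

lemma tcost_mono:
  assumes "0 < p" "p \<le> 1" "\<And>e. 0 \<le> w e" "\<And>e. e \<in> M \<times> M \<Longrightarrow> w e \<le> w' e" "\<xi> \<in> molecules M"
  shows "tcost p w M \<xi> \<le> tcost p w' M \<xi>"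
proof -
  interpret transport p w M using assms by unfold_locales auto
  show ?thesis
    unfolding tcost_def
  proof (rule cInf_mono)
    show "bdd_below (cost p w ` flows M \<xi>)"
      by (intro bdd_belowI[of _ 0]) (auto simp: cost_nonneg)
    show "\<exists>a\<in>cost p w ` flows M \<xi>. a \<le> b" if "b \<in> cost p w' ` flows M \<xi>" for b
    proof -
      from that obtain g where "g \<in> flows M \<xi>" "b = cost p w' g" by auto
      moreover from this have "cost p w g \<le> cost p w' g"
        unfolding cost_def using assms by (intro sum_mono mult_left_mono) (auto simp: flows_def)
      ultimately show ?thesis by auto
    qed
  qed (use assms(5) in \<open>auto simp: molecules_iff\<close>)
qed

section \<open>Flows with few edges\<close>

definition delete_key :: "'a \<Rightarrow> ('a \<Rightarrow>\<^sub>0 real) \<Rightarrow> 'a \<Rightarrow>\<^sub>0 real" where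
  "delete_key e g = g - Poly_Mapping.single e (lookup g e)"

lemma lookup_delete_key: "lookup (delete_key e g) f = (if f = e then 0 else lookup g f)"
  by (auto simp: delete_key_def lookup_minus lookup_single when_def)

lemma keys_delete_key [simp]: "keys (delete_key e g) = keys g - {e}"
  by (auto simp: in_keys_iff lookup_delete_key split: if_splits)

lemma flow_delete_key:
  "flow (delete_key e g) = flow g - lookup g e *\<^sub>R dipole (fst e) (snd e)"
  unfolding delete_key_def linear_diff[OF linear_flow]
  using flow_single[of "fst e" "snd e"] by simp

lemma cost_delete_key:
  "cost p w (delete_key e g) = cost p w g - \<bar>lookup g e\<bar> powr p * w e"
proof -
  let ?S = "insert e (keys g)"
  have "cost p w g = \<bar>lookup g e\<bar> powr p * w e + (\<Sum>f\<in>keys g - {e}. \<bar>lookup g f\<bar> powr p * w f)"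
    by (subst cost_superset[of ?S]) (auto simp: sum.insert_remove)
  moreover have "cost p w (delete_key e g) = (\<Sum>f\<in>keys g - {e}. \<bar>lookup g f\<bar> powr p * w f)"
    by (auto simp: cost_def lookup_delete_key)
  ultimately show ?thesis by simp
qed

lemma dipole_self [simp]: "dipole u u = 0"
  by (simp add: dipole_def)

lemma dipole_flip: "dipole u v = - dipole v u"
  by (simp add: dipole_def)

locale metric_transport = transport +
  assumes w_sym: "u \<in> M \<Longrightarrow> v \<in> M \<Longrightarrow> w (u, v) = w (v, u)"
    and w_triangle: "u \<in> M \<Longrightarrow> x \<in> M \<Longrightarrow> v \<in> M \<Longrightarrow> w (u, v) \<le> w (u, x) + w (x, v)"
    and w_pos: "u \<in> M \<Longrightarrow> v \<in> M \<Longrightarrow> u \<noteq> v \<Longrightarrow> 0 < w (u, v)"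
begin

text \<open>As long as no coefficient changes its sign, the cost is a concave function of the
  coefficients. Hence along one of the directions k and -k it does not increase, and one may move
  until an edge of \<open>h\<close> disappears, without changing the divergence.\<close>

lemma improve_along_circulation:
  assumes M: "keys h \<subseteq> M \<times> M" and loops: "\<And>e. e \<in> keys h \<Longrightarrow> fst e \<noteq> snd e"
    and k: "k \<noteq> 0" "keys k \<subseteq> keys h" "flow k = 0"
  obtains h' where "flow h' = flow h" "keys h' \<subset> keys h" "cost p w h' \<le> cost p w h"
proof -
  \<comment> \<open>Up to the factor p this is the derivative of the cost at \<open>h\<close> in
    direction \<open>k\<close>. It is odd in \<open>k\<close>, so a sign of \<open>k\<close> with
    \<open>S k \<le> 0\<close> can be chosen.\<close>
  define S where "S k = (\<Sum>e\<in>keys h. \<bar>lookup h e\<bar> powr p * w e * (lookup k e / lookup h e))" for k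
  obtain k where k: "k \<noteq> 0" "keys k \<subseteq> keys h" "flow k = 0" and S: "S k \<le> 0"
  proof (cases "S k \<le> 0")
    case False
    have "S (- k) = - S k" by (simp add: S_def sum_negf)
    then show thesis
      using that[of "- k"] k False linear_neg[OF linear_flow, of k] by (auto simp: in_keys_iff)
  qed (use that k in blast)
  define \<mu> where "\<mu> e = lookup k e / lookup h e" for e
  have h0: "lookup h e \<noteq> 0" if "e \<in> keys h" for e using that by (simp add: in_keys_iff)
  have wpos: "0 < w e" if "e \<in> keys h" for e
    using that M loops w_pos[of "fst e" "snd e"] by (cases e) auto
  have ne: "keys h \<noteq> {}" using k by (metis keys_eq_empty subset_empty)
  \<comment> \<open>The edge with the most negative relative change is the first one whose
    coefficient reaches zero.\<close>
  obtain e1 where e1: "e1 \<in> keys h" "\<And>e. e \<in> keys h \<Longrightarrow> \<mu> e1 \<le> \<mu> e"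
    using arg_min_if_finite[of "keys h" \<mu>] ne by (meson finite_keys not_le_imp_less)
  have neg: "\<mu> e1 < 0"
  proof (rule ccontr)
    assume "\<not> \<mu> e1 < 0"
    then have nn: "0 \<le> \<mu> e" if "e \<in> keys h" for e using e1(2)[OF that] by simp
    have "(\<Sum>e\<in>keys h. \<bar>lookup h e\<bar> powr p * w e * \<mu> e) = 0"
      using S nn by (intro antisym sum_nonneg mult_nonneg_nonneg w_nonneg) (auto simp: S_def \<mu>_def)
    then have "\<forall>e\<in>keys h. \<bar>lookup h e\<bar> powr p * w e * \<mu> e = 0"
      using nn w_nonneg by (subst (asm) sum_nonneg_eq_0_iff) auto
    then have "\<forall>e\<in>keys h. lookup k e = 0"
      using wpos h0 by (fastforce simp: \<mu>_def)
    then have "keys k = {}" using k(2) by (auto simp: in_keys_iff simp del: keys_eq_empty)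
    then show False using k(1) by (simp only: keys_eq_empty)
  qed
  \<comment> \<open>The time at which the coefficient of \<open>e1\<close> vanishes; until then all
    factors 1 + t \<mu> stay nonnegative.\<close>
  define t where "t = - 1 / \<mu> e1"
  have t: "t > 0" using neg by (simp add: t_def)
  have pos: "0 \<le> 1 + t * \<mu> e" if "e \<in> keys h" for e
    using e1(2)[OF that] neg by (simp add: t_def field_simps)
  have lk: "lookup (h + t *\<^sub>R k) e = lookup h e * (1 + t * \<mu> e)" if "e \<in> keys h" for e
    using h0[OF that] by (simp add: lookup_add \<mu>_def field_simps)
  have sub: "keys (h + t *\<^sub>R k) \<subseteq> keys h"
    using keys_add[of h "t *\<^sub>R k"] keys_scaleR_subset[of t k] k(2) by blast
  show thesis
  proof (rule that)
    show "flow (h + t *\<^sub>R k) = flow h" by (simp add: flow_add flow_scaleR k)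
    have "lookup (h + t *\<^sub>R k) e1 = 0" using lk[OF e1(1)] neg by (simp add: t_def)
    then show "keys (h + t *\<^sub>R k) \<subset> keys h" using sub e1(1) by (auto simp: in_keys_iff)
    have "cost p w (h + t *\<^sub>R k) = (\<Sum>e\<in>keys h. \<bar>lookup h e\<bar> powr p * w e * (1 + t * \<mu> e) powr p)"
      using sub pos
      by (subst cost_superset[of "keys h"]) (auto simp: lk abs_mult powr_mult mult_ac intro!: sum.cong)
    \<comment> \<open>Bernoulli's inequality is concavity here: it bounds the cost by its tangent at
      \<open>h\<close>, which descends because \<open>S k \<le> 0\<close>.\<close>
    also have "\<dots> \<le> (\<Sum>e\<in>keys h. \<bar>lookup h e\<bar> powr p * w e * (1 + p * (1 + t * \<mu> e - 1)))"
      using pos p w_nonneg by (intro sum_mono mult_left_mono powr_Bernoulli) auto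
    also have "\<dots> = cost p w h + p * t * S k"
      by (simp add: cost_def S_def \<mu>_def sum.distrib algebra_simps sum_distrib_left)
    also have "\<dots> \<le> cost p w h" using S p t by (simp add: mult_le_0_iff)
    finally show "cost p w (h + t *\<^sub>R k) \<le> cost p w h" .
  qed
qed

text \<open>Turns an edge at \<open>x\<close> so that it ends in \<open>x\<close>, changing the sign
  of its coefficient if necessary. Two edges meeting in \<open>x\<close> can then be compared
  regardless of their original directions.\<close>

lemma reorient:
  assumes "e \<in> M \<times> M" "fst e \<noteq> snd e" "x = fst e \<or> x = snd e"
  obtains a y where "y \<in> M" "lookup g e *\<^sub>R dipole (fst e) (snd e) = a *\<^sub>R dipole y x"
    "\<bar>a\<bar> = \<bar>lookup g e\<bar>" "w (y, x) = w e"
    "a = - (lookup g e * ((if fst e = x then 1 else 0) - (if snd e = x then 1 else 0)))"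
proof (cases "x = snd e")
  case True
  then show thesis using assms by (intro that[of "fst e" "lookup g e"]) auto
next
  case False
  then have "x = fst e" using assms by simp
  then show thesis using assms w_sym[of "fst e" "snd e"] dipole_flip[of x "snd e"]
    by (intro that[of "snd e" "- lookup g e"]) auto
qed

text \<open>A flow with the fewest edges among those of no larger cost has no circulation in its support,
  hence at most as many edges as vertices, and its vertices outside \<open>A\<close> have degree at least 3,
  since two edges meeting in such a vertex could be replaced by one. So there are at most
  \<open>2 |A|\<close> such vertices.\<close>

lemma flow_few_edges:
  assumes g: "g \<in> flows M \<xi>" and A: "finite A" "keys \<xi> \<subseteq> A"
  obtains h where "h \<in> flows M \<xi>" "cost p w h \<le> cost p w g" "card (keys h) \<le> 3 * card A"
proof -
  define P where "P h \<longleftrightarrow> h \<in> flows M \<xi> \<and> cost p w h \<le> cost p w g" for h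
  have "P g" using g by (simp add: P_def)
  then obtain h where h: "P h" and min: "\<And>h'. P h' \<Longrightarrow> card (keys h) \<le> card (keys h')"
    using ex_has_least_nat[of P g "\<lambda>h. card (keys h)"] by blast
  define D where "D e = dipole (fst e) (snd e)" for e :: "'a \<times> 'a"
  have hM: "keys h \<subseteq> M \<times> M" and hflow: "flow h = \<xi>" and hcost: "cost p w h \<le> cost p w g"
    using h by (auto simp: P_def flows_def)
  have improve: False
    if "flow h' = flow h" "keys h' \<subseteq> M \<times> M" "card (keys h') < card (keys h)" "cost p w h' \<le> cost p w h"
    for h'
    using min[of h'] that hflow hcost by (auto simp: P_def flows_def)
  have loops: "fst e \<noteq> snd e" if e: "e \<in> keys h" for e
  proof
    assume "fst e = snd e"
    then have "flow (delete_key e h) = flow h" by (simp add: flow_delete_key)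
    moreover have "card (keys (delete_key e h)) < card (keys h)"
      using e by (metis card_Diff1_less finite_keys keys_delete_key)
    moreover have "cost p w (delete_key e h) \<le> cost p w h"
      using w_nonneg by (simp add: cost_delete_key)
    ultimately show False using improve[of "delete_key e h"] hM by auto
  qed
  have acyclic: "k = 0" if k: "keys k \<subseteq> keys h" "flow k = 0" for k
  proof (rule ccontr)
    assume "k \<noteq> 0"
    from improve_along_circulation[OF hM loops this k] obtain h'
      where "flow h' = flow h" "keys h' \<subset> keys h" "cost p w h' \<le> cost p w h" by blast
    then show False using improve[of h'] hM psubset_card_mono[of "keys h" "keys h'"] by auto
  qed
  define V where "V = fst ` keys h \<union> snd ` keys h"
  have finV: "finite V" by (simp add: V_def)
  have inj: "inj_on D (keys h)"
  proof (rule inj_onI, rule ccontr)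
    fix e f assume e: "e \<in> keys h" "f \<in> keys h" "D e = D f" "e \<noteq> f"
    let ?k = "Poly_Mapping.single e (1 :: real) - Poly_Mapping.single f 1"
    have "keys ?k \<subseteq> keys h"
      using e by (auto simp: in_keys_iff lookup_minus lookup_single when_def split: if_splits)
    moreover have "flow ?k = 0"
      using e flow_single[of "fst e" "snd e" 1] flow_single[of "fst f" "snd f" 1]
      by (simp add: linear_diff[OF linear_flow] D_def)
    ultimately have "?k = 0" by (rule acyclic)
    then have "lookup ?k e = 0" by (metis lookup_zero)
    then show False using e by (simp add: lookup_minus lookup_single)
  qed
  \<comment> \<open>A linear relation between the dipoles of the edges is a circulation, so
    acyclicity means independence. As the dipoles lie in the span of the vertices, there are at most
    \<open>card V\<close> edges.\<close>
  have "independent (D ` keys h)"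
  proof
    assume "dependent (D ` keys h)"
    then obtain U e0 where U: "e0 \<in> keys h" "U (D e0) \<noteq> 0" "(\<Sum>v\<in>D ` keys h. U v *\<^sub>R v) = 0"
      by (subst (asm) dependent_finite) auto
    define k where "k = (\<Sum>e\<in>keys h. Poly_Mapping.single e (U (D e)))"
    have lk: "lookup k e = (if e \<in> keys h then U (D e) else 0)" for e
      by (simp add: k_def lookup_sum lookup_single when_def)
    have sub: "keys k \<subseteq> keys h" by (auto simp: in_keys_iff lk split: if_splits)
    have "flow k = (\<Sum>e\<in>keys h. U (D e) *\<^sub>R D e)"
      using sub by (subst flow_superset[of "keys h"]) (auto simp: lk D_def intro!: sum.cong)
    also have "\<dots> = 0" using U(3) inj by (simp add: sum.reindex)
    finally have "k = 0" by (intro acyclic sub)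
    then show False using lk[of e0] U by simp
  qed
  moreover have "D ` keys h \<subseteq> span ((\<lambda>x. Poly_Mapping.single x (1::real)) ` V)"
    unfolding D_def dipole_def V_def by (intro image_subsetI span_diff span_base imageI) auto
  ultimately have "card (D ` keys h) \<le> card ((\<lambda>x. Poly_Mapping.single x (1::real)) ` V)"
    using finV by (intro conjunct2[OF independent_span_bound]) auto
  also have "\<dots> \<le> card V" by (rule card_image_le[OF finV])
  finally have edges: "card (keys h) \<le> card V" using inj by (simp add: card_image)
  define I where "I x = {e \<in> keys h. x = fst e \<or> x = snd e}" for x
  have deg: "3 \<le> card (I x)" if x: "x \<in> V - A" for x
  proof (rule ccontr)
    assume "\<not> 3 \<le> card (I x)"
    moreover have finI: "finite (I x)" by (simp add: I_def)
    moreover have "I x \<noteq> {}" using x unfolding I_def V_def by blast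
    ultimately have cases: "card (I x) = 1 \<or> card (I x) = 2"
      by (cases "card (I x)") auto
    define s where "s e = lookup h e * ((if fst e = x then 1 else 0) - (if snd e = x then 1 else 0))" for e
    \<comment> \<open>Outside \<open>A\<close> the divergence vanishes. With a single edge at
      \<open>x\<close> this is impossible; with two edges it makes their coefficients opposite once
      both are oriented towards \<open>x\<close>.\<close>
    have "lookup (flow h) x = 0"
      using x A hflow by (auto simp: in_keys_iff)
    then have "(\<Sum>e\<in>keys h. s e) = 0" by (simp add: lookup_flow s_def)
    moreover have "(\<Sum>e\<in>keys h. s e) = (\<Sum>e\<in>I x. s e)"
      by (rule sum.mono_neutral_right) (auto simp: I_def s_def)
    ultimately have sum0: "(\<Sum>e\<in>I x. s e) = 0" by simp
    have s0: "s e \<noteq> 0" if "e \<in> I x" for e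
      using that loops[of e] by (auto simp: s_def I_def in_keys_iff)
    from cases show False
    proof
      assume "card (I x) = 1"
      then obtain e where "I x = {e}" by (auto simp: card_1_singleton_iff)
      then show False using sum0 s0[of e] by simp
    next
      assume "card (I x) = 2"
      then obtain e f where ef: "I x = {e, f}" "e \<noteq> f" by (auto simp: card_2_iff)
      have e: "e \<in> keys h" "x = fst e \<or> x = snd e" and f: "f \<in> keys h" "x = fst f \<or> x = snd f"
        using ef by (auto simp: I_def)
      obtain a y where y: "y \<in> M" "lookup h e *\<^sub>R D e = a *\<^sub>R dipole y x"
        "\<bar>a\<bar> = \<bar>lookup h e\<bar>" "w (y, x) = w e" "a = - s e"
        by (rule reorient[OF subsetD[OF hM e(1)] loops[OF e(1)] e(2), of h, folded D_def s_def])
      obtain b z where z: "z \<in> M" "lookup h f *\<^sub>R D f = b *\<^sub>R dipole z x"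
        "\<bar>b\<bar> = \<bar>lookup h f\<bar>" "w (z, x) = w f" "b = - s f"
        by (rule reorient[OF subsetD[OF hM f(1)] loops[OF f(1)] f(2), of h, folded D_def s_def])
      have b: "b = - a" using sum0 ef y(5) z(5) by simp
      have xM: "x \<in> M" using e hM by auto
      \<comment> \<open>The path through \<open>x\<close> is replaced by the direct edge from
        \<open>y\<close> to \<open>z\<close>. This edge may already be present or be a loop;
        subadditivity of the cost covers these cases as well.\<close>
      define h' where "h' = delete_key f (delete_key e h) + Poly_Mapping.single (y, z) a"
      have lf: "lookup (delete_key e h) f = lookup h f" using ef by (simp add: lookup_delete_key)
      have sub: "keys h' \<subseteq> insert (y, z) (keys h - {e, f})"
        using keys_add[of "delete_key f (delete_key e h)" "Poly_Mapping.single (y, z) a"]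
        by (auto simp: h'_def split: if_splits)
      have "flow h' = flow h - lookup h e *\<^sub>R D e - lookup h f *\<^sub>R D f + a *\<^sub>R dipole y z"
        by (simp add: h'_def flow_add flow_delete_key flow_single lf D_def)
      also have "\<dots> = flow h"
        unfolding y(2) z(2) b by (simp add: dipole_def algebra_simps)
      finally have 1: "flow h' = flow h" .
      have "card (keys h') \<le> Suc (card (keys h - {e, f}))"
        using card_mono[OF _ sub] by (simp add: card_insert_if split: if_splits)
      also have "\<dots> < card (keys h)"
        using e f ef card_mono[of "keys h" "{e, f}"] by (simp add: card_Diff_subset)
      finally have 2: "card (keys h') < card (keys h)" .
      have "cost p w h' \<le> cost p w h - \<bar>lookup h e\<bar> powr p * w e - \<bar>lookup h f\<bar> powr p * w f
          + \<bar>a\<bar> powr p * w (y, z)"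
        unfolding h'_def using cost_add[of "delete_key f (delete_key e h)" "Poly_Mapping.single (y, z) a"]
        by (simp add: cost_delete_key cost_single lf)
      also have "\<dots> = cost p w h + \<bar>a\<bar> powr p * (w (y, z) - (w (y, x) + w (x, z)))"
        unfolding y(3,4)[symmetric] z(3,4)[symmetric] w_sym[OF xM z(1)] b
        by (simp add: algebra_simps)
      also have "\<dots> \<le> cost p w h"
        using w_triangle[OF y(1) xM z(1)] by (simp add: mult_nonneg_nonpos)
      finally have 3: "cost p w h' \<le> cost p w h" .
      show False using improve[OF 1 _ 2 3] sub hM y(1) z(1) by blast
    qed
  qed
  \<comment> \<open>Double counting of incidences: each vertex outside \<open>A\<close> meets at
    least three edges, each edge meets at most two vertices.\<close>
  have "3 * card (V - A) \<le> (\<Sum>x\<in>V - A. card (I x))"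
    using deg sum_mono[of "V - A" "\<lambda>_. 3" "\<lambda>x. card (I x)"] by (simp add: mult.commute)
  also have "\<dots> = (\<Sum>x\<in>V - A. \<Sum>e\<in>keys h. if x = fst e \<or> x = snd e then 1 else 0)"
    unfolding I_def card_eq_sum by (intro sum.cong sum.inter_filter) auto
  also have "\<dots> = (\<Sum>e\<in>keys h. \<Sum>x\<in>V - A. if x = fst e \<or> x = snd e then 1 else 0)"
    by (rule sum.swap)
  also have "\<dots> \<le> (\<Sum>e\<in>keys h. 2)"
  proof (rule sum_mono)
    fix e
    have "(\<Sum>x\<in>V - A. if x = fst e \<or> x = snd e then 1 else 0) = card {x \<in> V - A. x = fst e \<or> x = snd e}"
      unfolding card_eq_sum using finV by (intro sum.inter_filter[symmetric]) auto
    also have "\<dots> \<le> card {fst e, snd e}" by (rule card_mono) auto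
    also have "\<dots> \<le> 2" by (simp add: card_insert_if)
    finally show "(\<Sum>x\<in>V - A. if x = fst e \<or> x = snd e then 1 else 0) \<le> (2::nat)" .
  qed
  finally have "3 * card (V - A) \<le> 2 * card (keys h)" by (simp add: mult.commute)
  moreover have "card V \<le> card (V - A) + card A"
    using card_Un_le[of "V - A" A] card_mono[of "(V - A) \<union> A" V] finV A by auto
  \<comment> \<open>From 3 |V - A| \<le> 2 |E| and |E| \<le> |V| \<le> |V - A| + |A| follows |V - A|
    \<le> 2 |A|, hence |E| \<le> 3 |A|.\<close>
  ultimately have "card (keys h) \<le> 3 * card A" using edges by linarith
  then show thesis using that[of h] h by (simp add: P_def)
qed

end

section \<open>Snowflakes of compact metric spaces\<close>

text \<open>The diagonal sequence is a subsequence of the j-th stage only after finitely many terms.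
  The third assumption, insensitivity to an initial segment, removes that shift.\<close>

lemma diagonal_subsequence:
  fixes P :: "nat \<Rightarrow> (nat \<Rightarrow> nat) \<Rightarrow> bool"
  assumes "\<And>j (s :: nat \<Rightarrow> nat). strict_mono s \<Longrightarrow> \<exists>r. strict_mono r \<and> P j (s \<circ> r)"
    and "\<And>j (s :: nat \<Rightarrow> nat) r. P j s \<Longrightarrow> strict_mono r \<Longrightarrow> P j (s \<circ> r)"
    and "\<And>j s k. P j (s \<circ> (+) k) \<Longrightarrow> P j s"
  obtains s where "strict_mono s" "\<And>j. P j s"
proof -
  interpret subseqs P by unfold_locales (rule assms(1))
  show thesis
    using that[OF subseq_diagseq] diagseq_holds assms(2,3) by metis
qed

text \<open>The push-forward of a finitely supported signed measure. It carries dipoles to dipoles,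
  so the vertices of a flow can be moved while its divergence is tracked.\<close>

definition push :: "('a \<Rightarrow> 'b) \<Rightarrow> ('a \<Rightarrow>\<^sub>0 real) \<Rightarrow> 'b \<Rightarrow>\<^sub>0 real" where
  "push \<pi> \<xi> = (\<Sum>x\<in>keys \<xi>. Poly_Mapping.single (\<pi> x) (lookup \<xi> x))"

lemma push_superset:
  "finite S \<Longrightarrow> keys \<xi> \<subseteq> S \<Longrightarrow> push \<pi> \<xi> = (\<Sum>x\<in>S. Poly_Mapping.single (\<pi> x) (lookup \<xi> x))"
  unfolding push_def by (intro sum.mono_neutral_left) (auto simp: in_keys_iff)

lemma scaleR_single: "c *\<^sub>R Poly_Mapping.single x (a::real) = Poly_Mapping.single x (c * a)"
  by (rule poly_mapping_eqI) (simp add: lookup_single when_def)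

lemma linear_push: "linear (push \<pi>)"
proof (rule linearI)
  show "push \<pi> (\<xi> + \<eta>) = push \<pi> \<xi> + push \<pi> \<eta>" for \<xi> \<eta> :: "'a \<Rightarrow>\<^sub>0 real"
    using keys_add[of \<xi> \<eta>]
    by (simp add: push_superset[of "keys \<xi> \<union> keys \<eta>"] lookup_add single_add sum.distrib)
  show "push \<pi> (c *\<^sub>R \<xi>) = c *\<^sub>R push \<pi> \<xi>" for c and \<xi> :: "'a \<Rightarrow>\<^sub>0 real"
    using keys_scaleR_subset[of c \<xi>]
    by (simp add: push_superset[of "keys \<xi>"] scaleR_sum_right scaleR_single)
qed

lemma push_dipole: "push \<pi> (dipole u v) = dipole (\<pi> u) (\<pi> v)"
  unfolding dipole_def linear_diff[OF linear_push] by (simp add: push_def)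

lemma push_flow:
  "push \<pi> (flow g) = (\<Sum>e\<in>keys g. lookup g e *\<^sub>R dipole (\<pi> (fst e)) (\<pi> (snd e)))"
  by (simp add: flow_def linear_sum[OF linear_push] linear_scale[OF linear_push] push_dipole)

lemma push_id:
  assumes "\<And>x. x \<in> keys \<xi> \<Longrightarrow> \<pi> x = x"
  shows "push \<pi> \<xi> = \<xi>"
proof -
  have "push \<pi> \<xi> = (\<Sum>x\<in>keys \<xi>. Poly_Mapping.single x (lookup \<xi> x))"
    unfolding push_def using assms by (intro sum.cong) auto
  also have "\<dots> = \<xi>"
    by (rule poly_mapping_eqI) (auto simp: lookup_sum lookup_single when_def in_keys_iff)
  finally show ?thesis .
qed

lemma decreasing_enumeration:
  fixes h :: "'e \<Rightarrow> real"
  assumes "finite S"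
  obtains f where "bij_betw f {..<card S} S" "\<And>i j. i \<le> j \<Longrightarrow> j < card S \<Longrightarrow> h (f j) \<le> h (f i)"
proof -
  obtain ys where ys: "set ys = S" "distinct ys"
    using finite_distinct_list[OF assms] by blast
  define xs where "xs = sort_key (\<lambda>e. - h e) ys"
  have xs: "set xs = S" "distinct xs" "length xs = card S" "sorted (map (\<lambda>e. - h e) xs)"
    using ys by (auto simp: xs_def distinct_card)
  show thesis
  proof (rule that)
    show "bij_betw ((!) xs) {..<card S} S" using xs by (intro bij_betw_nth) auto
    show "h (xs ! j) \<le> h (xs ! i)" if "i \<le> j" "j < card S" for i j
      using sorted_nth_mono[OF xs(4), of i j] that xs(3) by simp
  qed
qed

locale snowflake = Metric_space M D for M :: "'m set" and D +
  fixes p \<alpha> :: real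
  assumes p01: "0 < p" "p < 1" and \<alpha>: "0 < \<alpha>" "\<alpha> < 1"
    and compact: "compact_space mtopology" and nonempty: "M \<noteq> {}"
begin

definition \<omega> :: "'m \<times> 'm \<Rightarrow> real" where
  "\<omega> e = D (fst e) (snd e) powr \<alpha>"

text \<open>This equals \<open>\<omega>\<close> where D^(1-\<alpha>) \<ge> 1/R and is linear in
  \<open>D\<close> on shorter edges. Increasing \<open>R\<close> lowers the threshold, so that the
  weight of any fixed edge is eventually \<open>\<omega>\<close>.\<close>

definition \<omega>R :: "real \<Rightarrow> 'm \<times> 'm \<Rightarrow> real" where
  "\<omega>R R e = min (\<omega> e) (R * D (fst e) (snd e))"

lemma \<omega>_nonneg: "0 \<le> \<omega> e"
  by (simp add: \<omega>_def)

lemma \<omega>R_le: "\<omega>R R e \<le> \<omega> e" "\<omega>R R e \<le> R * D (fst e) (snd e)"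
  by (auto simp: \<omega>R_def)

sublocale metric_transport p \<omega> M
proof
  fix u v x
  show "\<omega> (u, v) = \<omega> (v, u)" by (simp add: \<omega>_def commute)
  show "0 < \<omega> (u, v)" if "u \<in> M" "v \<in> M" "u \<noteq> v"
    using mdist_pos_eq[OF that(1,2)] that by (simp add: \<omega>_def)
  show "\<omega> (u, v) \<le> \<omega> (u, x) + \<omega> (x, v)" if "u \<in> M" "x \<in> M" "v \<in> M"
  proof -
    have "\<omega> (u, v) \<le> (D u x + D x v) powr \<alpha>"
      unfolding \<omega>_def using triangle[OF that] \<alpha> by (auto intro: powr_mono2)
    also have "\<dots> \<le> \<omega> (u, x) + \<omega> (x, v)"
      using \<alpha> by (auto simp: \<omega>_def intro!: powr_subadditive)
    finally show ?thesis .
  qed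
qed (use p01 in \<open>auto simp: \<omega>_nonneg\<close>)

text \<open>The profile min(t^\<alpha>, R t) divided by t is min(t^(\<alpha>-1), R), which
  decreases; so the profile is subadditive and the truncated weight inherits the triangle
  inequality.\<close>

lemma metric_transport_\<omega>R:
  assumes R: "0 < R"
  shows "metric_transport p (\<omega>R R) M"
proof
  fix u v x
  define \<phi> where "\<phi> t = min (t powr \<alpha>) (R * t)" for t
  have \<phi>: "\<omega>R R (a, b) = \<phi> (D a b)" for a b by (simp add: \<omega>R_def \<omega>_def \<phi>_def)
  show "\<omega>R R (u, v) = \<omega>R R (v, u)" by (simp add: \<phi> commute)
  show "0 < \<omega>R R (u, v)" if "u \<in> M" "v \<in> M" "u \<noteq> v"
    using mdist_pos_eq[OF that(1,2)] that R by (simp add: \<phi> \<phi>_def)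
  show "\<omega>R R (u, v) \<le> \<omega>R R (u, x) + \<omega>R R (x, v)" if "u \<in> M" "x \<in> M" "v \<in> M"
  proof -
    have "\<phi> (D u v) \<le> \<phi> (D u x + D x v)"
      unfolding \<phi>_def using triangle[OF that] \<alpha> R by (intro min.mono powr_mono2) auto
    also have "\<dots> \<le> \<phi> (D u x) + \<phi> (D x v)"
    proof (rule subadditive_of_ratio_decreasing)
      fix s t :: real assume st: "0 < s" "s \<le> t"
      have "\<phi> t / t = min (t powr \<alpha> / t) R" using st by (simp add: \<phi>_def min_divide_distrib_right)
      also have "\<dots> \<le> min (s powr \<alpha> / s) R"
        using powr_ratio_decreasing[of s t \<alpha>] st \<alpha> by (intro min.mono) auto
      also have "\<dots> = \<phi> s / s" using st by (simp add: \<phi>_def min_divide_distrib_right)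
      finally show "\<phi> t / t \<le> \<phi> s / s" .
    qed (auto simp: \<phi>_def)
    finally show ?thesis by (simp add: \<phi>)
  qed
qed (use p01 R in \<open>auto simp: \<omega>R_def \<omega>_nonneg\<close>)

abbreviation "cR R \<equiv> tcost p (\<omega>R R) M"

lemma cR_le: "0 < R \<Longrightarrow> \<xi> \<in> molecules M \<Longrightarrow> cR R \<xi> \<le> c \<xi>"
  using p01 by (intro tcost_mono) (auto simp: \<omega>R_le \<omega>_nonneg, simp add: \<omega>R_def \<omega>_nonneg)

section \<open>Limits of vertices in the compact space; the truncated costs separate points\<close>

lemma convergent_subsequence:
  fixes x :: "nat \<Rightarrow> 'm"
  assumes "\<And>n. x n \<in> M"
  obtains r l where "strict_mono r" "l \<in> M" "(\<lambda>n. D (x (r n)) l) \<longlonglongrightarrow> 0"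
proof -
  from assms have "range x \<subseteq> M" by auto
  with compact obtain l r where lr: "l \<in> M" "strict_mono r" "limitin mtopology (x \<circ> r) l sequentially"
    unfolding compact_space_sequentially by meson
  from lr(3) have "(\<lambda>n. D (x (r n)) l) \<longlonglongrightarrow> 0"
    unfolding limitin_metric_dist_null by (simp add: o_def)
  then show thesis by (rule that[OF lr(2,1)])
qed

lemma \<omega>_LIM_0:
  "(\<lambda>n. D (x n) (y n)) \<longlonglongrightarrow> 0 \<Longrightarrow> (\<lambda>n. \<omega> (x n, y n)) \<longlonglongrightarrow> 0"
  using \<alpha> tendsto_powr2[of "\<lambda>n. D (x n) (y n)" 0 sequentially "\<lambda>_. \<alpha>" \<alpha>] by (simp add: \<omega>_def)

lemma D_LIM:
  assumes "\<And>n. x n \<in> M" "\<And>n. y n \<in> M" "l \<in> M" "m \<in> M"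
    and "(\<lambda>n. D (x n) l) \<longlonglongrightarrow> 0" "(\<lambda>n. D (y n) m) \<longlonglongrightarrow> 0"
  shows "(\<lambda>n. D (x n) (y n)) \<longlonglongrightarrow> D l m"
proof (rule LIM_zero_cancel, rule Lim_null_comparison)
  show "(\<lambda>n. D (x n) l + D (y n) m) \<longlonglongrightarrow> 0" using tendsto_add[OF assms(5,6)] by simp
  have "D (x n) (y n) \<le> D (x n) l + (D l m + D m (y n))"
    "D l m \<le> D l (x n) + (D (x n) (y n) + D (y n) m)" for n
    using triangle[of "x n" l "y n"] triangle[of l m "y n"] triangle[of l "x n" m]
      triangle[of "x n" "y n" m] assms(1-4) by fastforce+
  then have "\<bar>D (x n) (y n) - D l m\<bar> \<le> D (x n) l + D (y n) m" for n
    using commute[of l "x n"] commute[of m "y n"] by (smt (verit))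
  then show "\<forall>\<^sub>F n in sequentially. norm (D (x n) (y n) - D l m) \<le> D (x n) l + D (y n) m" by simp
qed

lemma common_subsequence:
  fixes x :: "nat \<Rightarrow> nat \<Rightarrow> 'm" and s :: "nat \<Rightarrow> nat \<Rightarrow> real"
  assumes x: "\<And>n j. x n j \<in> M" and s: "\<And>n j. \<bar>s n j\<bar> \<le> C"
  obtains r l \<sigma> where "strict_mono r" "\<And>j. l j \<in> M" "\<And>j. (\<lambda>n. D (x (r n) j) (l j)) \<longlonglongrightarrow> 0"
    "\<And>j. (\<lambda>n. s (r n) j) \<longlonglongrightarrow> \<sigma> j"
proof -
  define P where "P j r \<longleftrightarrow>
    (\<exists>l\<in>M. (\<lambda>n. D (x (r n) j) l) \<longlonglongrightarrow> 0) \<and> (\<exists>\<sigma>. (\<lambda>n. s (r n) j) \<longlonglongrightarrow> \<sigma>)" for j and r :: "nat \<Rightarrow> nat"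
  obtain r where r: "strict_mono r" "\<And>j. P j r"
  proof (rule diagonal_subsequence[of P])
    fix j and q :: "nat \<Rightarrow> nat"
    obtain r1 l where r1: "strict_mono r1" "l \<in> M" "(\<lambda>n. D (x (q (r1 n)) j) l) \<longlonglongrightarrow> 0"
      using convergent_subsequence[of "\<lambda>n. x (q n) j"] x by auto
    have "bounded (range (\<lambda>n. s (q (r1 n)) j))"
      using s by (auto intro!: boundedI[of _ C])
    then obtain \<sigma> r2 where r2: "strict_mono r2" "((\<lambda>n. s (q (r1 n)) j) \<circ> r2) \<longlonglongrightarrow> \<sigma>"
      using bounded_imp_convergent_subsequence by blast
    show "\<exists>r. strict_mono r \<and> P j (q \<circ> r)"
      using r1 r2 LIMSEQ_subseq_LIMSEQ[OF r1(3) r2(1)] strict_mono_o[OF r1(1) r2(1)]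
      by (intro exI[of _ "r1 \<circ> r2"]) (auto simp: P_def o_def)
  next
    fix j and q r :: "nat \<Rightarrow> nat"
    assume "P j q" and r: "strict_mono r"
    then show "P j (q \<circ> r)"
      using LIMSEQ_subseq_LIMSEQ[OF _ r] by (fastforce simp: P_def o_def)
  next
    fix j and q :: "nat \<Rightarrow> nat" and k
    assume "P j (q \<circ> (+) k)"
    then show "P j q"
      using LIMSEQ_offset[where k = k] by (fastforce simp: P_def o_def add.commute)
  qed (rule that)
  then have "\<exists>l. l \<in> M \<and> (\<lambda>n. D (x (r n) j) l) \<longlonglongrightarrow> 0" "\<exists>\<sigma>. (\<lambda>n. s (r n) j) \<longlonglongrightarrow> \<sigma>" for j
    by (auto simp: P_def)
  then show thesis using that[OF r(1)] by metis
qed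

text \<open>Used in contraposed form: vertices that coincide at a late stage have the same limit, so
  replacing vertices by their limits is well defined.\<close>

lemma D_LIM_neq:
  assumes "\<And>n. x n \<in> M" "\<And>n. y n \<in> M" "l \<in> M" "m \<in> M" "l \<noteq> m"
    and "(\<lambda>n. D (x n) l) \<longlonglongrightarrow> 0" "(\<lambda>n. D (y n) m) \<longlonglongrightarrow> 0"
  shows "\<forall>\<^sub>F n in sequentially. x n \<noteq> y n"
proof -
  have "\<forall>\<^sub>F n in sequentially. 0 < D (x n) (y n)"
    using order_tendstoD(1)[OF D_LIM[OF assms(1-4,6,7)], of 0] mdist_pos_eq[OF assms(3,4)] assms(5)
    by simp
  then show ?thesis
    by (rule eventually_mono) (use mdist_zero[OF assms(2)] in auto)
qed

text \<open>For every \<open>R\<close> there is a nearly optimal flow with a bounded number of edges. In the limit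
  \<open>R \<rightarrow> \<infinity>\<close> its vertices can be replaced by their limit points, which leaves the points of the
  support of \<open>y\<close> fixed.\<close>

lemma c_le_sup_cR:
  assumes y: "y \<in> molecules M" and le: "\<And>R. 0 < R \<Longrightarrow> cR R y \<le> t"
  shows "c y \<le> t"
proof -
  define A where "A = keys y"
  define N where "N = 3 * card A"
  have ex: "\<exists>g f. g \<in> flows M y \<and> cost p (\<omega>R (real n + 1)) g \<le> t + 1 / (real n + 1) \<and>
      keys g \<subseteq> f ` {..<N} \<and> (\<forall>j. f j \<in> M \<times> M)" for n
  proof -
    define R where "R = real n + 1"
    have R: "0 < R" by (simp add: R_def)
    interpret T: metric_transport p "\<omega>R R" M by (rule metric_transport_\<omega>R[OF R])
    have "cR R y < t + 1 / R" using le[OF R] R by (simp add: add_increasing2 le_less_trans[of _ t])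
    then obtain g0 where g0: "g0 \<in> flows M y" "cost p (\<omega>R R) g0 < t + 1 / R"
      using T.c_approx[OF y] by blast
    obtain g where g: "g \<in> flows M y" "cost p (\<omega>R R) g \<le> cost p (\<omega>R R) g0" "card (keys g) \<le> N"
      using T.flow_few_edges[OF g0(1), of A] unfolding N_def A_def by auto
    obtain f where f: "bij_betw f {..<card (keys g)} (keys g)"
      using ex_bij_betw_nat_finite[of "keys g"] by (auto simp: lessThan_atLeast0)
    obtain b where b: "b \<in> M" using nonempty by auto
    \<comment> \<open>All stages get a list of the same length \<open>N\<close>; the pair (b, b) is
      mere padding beyond the actual edges.\<close>
    define f' where "f' j = (if j < card (keys g) then f j else (b, b))" for j
    have "keys g = f ` {..<card (keys g)}" using f by (simp add: bij_betw_def)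
    also have "\<dots> = f' ` {..<card (keys g)}" by (simp add: f'_def)
    finally have *: "keys g = f' ` {..<card (keys g)}" .
    then have "keys g \<subseteq> f' ` {..<N}" using g(3) by fastforce
    moreover have "f' j \<in> M \<times> M" for j
      using * g(1) b unfolding flows_def f'_def by auto
    ultimately show ?thesis using g g0 unfolding R_def by (intro exI[of _ g] exI[of _ f']) auto
  qed
  then obtain g f where g: "\<And>n. g n \<in> flows M y"
      and gc: "\<And>n. cost p (\<omega>R (real n + 1)) (g n) \<le> t + 1 / (real n + 1)"
      and gf: "\<And>n. keys (g n) \<subseteq> f n ` {..<N}" and f: "\<And>n j. f n j \<in> M \<times> M"
    by metis
  \<comment> \<open>The endpoints of the edges in one sequence: the vertices 2j and 2j + 1 are the
    source and the target of edge j.\<close>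
  define x where "x n i = (if even i then fst (f n (i div 2)) else snd (f n (i div 2)))" for n i
  have fx: "f n j = (x n (2 * j), x n (2 * j + 1))" for n j by (simp add: x_def)
  have xM: "x n i \<in> M" for n i using f[of n "i div 2"] by (auto simp: x_def)
  obtain r l where r: "strict_mono r" and l: "\<And>j. l j \<in> M"
      and lim: "\<And>j. (\<lambda>n. D (x (r n) j) (l j)) \<longlonglongrightarrow> 0"
    by (rule common_subsequence[of x "\<lambda>_ _. 0" 0]) (use xM in auto)
  have AM: "A \<subseteq> M"
  proof -
    obtain h where "keys h \<subseteq> M \<times> M" "y = flow h" using y by (auto simp: molecules_def)
    then have "lookup y x = 0" if "x \<notin> M" for x
      using that by (auto simp: lookup_flow intro!: sum.neutral)
    then show ?thesis by (auto simp: A_def in_keys_iff)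
  qed
  have coincide: "\<forall>\<^sub>F n in sequentially. \<forall>i\<in>{..<2*N}. \<forall>j\<in>{..<2*N}. x (r n) i = x (r n) j \<longrightarrow> l i = l j"
  proof (intro eventually_ball_finite ballI finite_lessThan)
    show "\<forall>\<^sub>F n in sequentially. x (r n) i = x (r n) j \<longrightarrow> l i = l j" for i j
      using D_LIM_neq[OF xM xM l l _ lim lim, of i j]
      by (cases "l i = l j") (auto elim: eventually_mono)
  qed
  have fixed: "\<forall>\<^sub>F n in sequentially. \<forall>i\<in>{..<2*N}. \<forall>a\<in>A. x (r n) i = a \<longrightarrow> l i = a"
  proof (intro eventually_ball_finite ballI)
    fix i a assume a: "a \<in> A"
    have "(\<lambda>n. D a a) \<longlonglongrightarrow> 0" using a AM by auto
    then show "\<forall>\<^sub>F n in sequentially. x (r n) i = a \<longrightarrow> l i = a"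
      using D_LIM_neq[of "\<lambda>n. x (r n) i" "\<lambda>_. a" "l i" a, OF xM _ l _ _ lim] a AM
      by (cases "l i = a") (auto elim: eventually_mono)
  qed (auto simp: A_def)
  \<comment> \<open>An edge that degenerates in the limit costs nothing there. Otherwise its length
    stays away from zero while the truncation level tends to infinity, so the truncated weight is
    eventually the full weight, which is continuous.\<close>
  have edges: "\<forall>\<^sub>F n in sequentially. \<forall>j\<in>{..<N}.
      \<omega> (l (2 * j), l (2 * j + 1)) \<le> (1 + \<eta>) * \<omega>R (real (r n) + 1) (f (r n) j)" if \<eta>: "0 < \<eta>" for \<eta>
  proof (intro eventually_ball_finite ballI finite_lessThan)
    fix j
    let ?u = "l (2 * j)" and ?v = "l (2 * j + 1)"
    let ?d = "\<lambda>n. D (x (r n) (2 * j)) (x (r n) (2 * j + 1))"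
    show "\<forall>\<^sub>F n in sequentially. \<omega> (?u, ?v) \<le> (1 + \<eta>) * \<omega>R (real (r n) + 1) (f (r n) j)"
    proof (cases "?u = ?v")
      case True
      then have "\<omega> (?u, ?v) = 0" using l by (simp add: \<omega>_def)
      then show ?thesis using \<eta> by (simp add: \<omega>R_def \<omega>_nonneg)
    next
      case False
      then have pos: "0 < D ?u ?v" using mdist_pos_eq[OF l l] by blast
      have d: "?d \<longlonglongrightarrow> D ?u ?v" by (rule D_LIM[OF xM xM l l lim lim])
      have "(\<lambda>n. (1 + \<eta>) * ?d n powr \<alpha>) \<longlonglongrightarrow> (1 + \<eta>) * D ?u ?v powr \<alpha>"
        using pos by (intro tendsto_intros d) auto
      moreover have "D ?u ?v powr \<alpha> < (1 + \<eta>) * D ?u ?v powr \<alpha>" using pos \<eta> by simp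
      ultimately have 1: "\<forall>\<^sub>F n in sequentially. D ?u ?v powr \<alpha> < (1 + \<eta>) * ?d n powr \<alpha>"
        by (rule order_tendstoD(1))
      have "filterlim (\<lambda>n. real (r n) + 1) at_top sequentially"
        using filterlim_compose[OF filterlim_real_sequentially filterlim_subseq[OF r]]
        by (rule filterlim_at_top_mono) auto
      then have "filterlim (\<lambda>n. ?d n * (real (r n) + 1)) at_top sequentially"
        by (rule filterlim_tendsto_pos_mult_at_top[OF d pos])
      then have 2: "\<forall>\<^sub>F n in sequentially. D ?u ?v powr \<alpha> \<le> ?d n * (real (r n) + 1)"
        by (simp add: filterlim_at_top)
      from 1 2 show ?thesis
      proof eventually_elim
        case (elim n)
        have "D ?u ?v powr \<alpha> \<le> (1 + \<eta>) * ((real (r n) + 1) * ?d n)"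
        proof -
          have "0 \<le> \<eta> * (?d n * (real (r n) + 1))" using \<eta> by simp
          then show ?thesis using elim(2) by (simp add: algebra_simps)
        qed
        then show ?case using elim(1) \<eta>
          by (simp add: \<omega>R_def \<omega>_def fx min_mult_distrib_left)
      qed
    qed
  qed
  have main: "c y \<le> (1 + \<eta>) * (t + \<eta>)" if \<eta>: "0 < \<eta>" for \<eta>
  proof -
    have "(\<lambda>n. 1 / (real (r n) + 1)) \<longlonglongrightarrow> 0"
      using LIMSEQ_subseq_LIMSEQ[OF LIMSEQ_inverse_real_of_nat r] by (simp add: o_def divide_inverse add.commute)
    then have "\<forall>\<^sub>F n in sequentially. 1 / (real (r n) + 1) < \<eta>" using \<eta> by (rule order_tendstoD)
    with coincide fixed edges[OF \<eta>] have "\<forall>\<^sub>F n in sequentially. c y \<le> (1 + \<eta>) * (t + \<eta>)"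
    proof eventually_elim
      case (elim n)
      \<comment> \<open>Sends every vertex to its limit and fixes the support of \<open>y\<close>;
        \<open>coincide\<close> and \<open>fixed\<close> make this consistent. Hence
        \<open>push \<pi>\<close> leaves \<open>y\<close> unchanged but turns the flow into one with
        limit edges.\<close>
      define \<pi> where "\<pi> z = (if z \<in> A then z else l (SOME i. i < 2 * N \<and> x (r n) i = z))" for z
      have \<pi>: "\<pi> (x (r n) i) = l i" if i: "i < 2 * N" for i
      proof (cases "x (r n) i \<in> A")
        case False
        define k where "k = (SOME k. k < 2 * N \<and> x (r n) k = x (r n) i)"
        have "k < 2 * N \<and> x (r n) k = x (r n) i" unfolding k_def using i by (intro someI) auto
        then have "l k = l i" using elim(1) i by blast
        then show ?thesis using False unfolding \<pi>_def k_def by simp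
      next
        case True
        then have "l i = x (r n) i" using elim(2) i by blast
        then show ?thesis using True unfolding \<pi>_def by simp
      qed
      let ?g = "g (r n)"
      have "\<pi> z = z" if "z \<in> keys y" for z using that unfolding \<pi>_def A_def by (rule if_P)
      then have "push \<pi> y = y" by (rule push_id)
      moreover have "y = flow ?g" using g[of "r n"] unfolding flows_def by blast
      ultimately have "y = push \<pi> (flow ?g)" by metis
      also have "\<dots> = (\<Sum>e\<in>keys ?g. lookup ?g e *\<^sub>R dipole (\<pi> (fst e)) (\<pi> (snd e)))" by (rule push_flow)
      finally have y_eq: "y = \<dots>" .
      have e: "\<pi> (fst e) \<in> M \<and> \<pi> (snd e) \<in> M \<and>
          \<omega> (\<pi> (fst e), \<pi> (snd e)) \<le> (1 + \<eta>) * \<omega>R (real (r n) + 1) e" if "e \<in> keys ?g" for e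
      proof -
        from that gf[of "r n"] obtain j where j: "j < N" "e = f (r n) j" by auto
        have "\<pi> (fst e) = l (2 * j)" "\<pi> (snd e) = l (2 * j + 1)"
          unfolding j(2) fx using j(1) by (simp_all add: \<pi>)
        then show ?thesis using bspec[OF elim(3), of j] j l by simp
      qed
      have "c y \<le> (\<Sum>e\<in>keys ?g. c (lookup ?g e *\<^sub>R dipole (\<pi> (fst e)) (\<pi> (snd e))))"
        unfolding y_eq using e
        by (intro c_sum subspace_scale[OF subspace_molecules] dipole_in_molecules) auto
      also have "\<dots> \<le> (\<Sum>e\<in>keys ?g. \<bar>lookup ?g e\<bar> powr p * ((1 + \<eta>) * \<omega>R (real (r n) + 1) e))"
        using e by (intro sum_mono order_trans[OF c_dipole] mult_left_mono) auto
      also have "\<dots> = (1 + \<eta>) * cost p (\<omega>R (real (r n) + 1)) ?g"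
        by (simp add: cost_def sum_distrib_left mult_ac)
      also have "\<dots> \<le> (1 + \<eta>) * (t + \<eta>)"
        using gc[of "r n"] elim(4) \<eta> by (intro mult_left_mono) auto
      finally show ?case .
    qed
    then show ?thesis by simp
  qed
  have "((\<lambda>\<eta>. (1 + \<eta>) * (t + \<eta>)) \<longlongrightarrow> (1 + 0) * (t + 0)) (at_right (0::real))"
    by (intro tendsto_intros)
  moreover have "\<forall>\<^sub>F \<eta> in at_right (0::real). c y \<le> (1 + \<eta>) * (t + \<eta>)"
    using main by (auto simp: eventually_at_right_less intro: eventually_mono[OF eventually_at_right_less])
  ultimately show ?thesis
    using tendsto_lowerbound by fastforce
qed

end

section \<open>Truncated costs of sums of many dipoles\<close>

abbreviation dip :: "'a \<times> 'a \<Rightarrow> 'a \<Rightarrow>\<^sub>0 real" where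
  "dip e \<equiv> dipole (fst e) (snd e)"

context transport begin

lemma sum_dip_in_molecules:
  "(\<And>i. i \<in> I \<Longrightarrow> e i \<in> M \<times> M) \<Longrightarrow> (\<Sum>i\<in>I. a i *\<^sub>R dip (e i)) \<in> molecules M"
  by (intro subspace_sum[OF subspace_molecules] subspace_scale[OF subspace_molecules]
      dipole_in_molecules) (auto simp: mem_Times_iff)

lemma c_sum_dip:
  assumes "\<And>i. i \<in> I \<Longrightarrow> e i \<in> M \<times> M"
  shows "c (\<Sum>i\<in>I. a i *\<^sub>R dip (e i)) \<le> (\<Sum>i\<in>I. \<bar>a i\<bar> powr p * w (e i))"
proof -
  have "c (\<Sum>i\<in>I. a i *\<^sub>R dip (e i)) \<le> (\<Sum>i\<in>I. c (a i *\<^sub>R dip (e i)))"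
    using assms by (intro c_sum subspace_scale[OF subspace_molecules] dipole_in_molecules)
      (auto simp: mem_Times_iff)
  also have "\<dots> \<le> (\<Sum>i\<in>I. \<bar>a i\<bar> powr p * w (e i))"
  proof (rule sum_mono)
    fix i assume "i \<in> I"
    then show "c (a i *\<^sub>R dip (e i)) \<le> \<bar>a i\<bar> powr p * w (e i)"
      using assms[of i] c_dipole[of "fst (e i)" "snd (e i)" "a i"] by (simp add: mem_Times_iff)
  qed
  finally show ?thesis .
qed

end

context snowflake begin

text \<open>Dividing by D^\<alpha> turns the assumption into a lower bound \<epsilon>/R for
  D^(1-\<alpha>). So an edge on which truncation saves little has weight above a threshold
  independent of the edge.\<close>

lemma big_edge:
  assumes "0 < R" "0 < \<epsilon>" "\<epsilon> * \<omega> e < R * D (fst e) (snd e)"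
  shows "(\<epsilon> / R) powr (\<alpha> / (1 - \<alpha>)) \<le> \<omega> e"
proof -
  let ?d = "D (fst e) (snd e)"
  have "?d \<noteq> 0"
  proof
    assume "?d = 0"
    then show False using assms by (simp add: \<omega>_def)
  qed
  then have d: "0 < ?d" using nonneg[of "fst e" "snd e"] by linarith
  have "?d powr \<alpha> * ?d powr (1 - \<alpha>) = ?d" using d by (simp flip: powr_add)
  then have "\<epsilon> * ?d powr \<alpha> < R * ?d powr (1 - \<alpha>) * ?d powr \<alpha>"
    using assms(3) by (simp add: \<omega>_def mult_ac)
  then have "\<epsilon> / R \<le> ?d powr (1 - \<alpha>)" using d assms(1) by (simp add: field_simps)
  then have "(\<epsilon> / R) powr (\<alpha> / (1 - \<alpha>)) \<le> (?d powr (1 - \<alpha>)) powr (\<alpha> / (1 - \<alpha>))"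
    using assms \<alpha> by (intro powr_mono2) auto
  also have "\<dots> = \<omega> e" using \<alpha> by (simp add: powr_powr \<omega>_def)
  finally show ?thesis .
qed

lemma finite_net:
  assumes "0 < \<eta>"
  obtains Z \<nu> where "finite Z" "Z \<subseteq> M" "\<And>x. x \<in> M \<Longrightarrow> \<nu> x \<in> Z \<and> \<omega> (x, \<nu> x) \<le> \<eta>"
proof -
  have tot: "mtotally_bounded M"
    using compact unfolding compact_space_eq_mcomplete_mtotally_bounded by blast
  have "0 < \<eta> powr (1 / \<alpha>)" using assms by simp
  from tot[unfolded mtotally_bounded_def, rule_format, OF this]
  obtain Z where Z: "finite Z" "Z \<subseteq> M" "M \<subseteq> (\<Union>x\<in>Z. mball x (\<eta> powr (1 / \<alpha>)))"
    by (elim exE conjE)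
  have "\<exists>z\<in>Z. \<omega> (x, z) \<le> \<eta>" if x: "x \<in> M" for x
  proof -
    from subsetD[OF Z(3) x] obtain z where z: "z \<in> Z" "x \<in> mball z (\<eta> powr (1 / \<alpha>))"
      by (rule UN_E)
    then have "\<omega> (x, z) \<le> (\<eta> powr (1 / \<alpha>)) powr \<alpha>"
      unfolding \<omega>_def using \<alpha> by (intro powr_mono2) (auto simp: commute in_mball)
    also have "\<dots> = \<eta>" using \<alpha> assms by (simp add: powr_powr)
    finally show ?thesis using z by blast
  qed
  then obtain \<nu> where "\<And>x. x \<in> M \<Longrightarrow> \<nu> x \<in> Z \<and> \<omega> (x, \<nu> x) \<le> \<eta>" by metis
  with Z that show thesis by blast
qed

text \<open>Since \<open>p < 1\<close>, a combination of many unit dipoles with small coefficients is small if all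
  dipoles are close to multiples of a few of them. With respect to \<open>\<omega>R R\<close> this is so: short
  dipoles are small, and the endpoints of long ones can be moved to a finite net.\<close>

lemma cR_sum_dip_le:
  assumes R: "0 < R" and \<epsilon>: "0 < \<epsilon>"
  obtains K where "0 \<le> K" "\<And>(I :: nat set) a e. finite I \<Longrightarrow> (\<And>i. i \<in> I \<Longrightarrow> e i \<in> M \<times> M) \<Longrightarrow>
    cR R (\<Sum>i\<in>I. a i *\<^sub>R dip (e i)) \<le>
      \<epsilon> * (\<Sum>i\<in>I. \<bar>a i\<bar> powr p * \<omega> (e i)) + K * (\<Sum>i\<in>I. \<bar>a i\<bar> * \<omega> (e i) powr (1 / p)) powr p"
proof -
  interpret T: metric_transport p "\<omega>R R" M by (rule metric_transport_\<omega>R[OF R])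
  define w0 where "w0 = (\<epsilon> / R) powr (\<alpha> / (1 - \<alpha>))"
  have w0: "0 < w0" using \<epsilon> R by (simp add: w0_def)
  \<comment> \<open>A long edge weighs at least \<open>w0\<close>, so moving either endpoint to the
    net costs at most \<epsilon>/2 times the weight of the edge.\<close>
  obtain Z \<nu> where Z: "finite Z" "Z \<subseteq> M"
    and \<nu>: "\<And>x. x \<in> M \<Longrightarrow> \<nu> x \<in> Z \<and> \<omega> (x, \<nu> x) \<le> \<epsilon> * w0 / 2"
    using finite_net[of "\<epsilon> * w0 / 2"] \<epsilon> w0 by auto
  \<comment> \<open>After rounding, each net pair carries a coefficient of modulus at most
    \<open>w0 powr (- 1 / p) * s\<close>, where \<open>s\<close> is the l_1 sum defined below;
    \<open>K\<close> collects the cost of finitely many such pairs.\<close>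
  define K where "K = (\<Sum>z\<in>Z \<times> Z. \<omega> z) * (w0 powr (- 1 / p)) powr p"
  show thesis
  proof (rule that[of K])
    show "0 \<le> K" by (simp add: K_def sum_nonneg \<omega>_nonneg)
    fix I :: "nat set" and a :: "nat \<Rightarrow> real" and e
    assume I: "finite I" and e: "\<And>i. i \<in> I \<Longrightarrow> e i \<in> M \<times> M"
    define S where "S = {i \<in> I. R * D (fst (e i)) (snd (e i)) \<le> \<epsilon> * \<omega> (e i)}"
    define B where "B = I - S"
    have IS: "I = S \<union> B" "S \<inter> B = {}" "finite S" "finite B" using I by (auto simp: S_def B_def)
    have eS: "e i \<in> M \<times> M" if "i \<in> S" for i using that e by (auto simp: S_def)
    have eB: "e i \<in> M \<times> M" "fst (e i) \<in> M" "snd (e i) \<in> M" "w0 \<le> \<omega> (e i)" if "i \<in> B" for i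
      using that e[of i] big_edge[OF R \<epsilon>, of "e i"] by (auto simp: S_def B_def w0_def)
    define e1 e2 e3 where "e1 i = (fst (e i), \<nu> (fst (e i)))" and "e2 i = (\<nu> (snd (e i)), snd (e i))"
      and "e3 i = (\<nu> (fst (e i)), \<nu> (snd (e i)))" for i
    have \<nu>M: "\<nu> x \<in> M" if "x \<in> M" for x using \<nu>[OF that] Z by auto
    have e123: "e1 i \<in> M \<times> M" "e2 i \<in> M \<times> M" "e3 i \<in> M \<times> M" "e3 i \<in> Z \<times> Z" if "i \<in> B" for i
      using eB[OF that] \<nu>M \<nu> by (auto simp: e1_def e2_def e3_def)
    define b where "b z = (\<Sum>i\<in>{i \<in> B. e3 i = z}. a i)" for z
    have "e3 ` B \<subseteq> Z \<times> Z" using e123(4) by blast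
    then have "(\<Sum>i\<in>B. a i *\<^sub>R dip (e3 i)) = (\<Sum>z\<in>Z \<times> Z. \<Sum>i\<in>{i \<in> B. e3 i = z}. a i *\<^sub>R dip (e3 i))"
      using Z(1) IS(4) by (intro sum.group[symmetric] finite_cartesian_product)
    also have "\<dots> = (\<Sum>z\<in>Z \<times> Z. b z *\<^sub>R dip z)"
      by (intro sum.cong) (auto simp: b_def scaleR_sum_left)
    finally have e3: "(\<Sum>i\<in>B. a i *\<^sub>R dip (e3 i)) = (\<Sum>z\<in>Z \<times> Z. b z *\<^sub>R dip z)" .
    have split: "dip (e i) = dip (e1 i) + dip (e2 i) + dip (e3 i)" for i
      by (simp add: dipole_def e1_def e2_def e3_def)
    let ?X1 = "\<Sum>i\<in>S. a i *\<^sub>R dip (e i)" and ?X2 = "\<Sum>i\<in>B. a i *\<^sub>R dip (e1 i)"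
      and ?X3 = "\<Sum>i\<in>B. a i *\<^sub>R dip (e2 i)" and ?X4 = "\<Sum>z\<in>Z \<times> Z. b z *\<^sub>R dip z"
    have "(\<Sum>i\<in>I. a i *\<^sub>R dip (e i)) = ?X1 + (\<Sum>i\<in>B. a i *\<^sub>R dip (e i))"
      unfolding IS(1) using IS by (intro sum.union_disjoint) auto
    also have "\<dots> = ?X1 + (?X2 + (?X3 + ?X4))"
      by (simp add: split scaleR_add_right sum.distrib e3)
    finally have eq: "(\<Sum>i\<in>I. a i *\<^sub>R dip (e i)) = ?X1 + (?X2 + (?X3 + ?X4))" .
    have mol: "?X1 \<in> molecules M" "?X2 \<in> molecules M" "?X3 \<in> molecules M" "?X4 \<in> molecules M"
      using eS e123 Z by (auto intro!: sum_dip_in_molecules)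
    have 1: "cR R ?X1 \<le> \<epsilon> * (\<Sum>i\<in>S. \<bar>a i\<bar> powr p * \<omega> (e i))"
    proof -
      have "cR R ?X1 \<le> (\<Sum>i\<in>S. \<bar>a i\<bar> powr p * \<omega>R R (e i))" by (rule T.c_sum_dip[OF eS])
      also have "\<dots> \<le> (\<Sum>i\<in>S. \<bar>a i\<bar> powr p * (\<epsilon> * \<omega> (e i)))"
        by (intro sum_mono mult_left_mono order_trans[OF \<omega>R_le(2)]) (auto simp: S_def)
      finally show ?thesis by (simp add: sum_distrib_left mult_ac)
    qed
    have 23: "cR R (\<Sum>i\<in>B. a i *\<^sub>R dip (f i)) \<le> (\<epsilon> / 2) * (\<Sum>i\<in>B. \<bar>a i\<bar> powr p * \<omega> (e i))"
      if f: "\<And>i. i \<in> B \<Longrightarrow> f i \<in> M \<times> M \<and> \<omega> (f i) \<le> \<epsilon> * w0 / 2" for f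
    proof -
      have "cR R (\<Sum>i\<in>B. a i *\<^sub>R dip (f i)) \<le> (\<Sum>i\<in>B. \<bar>a i\<bar> powr p * \<omega>R R (f i))"
        using f by (intro T.c_sum_dip) auto
      also have "\<dots> \<le> (\<Sum>i\<in>B. \<bar>a i\<bar> powr p * ((\<epsilon> / 2) * \<omega> (e i)))"
      proof (intro sum_mono mult_left_mono)
        fix i assume i: "i \<in> B"
        have "\<omega>R R (f i) \<le> \<epsilon> / 2 * w0" using \<omega>R_le(1)[of R "f i"] f[OF i] by simp
        also have "\<dots> \<le> \<epsilon> / 2 * \<omega> (e i)" using eB(4)[OF i] \<epsilon> by (intro mult_left_mono) auto
        finally show "\<omega>R R (f i) \<le> \<epsilon> / 2 * \<omega> (e i)" .
      qed auto
      finally show ?thesis by (simp add: sum_distrib_left sum_divide_distrib mult_ac)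
    qed
    have 2: "cR R ?X2 \<le> (\<epsilon> / 2) * (\<Sum>i\<in>B. \<bar>a i\<bar> powr p * \<omega> (e i))"
      by (rule 23) (use e123 eB \<nu> in \<open>auto simp: e1_def\<close>)
    have 3: "cR R ?X3 \<le> (\<epsilon> / 2) * (\<Sum>i\<in>B. \<bar>a i\<bar> powr p * \<omega> (e i))"
    proof (rule 23)
      fix i assume i: "i \<in> B"
      have "\<omega> (e2 i) = \<omega> (snd (e i), \<nu> (snd (e i)))" by (simp add: e2_def \<omega>_def commute)
      then show "e2 i \<in> M \<times> M \<and> \<omega> (e2 i) \<le> \<epsilon> * w0 / 2"
        using e123(2)[OF i] eB(3)[OF i] \<nu> by auto
    qed
    define s where "s = (\<Sum>i\<in>I. \<bar>a i\<bar> * \<omega> (e i) powr (1 / p))"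
    \<comment> \<open>Coefficients on the same net pair are added before the p-th power is taken,
      which is the source of the l_1 sum; \<open>w0 \<le> \<omega> (e i)\<close> allows the weight
      to be inserted.\<close>
    have b: "\<bar>b z\<bar> \<le> w0 powr (- 1 / p) * s" for z
    proof -
      have "\<bar>b z\<bar> \<le> (\<Sum>i\<in>{i \<in> B. e3 i = z}. \<bar>a i\<bar>)" unfolding b_def by (rule sum_abs)
      also have "\<dots> \<le> (\<Sum>i\<in>B. \<bar>a i\<bar>)" using IS by (intro sum_mono2) auto
      also have "\<dots> \<le> (\<Sum>i\<in>B. w0 powr (- 1 / p) * (\<bar>a i\<bar> * \<omega> (e i) powr (1 / p)))"
      proof (rule sum_mono)
        fix i assume i: "i \<in> B"
        have "w0 powr (- 1 / p) * w0 powr (1 / p) = 1" using w0 by (simp flip: powr_add)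
        moreover have "w0 powr (1 / p) \<le> \<omega> (e i) powr (1 / p)"
          using w0 eB(4)[OF i] p by (intro powr_mono2) auto
        ultimately have "1 \<le> w0 powr (- 1 / p) * \<omega> (e i) powr (1 / p)"
          by (metis mult_left_mono powr_ge_zero)
        then show "\<bar>a i\<bar> \<le> w0 powr (- 1 / p) * (\<bar>a i\<bar> * \<omega> (e i) powr (1 / p))"
          using mult_left_mono[of 1 _ "\<bar>a i\<bar>"] by (fastforce simp: mult_ac)
      qed
      also have "\<dots> \<le> (\<Sum>i\<in>I. w0 powr (- 1 / p) * (\<bar>a i\<bar> * \<omega> (e i) powr (1 / p)))"
        using I by (intro sum_mono2) (auto simp: B_def)
      finally show ?thesis by (simp add: s_def sum_distrib_left)
    qed
    have s: "0 \<le> s" unfolding s_def by (intro sum_nonneg) auto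
    have "cR R ?X4 \<le> (\<Sum>z\<in>Z \<times> Z. \<bar>b z\<bar> powr p * \<omega>R R z)"
      using Z by (intro T.c_sum_dip) auto
    also have "\<dots> \<le> (\<Sum>z\<in>Z \<times> Z. (w0 powr (- 1 / p) * s) powr p * \<omega> z)"
      using b p \<omega>R_le(1) T.w_nonneg by (intro sum_mono mult_mono powr_mono2) auto
    also have "\<dots> = K * s powr p"
      using s w0 by (simp add: K_def powr_mult sum_distrib_left sum_distrib_right mult_ac)
    finally have 4: "cR R ?X4 \<le> K * s powr p" .
    have "cR R (\<Sum>i\<in>I. a i *\<^sub>R dip (e i)) \<le> cR R ?X1 + (cR R ?X2 + (cR R ?X3 + cR R ?X4))"
      unfolding eq using mol
      by (intro order_trans[OF T.c_add] add_mono order_refl subspace_add[OF subspace_molecules])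
    also have "\<dots> \<le> \<epsilon> * (\<Sum>i\<in>S. \<bar>a i\<bar> powr p * \<omega> (e i)) + \<epsilon> * (\<Sum>i\<in>B. \<bar>a i\<bar> powr p * \<omega> (e i))
        + K * s powr p"
      using 1 2 3 4 by simp
    also have "\<dots> = \<epsilon> * (\<Sum>i\<in>I. \<bar>a i\<bar> powr p * \<omega> (e i)) + K * s powr p"
      unfolding IS(1) using IS
      by (subst sum.union_disjoint) (auto simp: distrib_left)
    finally show "cR R (\<Sum>i\<in>I. a i *\<^sub>R dip (e i)) \<le>
      \<epsilon> * (\<Sum>i\<in>I. \<bar>a i\<bar> powr p * \<omega> (e i)) +
        K * (\<Sum>i\<in>I. \<bar>a i\<bar> * \<omega> (e i) powr (1 / p)) powr p" by (simp add: s_def)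
  qed
qed

text \<open>With b_j the cost of the j-th term, the l_1 sum in \<open>cR_sum_dip_le\<close> has
  terms b_j^(1/p). Since b_j \<le> C/(j+1) and the b_j have sum at most C, its tail tends to zero,
  uniformly over all representations with these bounds.\<close>

lemma cR_tail:
  assumes R: "0 < R" and \<epsilon>: "0 < \<epsilon>" and C: "0 \<le> C"
  shows "\<exists>J0. \<forall>J\<ge>J0. \<forall>k a e. (\<forall>j. e j \<in> M \<times> M) \<longrightarrow>
    (\<forall>j. \<bar>a j\<bar> powr p * \<omega> (e j) \<le> C / (real j + 1)) \<longrightarrow>
    (\<forall>k. (\<Sum>j<k. \<bar>a j\<bar> powr p * \<omega> (e j)) \<le> C) \<longrightarrow>
    cR R (\<Sum>j\<in>{J..<k}. a j *\<^sub>R dip (e j)) \<le> \<epsilon>"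
proof -
  define \<delta> where "\<delta> = \<epsilon> / (2 * (C + 1))"
  have \<delta>: "0 < \<delta>" using \<epsilon> C by (simp add: \<delta>_def)
  obtain K where K: "0 \<le> K" and bound: "\<And>(I :: nat set) a e. finite I \<Longrightarrow> (\<And>i. i \<in> I \<Longrightarrow> e i \<in> M \<times> M) \<Longrightarrow>
    cR R (\<Sum>i\<in>I. a i *\<^sub>R dip (e i)) \<le>
      \<delta> * (\<Sum>i\<in>I. \<bar>a i\<bar> powr p * \<omega> (e i)) + K * (\<Sum>i\<in>I. \<bar>a i\<bar> * \<omega> (e i) powr (1 / p)) powr p"
    using cR_sum_dip_le[OF R \<delta>] by blast
  \<comment> \<open>The spare exponent in b^(1/p) = b b^\<gamma>; it is positive because p < 1 and
    makes the factor b^\<gamma> small in the tail.\<close>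
  define \<gamma> where "\<gamma> = 1 / p - 1"
  have \<gamma>: "0 < \<gamma>" using p01 by (simp add: \<gamma>_def)
  define t where "t J = C * (C / (real J + 1)) powr \<gamma>" for J
  have "(\<lambda>J. C / (real J + 1)) \<longlonglongrightarrow> 0"
    using LIMSEQ_Suc[OF lim_const_over_n[of C]] by (simp add: add.commute)
  then have "(\<lambda>J. K * (C * (C / (real J + 1)) powr \<gamma>) powr p) \<longlonglongrightarrow> K * (C * 0 powr \<gamma>) powr p"
    using C \<gamma> p by (intro tendsto_intros tendsto_powr2) (auto intro!: always_eventually)
  then have "\<forall>\<^sub>F J in sequentially. K * t J powr p < \<epsilon> / 2"
    unfolding t_def using \<epsilon> by (intro order_tendstoD(2)) auto
  then obtain J0 where J0: "\<And>J. J0 \<le> J \<Longrightarrow> K * t J powr p < \<epsilon> / 2"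
    by (auto simp: eventually_sequentially)
  show ?thesis
  proof (intro exI[of _ J0] allI impI)
    fix J k a e
    assume J: "J0 \<le> J" and e: "\<forall>j. e j \<in> M \<times> M"
      and "\<forall>j. \<bar>a j\<bar> powr p * \<omega> (e j) \<le> C / (real j + 1)"
      and "\<forall>k. (\<Sum>j<k. \<bar>a j\<bar> powr p * \<omega> (e j)) \<le> C"
    then have dec: "\<bar>a j\<bar> powr p * \<omega> (e j) \<le> C / (real j + 1)"
      and tot: "(\<Sum>j<k. \<bar>a j\<bar> powr p * \<omega> (e j)) \<le> C" for j k by blast+
    let ?b = "\<lambda>j. \<bar>a j\<bar> powr p * \<omega> (e j)"
    have b0: "0 \<le> ?b j" for j by (simp add: \<omega>_nonneg)
    have "(\<Sum>j\<in>{J..<k}. ?b j) \<le> (\<Sum>j<k. ?b j)" using b0 by (intro sum_mono2) auto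
    then have tot': "(\<Sum>j\<in>{J..<k}. ?b j) \<le> C" using tot[of k] by simp
    have "(\<Sum>j\<in>{J..<k}. \<bar>a j\<bar> * \<omega> (e j) powr (1 / p)) \<le> (\<Sum>j\<in>{J..<k}. ?b j * (C / (real J + 1)) powr \<gamma>)"
    proof (rule sum_mono)
      fix j assume j: "j \<in> {J..<k}"
      have "\<bar>a j\<bar> * \<omega> (e j) powr (1 / p) = ?b j powr (1 / p)"
        using p \<omega>_nonneg by (simp add: powr_mult powr_powr)
      also have "\<dots> = ?b j powr (1 + \<gamma>)" by (simp add: \<gamma>_def)
      also have "\<dots> = ?b j * ?b j powr \<gamma>" using b0[of j] by (simp add: powr_add)
      also have "\<dots> \<le> ?b j * (C / (real J + 1)) powr \<gamma>"
      proof (intro mult_left_mono powr_mono2 b0)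
        have "C / (real j + 1) \<le> C / (real J + 1)" using j C by (intro divide_left_mono) auto
        then show "?b j \<le> C / (real J + 1)" using dec[of j] by linarith
      qed (use \<gamma> in auto)
      finally show "\<bar>a j\<bar> * \<omega> (e j) powr (1 / p) \<le> ?b j * (C / (real J + 1)) powr \<gamma>" .
    qed
    also have "\<dots> \<le> t J"
      using tot' by (simp add: t_def mult_right_mono flip: sum_distrib_right)
    finally have s: "(\<Sum>j\<in>{J..<k}. \<bar>a j\<bar> * \<omega> (e j) powr (1 / p)) \<le> t J" .
    have "cR R (\<Sum>j\<in>{J..<k}. a j *\<^sub>R dip (e j)) \<le> \<delta> * (\<Sum>j\<in>{J..<k}. ?b j)
        + K * (\<Sum>j\<in>{J..<k}. \<bar>a j\<bar> * \<omega> (e j) powr (1 / p)) powr p"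
      using e by (intro bound) auto
    also have "\<dots> \<le> \<delta> * (C + 1) + K * t J powr p"
      using tot' \<delta> K s p by (intro add_mono mult_left_mono powr_mono2) (auto intro!: sum_nonneg)
    also have "\<delta> * (C + 1) = \<epsilon> / 2" using C by (simp add: \<delta>_def field_simps)
    also have "\<epsilon> / 2 + K * t J powr p \<le> \<epsilon>" using J0[OF J] by simp
    finally show "cR R (\<Sum>j\<in>{J..<k}. a j *\<^sub>R dip (e j)) \<le> \<epsilon>" .
  qed
qed

text \<open>A finite combination is padded by zero coefficients to an infinite sequence, so that
  representations of different lengths can converge term by term. Ordering by cost yields the decay
  that \<open>cR_tail\<close> requires.\<close>

definition decreasing_rep ::
  "real \<Rightarrow> ('m \<Rightarrow>\<^sub>0 real) \<Rightarrow> (nat \<Rightarrow> real) \<Rightarrow> (nat \<Rightarrow> 'm \<times> 'm) \<Rightarrow> nat \<Rightarrow> bool" where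
  "decreasing_rep C \<xi> a e k \<longleftrightarrow>
     (\<forall>j. e j \<in> M \<times> M) \<and> (\<forall>j\<ge>k. a j = 0) \<and> \<xi> = (\<Sum>j<k. a j *\<^sub>R dip (e j)) \<and>
     (\<Sum>j<k. \<bar>a j\<bar> powr p * \<omega> (e j)) \<le> C \<and>
     (\<forall>i j. i \<le> j \<longrightarrow> \<bar>a j\<bar> powr p * \<omega> (e j) \<le> \<bar>a i\<bar> powr p * \<omega> (e i))"

lemma decreasing_representation:
  assumes \<xi>: "\<xi> \<in> molecules M" and \<epsilon>: "0 < \<epsilon>"
  shows "\<exists>a e k. decreasing_rep (c \<xi> + \<epsilon>) \<xi> a e k"
proof -
  obtain g where g: "g \<in> flows M \<xi>" "cost p \<omega> g < c \<xi> + \<epsilon>"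
    using c_approx[OF \<xi>, of "c \<xi> + \<epsilon>"] \<epsilon> by auto
  define k where "k = card (keys g)"
  define h where "h e = \<bar>lookup g e\<bar> powr p * \<omega> e" for e
  obtain f where f: "bij_betw f {..<k} (keys g)" "\<And>i j. i \<le> j \<Longrightarrow> j < k \<Longrightarrow> h (f j) \<le> h (f i)"
    unfolding k_def by (rule decreasing_enumeration[of "keys g" h]) auto
  obtain b where b: "b \<in> M" using nonempty by auto
  define e where "e j = (if j < k then f j else (b, b))" for j
  define a where "a j = (if j < k then lookup g (f j) else 0)" for j
  have fk: "f j \<in> keys g" if "j < k" for j using f(1) that by (auto simp: bij_betw_def)
  have "decreasing_rep (c \<xi> + \<epsilon>) \<xi> a e k"
    unfolding decreasing_rep_def
  proof (intro conjI allI impI)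
    show "e j \<in> M \<times> M" for j
      using fk[of j] g(1) b by (auto simp: e_def flows_def)
    show "a j = 0" if "k \<le> j" for j using that by (simp add: a_def)
    have "\<xi> = (\<Sum>e\<in>keys g. lookup g e *\<^sub>R dip e)" using g(1) by (simp add: flows_def flow_def)
    also have "\<dots> = (\<Sum>j<k. lookup g (f j) *\<^sub>R dip (f j))"
      by (rule sum.reindex_bij_betw[OF f(1), symmetric])
    finally show "\<xi> = (\<Sum>j<k. a j *\<^sub>R dip (e j))" by (simp add: a_def e_def)
    have "(\<Sum>j<k. \<bar>a j\<bar> powr p * \<omega> (e j)) = (\<Sum>j<k. h (f j))" by (simp add: a_def e_def h_def)
    also have "\<dots> = cost p \<omega> g"
      unfolding cost_def h_def by (rule sum.reindex_bij_betw[OF f(1)])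
    finally show "(\<Sum>j<k. \<bar>a j\<bar> powr p * \<omega> (e j)) \<le> c \<xi> + \<epsilon>" using g(2) by simp
    show "\<bar>a j\<bar> powr p * \<omega> (e j) \<le> \<bar>a i\<bar> powr p * \<omega> (e i)" if "i \<le> j" for i j
      using f(2)[OF that] that p by (auto simp: a_def e_def h_def \<omega>_nonneg)
  qed
  then show ?thesis by blast
qed

text \<open>Along a subsequence the decreasing representations converge termwise. The terms with a
  nondegenerate limit converge in norm and sum up to \<open>\<eta>\<close>, up to a small rest; the terms whose
  dipole shrinks to a point vanish with respect to every \<open>\<omega>R R\<close>.\<close>

lemma extract_limit:
  fixes \<xi> :: "nat \<Rightarrow> 'm \<Rightarrow>\<^sub>0 real"
  assumes mol: "\<And>n. \<xi> n \<in> molecules M" and C: "\<And>n. c (\<xi> n) \<le> C" and \<epsilon>: "0 < \<epsilon>"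
  shows "\<exists>r \<eta>. strict_mono (r :: nat \<Rightarrow> nat) \<and> \<eta> \<in> molecules M \<and>
    (\<forall>R>0. \<forall>\<^sub>F n in sequentially. cR R (\<xi> (r n) - \<eta>) \<le> \<epsilon>) \<and>
    (\<forall>\<^sub>F n in sequentially. c \<eta> + c (\<xi> (r n) - \<eta>) \<le> c (\<xi> (r n)) + \<epsilon>)"
proof -
  have "\<exists>a e k. decreasing_rep (c (\<xi> n) + inverse (real (Suc n))) (\<xi> n) a e k" for n
    by (intro decreasing_representation mol) simp
  then obtain a e k where
    "\<And>n. decreasing_rep (c (\<xi> n) + inverse (real (Suc n))) (\<xi> n) (a n) (e n) (k n)"
    by metis
  then have e: "\<And>n j. e n j \<in> M \<times> M" and k: "\<And>n j. k n \<le> j \<Longrightarrow> a n j = 0"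
    and \<xi>: "\<And>n. \<xi> n = (\<Sum>j<k n. a n j *\<^sub>R dip (e n j))"
    and cost: "\<And>n. (\<Sum>j<k n. \<bar>a n j\<bar> powr p * \<omega> (e n j)) \<le> c (\<xi> n) + inverse (real (Suc n))"
    and dec: "\<And>n i j. i \<le> j \<Longrightarrow> \<bar>a n j\<bar> powr p * \<omega> (e n j) \<le> \<bar>a n i\<bar> powr p * \<omega> (e n i)"
    unfolding decreasing_rep_def by blast+
  define B where "B n j = \<bar>a n j\<bar> powr p * \<omega> (e n j)" for n j
  have B0: "0 \<le> B n j" for n j by (simp add: B_def \<omega>_nonneg)
  have Bk: "B n j = 0" if "k n \<le> j" for n j using k[OF that] by (simp add: B_def)
  have sumk: "(\<Sum>j<m. f j) = (\<Sum>j<k n. f j)"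
    if "k n \<le> m" "\<And>j. k n \<le> j \<Longrightarrow> f j = 0" for f :: "nat \<Rightarrow> 'z::comm_monoid_add" and m n
    using that by (intro sum.mono_neutral_right) auto
  define C' where "C' = C + 1"
  have C'0: "0 \<le> C'" using order_trans[OF c_nonneg[OF mol] C] by (simp add: C'_def)
  have inv1: "inverse (real (Suc n)) \<le> 1" for n by (simp add: field_simps)
  have Btot: "(\<Sum>j<m. B n j) \<le> C'" for n m
  proof -
    have "(\<Sum>j<m. B n j) \<le> (\<Sum>j<max m (k n). B n j)" using B0 by (intro sum_mono2) auto
    also have "\<dots> = (\<Sum>j<k n. B n j)" using Bk by (intro sumk) auto
    also have "\<dots> \<le> C'" using cost[of n] C[of n] inv1[of n] by (simp add: B_def C'_def)
    finally show ?thesis .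
  qed
  \<comment> \<open>The first j + 1 terms are all at least as large as term j and have sum at most
    C'.\<close>
  have Bdec: "B n j \<le> C' / (real j + 1)" for n j
  proof -
    have "(real j + 1) * B n j = (\<Sum>i<Suc j. B n j)" by simp
    also have "\<dots> \<le> (\<Sum>i<Suc j. B n i)" using dec by (intro sum_mono) (auto simp: B_def)
    also have "\<dots> \<le> C'" by (rule Btot)
    finally show ?thesis by (simp add: field_simps)
  qed
  \<comment> \<open>The coefficients \<open>a\<close> may be unbounded when edges shrink. Normalised
    by the weight they are bounded by C'^(1/p), and \<open>a\<close> is recovered in the limit for
    nondegenerate edges.\<close>
  define s where "s n j = a n j * \<omega> (e n j) powr (1 / p)" for n j
  have s_bound: "\<bar>s n j\<bar> \<le> C' powr (1 / p)" for n j
  proof -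
    have "\<bar>s n j\<bar> = B n j powr (1 / p)"
      using p \<omega>_nonneg by (simp add: s_def B_def abs_mult powr_mult powr_powr)
    also have "B n j \<le> C'"
      using Btot[of n "Suc j"] member_le_sum[of j "{..<Suc j}" "B n"] B0 by simp
    then have "B n j powr (1 / p) \<le> C' powr (1 / p)" using B0 p by (intro powr_mono2) auto
    finally show ?thesis .
  qed
  define x where "x n i = (if even i then fst (e n (i div 2)) else snd (e n (i div 2)))" for n i
  have ex: "e n j = (x n (2 * j), x n (2 * j + 1))" for n j by (simp add: x_def)
  have xM: "x n i \<in> M" for n i using e[of n "i div 2"] by (auto simp: x_def mem_Times_iff)
  \<comment> \<open>One extraction serves points and numbers. It is indexed by vertices, so the
    coefficient of edge \<open>i div 2\<close> is listed at both of its endpoints.\<close>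
  obtain r l \<sigma> where r: "strict_mono r" and l: "\<And>j. l j \<in> M"
    and lim: "\<And>j. (\<lambda>n. D (x (r n) j) (l j)) \<longlonglongrightarrow> 0"
    and slim': "\<And>i. (\<lambda>n. s (r n) (i div 2)) \<longlonglongrightarrow> \<sigma> i"
    by (rule common_subsequence[of x "\<lambda>n i. s n (i div 2)" "C' powr (1 / p)"]) (use xM s_bound in auto)
  have slim: "(\<lambda>n. s (r n) j) \<longlonglongrightarrow> \<sigma> (2 * j)" for j using slim'[of "2 * j"] by simp
  define e' where "e' j = (l (2 * j), l (2 * j + 1))" for j
  have e'M: "e' j \<in> M \<times> M" for j using l by (simp add: e'_def)
  have dlim: "(\<lambda>n. D (fst (e (r n) j)) (snd (e (r n) j))) \<longlonglongrightarrow> D (fst (e' j)) (snd (e' j))" for j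
    unfolding ex e'_def fst_conv snd_conv by (rule D_LIM[OF xM xM l l lim lim])
  define G where "G = {j. fst (e' j) \<noteq> snd (e' j)}"
  have wpos: "0 < \<omega> (e' j)" if "j \<in> G" for j
    using w_pos[of "fst (e' j)" "snd (e' j)"] that e'M[of j] by (simp add: G_def mem_Times_iff)
  have wlim: "(\<lambda>n. \<omega> (e (r n) j)) \<longlonglongrightarrow> \<omega> (e' j)" for j
    unfolding \<omega>_def using \<alpha> by (intro tendsto_powr2 dlim tendsto_const) auto
  define a' where "a' j = \<sigma> (2 * j) / \<omega> (e' j) powr (1 / p)" for j
  have alim: "(\<lambda>n. a (r n) j) \<longlonglongrightarrow> a' j" if j: "j \<in> G" for j
  proof (rule Lim_transform_eventually)
    show "(\<lambda>n. s (r n) j / \<omega> (e (r n) j) powr (1 / p)) \<longlonglongrightarrow> a' j"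
      unfolding a'_def using wpos[OF j] by (intro tendsto_intros slim wlim) auto
    have "\<forall>\<^sub>F n in sequentially. 0 < \<omega> (e (r n) j)"
      using order_tendstoD(1)[OF wlim wpos[OF j]] .
    then show "\<forall>\<^sub>F n in sequentially. s (r n) j / \<omega> (e (r n) j) powr (1 / p) = a (r n) j"
      by eventually_elim (simp add: s_def)
  qed
  define t where "t j = a' j *\<^sub>R dip (e' j)" for j
  define T where "T n j = a (r n) j *\<^sub>R dip (e (r n) j)" for n j
  have tM: "t j \<in> molecules M" for j
    unfolding t_def using e'M[of j]
    by (intro subspace_scale[OF subspace_molecules] dipole_in_molecules) (auto simp: mem_Times_iff)
  have TM: "T n j \<in> molecules M" for n j
    unfolding T_def using e[of "r n" j]
    by (intro subspace_scale[OF subspace_molecules] dipole_in_molecules) (auto simp: mem_Times_iff)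
  define b where "b j = \<bar>a' j\<bar> powr p * \<omega> (e' j)" for j
  have b0: "0 \<le> b j" for j by (simp add: b_def \<omega>_nonneg)
  have ct: "c (t j) \<le> b j" for j
    using c_dipole[of "fst (e' j)" "snd (e' j)" "a' j"] e'M[of j] by (simp add: t_def b_def mem_Times_iff)
  have blim: "(\<lambda>n. B (r n) j) \<longlonglongrightarrow> b j" if "j \<in> G" for j
    unfolding B_def b_def using p
    by (intro tendsto_intros tendsto_powr2 alim[OF that] wlim) auto
  have btot: "sum b (G \<inter> {..<m}) \<le> C'" for m
  proof (rule LIMSEQ_le_const2)
    show "(\<lambda>n. \<Sum>j\<in>G \<inter> {..<m}. B (r n) j) \<longlonglongrightarrow> sum b (G \<inter> {..<m})"
      by (intro tendsto_sum blim) auto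
    have "(\<Sum>j\<in>G \<inter> {..<m}. B (r n) j) \<le> (\<Sum>j<m. B (r n) j)" for n
      using B0 by (intro sum_mono2) auto
    then show "\<exists>N. \<forall>n\<ge>N. (\<Sum>j\<in>G \<inter> {..<m}. B (r n) j) \<le> C'" using Btot order_trans by blast
  qed
  have good: "(\<lambda>n. c (T n j - t j)) \<longlonglongrightarrow> 0" if j: "j \<in> G" for j
  proof (rule tendsto_sandwich[OF _ _ tendsto_const])
    let ?f = "\<lambda>n. \<bar>a (r n) j - a' j\<bar> powr p * \<omega> (e (r n) j)
        + \<bar>a' j\<bar> powr p * (\<omega> (x (r n) (2*j), l (2*j)) + \<omega> (x (r n) (2*j+1), l (2*j+1)))"
    have "?f \<longlonglongrightarrow> 0 powr p * \<omega> (e' j) + \<bar>a' j\<bar> powr p * (0 + 0)"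
      using p LIM_zero[OF alim[OF j]]
      by (intro tendsto_intros wlim \<omega>_LIM_0 lim tendsto_powr2 tendsto_rabs_zero) auto
    then show "?f \<longlonglongrightarrow> 0" by simp
    show "\<forall>\<^sub>F n in sequentially. 0 \<le> c (T n j - t j)"
      by (intro always_eventually allI c_nonneg subspace_diff[OF subspace_molecules] TM tM)
    have "c (T n j - t j) \<le> ?f n" for n
    proof -
      let ?u = "x (r n) (2*j)" and ?v = "x (r n) (2*j+1)"
      \<comment> \<open>First the coefficient is changed on the old edge, then both endpoints are
        moved to their limits.\<close>
      have "T n j - t j = (a (r n) j - a' j) *\<^sub>R dipole ?u ?v
          + (a' j *\<^sub>R dipole ?u (l (2*j)) + (- a' j) *\<^sub>R dipole ?v (l (2*j+1)))"
        by (simp add: T_def t_def ex e'_def dipole_def algebra_simps)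
      also have "c \<dots> \<le> \<bar>a (r n) j - a' j\<bar> powr p * \<omega> (?u, ?v)
          + (\<bar>a' j\<bar> powr p * \<omega> (?u, l (2*j)) + \<bar>- a' j\<bar> powr p * \<omega> (?v, l (2*j+1)))"
        by (intro order_trans[OF c_add] add_mono c_dipole xM l
            subspace_add[OF subspace_molecules] subspace_scale[OF subspace_molecules] dipole_in_molecules)
      finally show ?thesis by (simp add: ex distrib_left)
    qed
    then show "\<forall>\<^sub>F n in sequentially. c (T n j - t j) \<le> ?f n" by simp
  qed
  have degenerate: "\<forall>\<^sub>F n in sequentially. cR R (T n j) \<le> \<delta>" if j: "j \<notin> G" and R: "0 < R" and \<delta>: "0 < \<delta>"
    for j R \<delta>
  proof -
    interpret TR: metric_transport p "\<omega>R R" M by (rule metric_transport_\<omega>R[OF R])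
    let ?d = "\<lambda>n. D (fst (e (r n) j)) (snd (e (r n) j))"
    have "?d \<longlonglongrightarrow> 0" using dlim[of j] j l by (simp add: G_def e'_def)
    then have "(\<lambda>n. C' * (R * ?d n powr (1 - \<alpha>))) \<longlonglongrightarrow> C' * (R * 0 powr (1 - \<alpha>))"
      using \<alpha> by (intro tendsto_intros tendsto_powr2) auto
    then have "\<forall>\<^sub>F n in sequentially. C' * (R * ?d n powr (1 - \<alpha>)) < \<delta>"
      using \<delta> by (intro order_tendstoD(2)) auto
    then show ?thesis
    proof eventually_elim
      case (elim n)
      have "cR R (T n j) \<le> \<bar>a (r n) j\<bar> powr p * \<omega>R R (e (r n) j)"
        using TR.c_dipole[of "fst (e (r n) j)" "snd (e (r n) j)" "a (r n) j"] e[of "r n" j]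
        by (simp add: T_def mem_Times_iff)
      also have "\<dots> \<le> \<bar>a (r n) j\<bar> powr p * (R * ?d n)"
        by (intro mult_left_mono \<omega>R_le) auto
      \<comment> \<open>The truncated weight is at most R D = R D^\<alpha> D^(1-\<alpha>). The
        factor D^\<alpha> is absorbed by the bounded cost \<open>B\<close>, and D^(1-\<alpha>) tends
        to zero since \<alpha> < 1.\<close>
      also have "?d n = ?d n powr \<alpha> * ?d n powr (1 - \<alpha>)" by (simp flip: powr_add)
      also have "\<bar>a (r n) j\<bar> powr p * (R * (?d n powr \<alpha> * ?d n powr (1 - \<alpha>)))
          = B (r n) j * (R * ?d n powr (1 - \<alpha>))"
        by (simp add: B_def \<omega>_def)
      also have "\<dots> \<le> C' * (R * ?d n powr (1 - \<alpha>))"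
        using Btot[of "r n" "Suc j"] member_le_sum[of j "{..<Suc j}" "B (r n)"] B0 R
        by (intro mult_right_mono) auto
      finally show ?case using elim by simp
    qed
  qed
  define b' where "b' j = (if j \<in> G then b j else 0)" for j
  have b'_sum: "sum b' {..<m} = sum b (G \<inter> {..<m})" for m
    by (simp add: b'_def sum.If_cases Int_commute)
  have "summable b'"
    using btot b0 b'_sum by (intro summableI_nonneg_bounded[of _ C']) (auto simp: b'_def)
  \<comment> \<open>The cutoff depends on \<epsilon> only. Thus \<eta> is a finite sum chosen before
    \<open>R\<close>, while the cost of the omitted limit terms stays below \<epsilon>/4.\<close>
  then obtain J where J: "\<And>m m'. J \<le> m \<Longrightarrow> norm (sum b' {m..<m'}) < \<epsilon> / 4"
    using \<epsilon> unfolding summable_Cauchy by (meson divide_pos_pos zero_less_numeral)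
  define \<eta> where "\<eta> = (\<Sum>j\<in>G \<inter> {..<J}. t j)"
  have \<eta>: "\<eta> \<in> molecules M" unfolding \<eta>_def by (intro subspace_sum[OF subspace_molecules] tM)
  have \<xi>_ext: "\<xi> (r n) = (\<Sum>j<m. T n j)" if "k (r n) \<le> m" for n m
    unfolding \<xi> T_def using that k by (intro sumk[symmetric]) auto
  have good_sum: "\<forall>\<^sub>F n in sequentially. c (\<Sum>j\<in>G \<inter> {..<m}. T n j - t j) \<le> \<delta>" if \<delta>: "0 < \<delta>" for \<delta> m
  proof -
    have "(\<lambda>n. \<Sum>j\<in>G \<inter> {..<m}. c (T n j - t j)) \<longlonglongrightarrow> (\<Sum>j\<in>G \<inter> {..<m}. 0)"
      by (intro tendsto_sum good) auto
    then have "\<forall>\<^sub>F n in sequentially. (\<Sum>j\<in>G \<inter> {..<m}. c (T n j - t j)) < \<delta>"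
      using \<delta> by (intro order_tendstoD(2)) auto
    then show ?thesis
    proof eventually_elim
      case (elim n)
      have "c (\<Sum>j\<in>G \<inter> {..<m}. T n j - t j) \<le> (\<Sum>j\<in>G \<inter> {..<m}. c (T n j - t j))"
        by (intro c_sum subspace_diff[OF subspace_molecules] TM tM)
      with elim show ?case by simp
    qed
  qed
  show ?thesis
  proof (intro exI[of _ r] exI[of _ \<eta>] conjI r \<eta> allI impI)
    fix R :: real assume R: "0 < R"
    interpret TR: metric_transport p "\<omega>R R" M by (rule metric_transport_\<omega>R[OF R])
    have "0 < \<epsilon> / 4" using \<epsilon> by simp
    from cR_tail[OF R this C'0] obtain J0 where J0: "\<forall>J\<ge>J0. \<forall>k a e. (\<forall>j. e j \<in> M \<times> M) \<longrightarrow>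
      (\<forall>j. \<bar>a j\<bar> powr p * \<omega> (e j) \<le> C' / (real j + 1)) \<longrightarrow>
      (\<forall>k. (\<Sum>j<k. \<bar>a j\<bar> powr p * \<omega> (e j)) \<le> C') \<longrightarrow>
      cR R (\<Sum>j\<in>{J..<k}. a j *\<^sub>R dip (e j)) \<le> \<epsilon> / 4" ..
    \<comment> \<open>The cutoff for the tail may depend on \<open>R\<close>. Below \<open>m\<close>
      there are converging terms, degenerate terms and the limit terms left out of \<eta>; with the
      tail beyond \<open>m\<close> these are four errors of \<epsilon>/4.\<close>
    define m where "m = max J J0"
    define q where "q = \<epsilon> / 4 / (real m + 1)"
    have q: "0 < q" using \<epsilon> by (simp add: q_def)
    have "\<forall>\<^sub>F n in sequentially. \<forall>j\<in>{..<m} - G. cR R (T n j) \<le> q"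
      using degenerate[OF _ R q] by (intro eventually_ball_finite) auto
    moreover have "\<forall>\<^sub>F n in sequentially. c (\<Sum>j\<in>G \<inter> {..<m}. T n j - t j) \<le> \<epsilon> / 4"
      using \<epsilon> by (intro good_sum) auto
    ultimately show "\<forall>\<^sub>F n in sequentially. cR R (\<xi> (r n) - \<eta>) \<le> \<epsilon>"
    proof eventually_elim
      case (elim n)
      let ?X1 = "\<Sum>j\<in>G \<inter> {..<m}. T n j - t j" and ?X2 = "\<Sum>j\<in>{..<m} - G. T n j"
        and ?X3 = "\<Sum>j\<in>G \<inter> {J..<m}. t j" and ?X4 = "\<Sum>j\<in>{m..<max m (k (r n))}. T n j"
      have "\<xi> (r n) = (\<Sum>j<max m (k (r n)). T n j)" by (rule \<xi>_ext) simp
      also have "\<dots> = (\<Sum>j<m. T n j) + ?X4"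
        by (subst sum.union_disjoint[symmetric]) (auto intro!: sum.cong)
      also have "(\<Sum>j<m. T n j) = (\<Sum>j\<in>G \<inter> {..<m}. T n j) + ?X2"
        by (subst sum.union_disjoint[symmetric]) (auto intro!: sum.cong)
      also have "(\<Sum>j\<in>G \<inter> {..<m}. T n j) = ?X1 + (\<Sum>j\<in>G \<inter> {..<m}. t j)" by (simp add: sum_subtractf)
      also have "(\<Sum>j\<in>G \<inter> {..<m}. t j) = \<eta> + ?X3"
        unfolding \<eta>_def by (subst sum.union_disjoint[symmetric]) (auto intro!: sum.cong simp: m_def)
      finally have eq: "\<xi> (r n) - \<eta> = ?X1 + (?X2 + (?X3 + ?X4))" by (simp add: algebra_simps)
      have X: "?X1 \<in> molecules M" "?X2 \<in> molecules M" "?X3 \<in> molecules M" "?X4 \<in> molecules M"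
        by (intro subspace_sum[OF subspace_molecules] subspace_diff[OF subspace_molecules] TM tM)+
      have 1: "cR R ?X1 \<le> \<epsilon> / 4" using cR_le[OF R X(1)] elim(2) by simp
      have "cR R ?X2 \<le> (\<Sum>j\<in>{..<m} - G. cR R (T n j))" by (intro TR.c_sum TM)
      also have "\<dots> \<le> (\<Sum>j\<in>{..<m} - G. q)" using elim(1) by (intro sum_mono) auto
      also have "\<dots> \<le> (\<Sum>j\<in>{..<m}. q)" using q by (intro sum_mono2) auto
      also have "\<dots> \<le> \<epsilon> / 4" using \<epsilon> by (simp add: q_def field_simps)
      finally have 2: "cR R ?X2 \<le> \<epsilon> / 4" .
      have "cR R ?X3 \<le> c ?X3" by (rule cR_le[OF R X(3)])
      also have "\<dots> \<le> (\<Sum>j\<in>G \<inter> {J..<m}. c (t j))" by (intro c_sum tM)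
      also have "\<dots> \<le> (\<Sum>j\<in>G \<inter> {J..<m}. b j)" by (intro sum_mono ct)
      also have "\<dots> = sum b' {J..<m}" by (simp add: b'_def sum.If_cases Int_commute)
      also have "\<dots> \<le> \<epsilon> / 4" using J[of J m] by simp
      finally have 3: "cR R ?X3 \<le> \<epsilon> / 4" .
      have 4: "cR R ?X4 \<le> \<epsilon> / 4"
        unfolding T_def using e Bdec[of "r n"] Btot[of "r n"]
        by (intro J0[rule_format]) (auto simp: m_def B_def)
      have "cR R (\<xi> (r n) - \<eta>) \<le> cR R ?X1 + (cR R ?X2 + (cR R ?X3 + cR R ?X4))"
        unfolding eq using X
        by (intro order_trans[OF TR.c_add] add_mono order_refl subspace_add[OF subspace_molecules])
      then show ?case using 1 2 3 4 by simp
    qed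
  next
    have "(\<lambda>n. \<Sum>j\<in>G \<inter> {..<J}. B (r n) j) \<longlonglongrightarrow> (\<Sum>j\<in>G \<inter> {..<J}. b j)"
      by (intro tendsto_sum blim) auto
    then have "\<forall>\<^sub>F n in sequentially. (\<Sum>j\<in>G \<inter> {..<J}. b j) - \<epsilon> / 3 < (\<Sum>j\<in>G \<inter> {..<J}. B (r n) j)"
      using \<epsilon> by (intro order_tendstoD(1)) auto
    moreover have "\<forall>\<^sub>F n in sequentially. c (\<Sum>j\<in>G \<inter> {..<J}. T n j - t j) \<le> \<epsilon> / 3"
      using \<epsilon> by (intro good_sum) auto
    moreover have "\<forall>\<^sub>F n in sequentially. inverse (real (Suc (r n))) < \<epsilon> / 3"
      using LIMSEQ_subseq_LIMSEQ[OF LIMSEQ_inverse_real_of_nat r] \<epsilon>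
      by (intro order_tendstoD(2)) (auto simp: o_def)
    ultimately show "\<forall>\<^sub>F n in sequentially. c \<eta> + c (\<xi> (r n) - \<eta>) \<le> c (\<xi> (r n)) + \<epsilon>"
    proof eventually_elim
      case (elim n)
      define m where "m = max J (k (r n))"
      \<comment> \<open>The terms outside \<eta> cost the nearly optimal total minus the share of
        the selected terms, and that share tends to a bound for \<open>c \<eta>\<close>. The three
        errors \<epsilon>/3 come from this limit, from T - t, and from near optimality.\<close>
      define H where "H = {..<m} - G \<inter> {..<J}"
      let ?X1 = "\<Sum>j\<in>G \<inter> {..<J}. T n j - t j" and ?X2 = "\<Sum>j\<in>H. T n j"
      have split: "sum f {..<m} = sum f (G \<inter> {..<J}) + sum f H" for f :: "nat \<Rightarrow> 'z::comm_monoid_add"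
        unfolding H_def by (subst sum.union_disjoint[symmetric]) (auto intro!: sum.cong simp: m_def)
      have "\<xi> (r n) = (\<Sum>j<m. T n j)" by (rule \<xi>_ext) (simp add: m_def)
      then have eq: "\<xi> (r n) - \<eta> = ?X1 + ?X2"
        by (simp add: split sum_subtractf \<eta>_def)
      have X: "?X1 \<in> molecules M" "?X2 \<in> molecules M"
        by (intro subspace_sum[OF subspace_molecules] subspace_diff[OF subspace_molecules] TM tM)+
      have "c ?X2 \<le> (\<Sum>j\<in>H. B (r n) j)"
        unfolding T_def B_def using e by (intro c_sum_dip)
      also have "\<dots> = (\<Sum>j<m. B (r n) j) - (\<Sum>j\<in>G \<inter> {..<J}. B (r n) j)" by (simp add: split)
      also have "(\<Sum>j<m. B (r n) j) = (\<Sum>j<k (r n). B (r n) j)"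
        using Bk by (intro sumk) (auto simp: m_def)
      also have "\<dots> \<le> c (\<xi> (r n)) + \<epsilon> / 3" using cost[of "r n"] elim(3) by (simp add: B_def)
      finally have 2: "c ?X2 \<le> c (\<xi> (r n)) + \<epsilon> / 3 - (\<Sum>j\<in>G \<inter> {..<J}. B (r n) j)" by simp
      have "c \<eta> \<le> (\<Sum>j\<in>G \<inter> {..<J}. c (t j))" unfolding \<eta>_def by (intro c_sum tM)
      also have "\<dots> \<le> (\<Sum>j\<in>G \<inter> {..<J}. b j)" by (intro sum_mono ct)
      finally have 3: "c \<eta> \<le> (\<Sum>j\<in>G \<inter> {..<J}. b j)" .
      have "c (\<xi> (r n) - \<eta>) \<le> c ?X1 + c ?X2" unfolding eq by (rule c_add[OF X])
      then show ?case using 2 3 elim(1,2) by linarith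
    qed
  qed
qed

end

section \<open>Asymptotic splitting\<close>

lemma finite_grid:
  fixes p \<delta> :: real
  assumes "0 < p" "0 < \<delta>"
  obtains T where "finite T" "\<And>t. \<bar>t\<bar> \<le> 1 \<Longrightarrow> \<exists>t'\<in>T. \<bar>t - t'\<bar> powr p \<le> \<delta>"
proof -
  have d: "0 < \<delta> powr (1 / p)" using assms by simp
  have "compact {-1..1 :: real}" by simp
  then have "\<exists>T. finite T \<and> {-1..1::real} \<subseteq> (\<Union>x\<in>T. ball x (\<delta> powr (1 / p)))"
    using d unfolding compact_eq_totally_bounded by blast
  then obtain T where T: "finite T" "{-1..1::real} \<subseteq> (\<Union>x\<in>T. ball x (\<delta> powr (1 / p)))" by blast
  have "\<exists>t'\<in>T. \<bar>t - t'\<bar> powr p \<le> \<delta>" if "\<bar>t\<bar> \<le> 1" for t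
  proof -
    have "t \<in> {-1..1}" using that by auto
    then obtain t' where t': "t' \<in> T" "t \<in> ball t' (\<delta> powr (1 / p))" using T(2) by blast
    then have "\<bar>t - t'\<bar> powr p \<le> (\<delta> powr (1 / p)) powr p"
      using assms by (intro powr_mono2) (auto simp: dist_real_def)
    then show ?thesis using t' assms by (auto simp: powr_powr)
  qed
  with T that show thesis by blast
qed

lemma abs_powr_diff_le:
  fixes s t p :: real
  assumes "0 < p" "p \<le> 1"
  shows "\<bar>\<bar>s\<bar> powr p - \<bar>t\<bar> powr p\<bar> \<le> \<bar>s - t\<bar> powr p"
  using abs_powr_triangle[OF assms, of "s - t" t] abs_powr_triangle[OF assms, of "t - s" s]
  by (simp add: abs_le_iff abs_minus_commute)

context transport begin

definition totally_bounded :: "('m \<Rightarrow>\<^sub>0 real) set \<Rightarrow> bool" where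
  "totally_bounded S \<longleftrightarrow> S \<subseteq> molecules M \<and>
     (\<forall>\<epsilon>>0. \<exists>F. finite F \<and> F \<subseteq> molecules M \<and> (\<forall>z\<in>S. \<exists>z'\<in>F. c (z - z') \<le> \<epsilon>))"

lemma totally_bounded_add_segment:
  assumes S: "totally_bounded S" and u: "u \<in> molecules M"
  shows "totally_bounded {z + t *\<^sub>R u |z t. z \<in> S \<and> \<bar>t\<bar> \<le> 1}"
  unfolding totally_bounded_def
proof (intro conjI allI impI)
  have SM: "S \<subseteq> molecules M" using S by (simp add: totally_bounded_def)
  have tu: "t *\<^sub>R u \<in> molecules M" for t using u by (rule subspace_scale[OF subspace_molecules])
  show "{z + t *\<^sub>R u |z t. z \<in> S \<and> \<bar>t\<bar> \<le> 1} \<subseteq> molecules M"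
    using SM tu by (auto intro!: subspace_add[OF subspace_molecules])
  fix \<epsilon> :: real assume \<epsilon>: "0 < \<epsilon>"
  then have "0 < \<epsilon> / 2" by simp
  then obtain F where F: "finite F" "F \<subseteq> molecules M" "\<forall>z\<in>S. \<exists>z'\<in>F. c (z - z') \<le> \<epsilon> / 2"
    using S unfolding totally_bounded_def by meson
  have cu: "0 \<le> c u" by (rule c_nonneg[OF u])
  obtain T where T: "finite T" "\<And>t. \<bar>t\<bar> \<le> 1 \<Longrightarrow> \<exists>t'\<in>T. \<bar>t - t'\<bar> powr p \<le> \<epsilon> / (2 * (c u + 1))"
    using finite_grid[of p "\<epsilon> / (2 * (c u + 1))"] p \<epsilon> cu by auto
  show "\<exists>F. finite F \<and> F \<subseteq> molecules M \<and>
      (\<forall>y\<in>{z + t *\<^sub>R u |z t. z \<in> S \<and> \<bar>t\<bar> \<le> 1}. \<exists>z'\<in>F. c (y - z') \<le> \<epsilon>)"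
  proof (intro exI conjI ballI)
    let ?F = "(\<lambda>(z, t). z + t *\<^sub>R u) ` (F \<times> T)"
    show "finite ?F" using F T by simp
    show "?F \<subseteq> molecules M" using F tu by (auto intro!: subspace_add[OF subspace_molecules])
    fix y assume "y \<in> {z + t *\<^sub>R u |z t. z \<in> S \<and> \<bar>t\<bar> \<le> 1}"
    then obtain z t where y: "y = z + t *\<^sub>R u" "z \<in> S" "\<bar>t\<bar> \<le> 1" by auto
    obtain z' where z': "z' \<in> F" "c (z - z') \<le> \<epsilon> / 2" using F y by auto
    obtain t' where t': "t' \<in> T" "\<bar>t - t'\<bar> powr p \<le> \<epsilon> / (2 * (c u + 1))" using T y by blast
    have "y - (z' + t' *\<^sub>R u) = (z - z') + (t - t') *\<^sub>R u" by (simp add: y algebra_simps)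
    also have "c \<dots> \<le> c (z - z') + c ((t - t') *\<^sub>R u)"
      using SM F y z' tu by (intro c_add subspace_diff[OF subspace_molecules]) auto
    also have "\<dots> \<le> \<epsilon> / 2 + \<epsilon> / (2 * (c u + 1)) * c u"
      unfolding c_scaleR[OF u] by (rule add_mono[OF z'(2) mult_right_mono[OF t'(2) cu]])
    also have "\<dots> \<le> \<epsilon> / 2 + \<epsilon> / 2"
      using \<epsilon> cu by (intro add_left_mono) (simp add: field_simps)
    finally have "c (y - (z' + t' *\<^sub>R u)) \<le> \<epsilon>" by simp
    then show "\<exists>z'\<in>?F. c (y - z') \<le> \<epsilon>" using z' t' by force
  qed
qed

end

context snowflake begin

text \<open>If it failed infinitely often, \<open>extract_limit\<close> would apply to z + u_n along
  the bad indices. All truncated costs of z - \<eta> are then at most 2\<epsilon>, so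
  \<open>c_le_sup_cR\<close> identifies \<eta> with z up to 2\<epsilon>, and the splitting at \<eta>
  becomes one at z.\<close>

lemma asymptotic_splitting:
  assumes u: "\<And>n. u n \<in> molecules M" and C: "\<And>n. c (u n) \<le> C" and \<epsilon>: "0 < \<epsilon>"
    and small: "\<And>R. 0 < R \<Longrightarrow> \<forall>\<^sub>F n in sequentially. cR R (u n) \<le> \<epsilon>"
    and z: "z \<in> molecules M"
  shows "\<forall>\<^sub>F n in sequentially. c z + c (u n) \<le> c (z + u n) + 6 * \<epsilon>"
proof (rule ccontr)
  assume "\<not> ?thesis"
  then have "infinite {n. \<not> c z + c (u n) \<le> c (z + u n) + 6 * \<epsilon>}"
    by (simp add: eventually_cofinite flip: cofinite_eq_sequentially)
  then obtain q :: "nat \<Rightarrow> nat" where q: "strict_mono q"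
    and bad: "\<And>n. \<not> c z + c (u (q n)) \<le> c (z + u (q n)) + 6 * \<epsilon>"
    using infinite_enumerate by blast
  have mol: "z + u (q n) \<in> molecules M" for n by (intro subspace_add[OF subspace_molecules] z u)
  have "c (z + u (q n)) \<le> c z + C" for n
    using c_add[OF z u[of "q n"]] C[of "q n"] by simp
  from extract_limit[of "\<lambda>n. z + u (q n)", OF mol this \<epsilon>]
  obtain r :: "nat \<Rightarrow> nat" and \<eta> where r: "strict_mono r" and \<eta>: "\<eta> \<in> molecules M"
    and lim: "\<forall>R>0. \<forall>\<^sub>F n in sequentially. cR R (z + u (q (r n)) - \<eta>) \<le> \<epsilon>"
    and split: "\<forall>\<^sub>F n in sequentially. c \<eta> + c (z + u (q (r n)) - \<eta>) \<le> c (z + u (q (r n))) + \<epsilon>"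
    by (elim exE conjE)
  have z\<eta>: "c (z - \<eta>) \<le> 2 * \<epsilon>"
  proof (rule c_le_sup_cR)
    show "z - \<eta> \<in> molecules M" by (intro subspace_diff[OF subspace_molecules] z \<eta>)
    fix R :: real assume R: "0 < R"
    interpret T: metric_transport p "\<omega>R R" M by (rule metric_transport_\<omega>R[OF R])
    have "\<forall>\<^sub>F n in sequentially. cR R (u (q (r n))) \<le> \<epsilon>"
      using eventually_compose_filterlim[OF small[OF R] filterlim_subseq[OF strict_mono_o[OF q r]]]
      by (simp add: o_def)
    with lim[rule_format, OF R] have "\<forall>\<^sub>F n in sequentially. cR R (z - \<eta>) \<le> 2 * \<epsilon>"
    proof eventually_elim
      case (elim n)
      have "cR R (z + u (q (r n)) - \<eta> - u (q (r n))) \<le> cR R (z + u (q (r n)) - \<eta>) + cR R (u (q (r n)))"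
        by (intro T.c_diff subspace_diff[OF subspace_molecules] mol \<eta> u)
      then show ?case using elim by simp
    qed
    then show "cR R (z - \<eta>) \<le> 2 * \<epsilon>" by simp
  qed
  from split obtain n where n: "c \<eta> + c (z + u (q (r n)) - \<eta>) \<le> c (z + u (q (r n))) + \<epsilon>"
    by (auto simp: eventually_sequentially)
  let ?u = "u (q (r n))"
  have "c (z + ?u - \<eta> - (z - \<eta>)) \<le> c (z + ?u - \<eta>) + c (z - \<eta>)"
    by (intro c_diff subspace_diff[OF subspace_molecules] mol \<eta> z)
  then have "c ?u \<le> c (z + ?u - \<eta>) + 2 * \<epsilon>" using z\<eta> by simp
  moreover have "c z \<le> 2 * \<epsilon> + c \<eta>" using c_le_diff[OF z \<eta>] z\<eta> by simp
  \<comment> \<open>Replacing \<eta> by z costs 2\<epsilon> in each of the two summands, and the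
    splitting itself costs \<epsilon>; the total 5\<epsilon> contradicts a failure by more than
    6\<epsilon>.\<close>
  ultimately show False using bad[of "r n"] n \<epsilon> by linarith
qed

text \<open>Pointwise splitting holds eventually for each of finitely many pairs (z, t); finite nets
  of \<open>S\<close> and of [-1, 1] extend it to all pairs at the price of \<delta>.\<close>

lemma uniform_splitting:
  assumes u: "\<And>n. u n \<in> molecules M" and C: "\<And>n. c (u n) \<le> C" and \<epsilon>: "0 < \<epsilon>"
    and small: "\<And>R. 0 < R \<Longrightarrow> \<forall>\<^sub>F n in sequentially. cR R (u n) \<le> \<epsilon>"
    and S: "totally_bounded S" and \<kappa>: "\<And>n. \<kappa> \<le> c (u n)" and \<delta>: "0 < \<delta>"
  shows "\<forall>\<^sub>F n in sequentially. \<forall>z\<in>S. \<forall>t. \<bar>t\<bar> \<le> 1 \<longrightarrow>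
    c z + \<bar>t\<bar> powr p * (\<kappa> - 6 * \<epsilon>) - \<delta> \<le> c (z + t *\<^sub>R u n)"
proof -
  define \<kappa>' where "\<kappa>' = \<kappa> - 6 * \<epsilon>"
  \<comment> \<open>A common bound for \<open>c (u n)\<close> and |\<kappa>'|, so that one grid for
    \<open>t\<close> controls both the change of t u_n and that of |t|^p \<kappa>'.\<close>
  define Q where "Q = C + \<bar>\<kappa>'\<bar> + 1"
  have C0: "0 \<le> C" using order_trans[OF c_nonneg[OF u] C] .
  then have Q: "0 < Q" "C \<le> Q" "\<bar>\<kappa>'\<bar> \<le> Q" by (auto simp: Q_def)
  have SM: "S \<subseteq> molecules M" using S by (simp add: totally_bounded_def)
  have "0 < \<delta> / 4" using \<delta> by simp
  then obtain F where F: "finite F" "F \<subseteq> molecules M" "\<forall>z\<in>S. \<exists>z'\<in>F. c (z - z') \<le> \<delta> / 4"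
    using S unfolding totally_bounded_def by meson
  obtain T where T: "finite T" "\<And>t. \<bar>t\<bar> \<le> 1 \<Longrightarrow> \<exists>t'\<in>T. \<bar>t - t'\<bar> powr p \<le> \<delta> / (4 * Q)"
    using finite_grid[of p "\<delta> / (4 * Q)"] p \<delta> Q by auto
  have "\<forall>\<^sub>F n in sequentially. \<forall>z\<in>F. \<forall>t\<in>T. c z + \<bar>t\<bar> powr p * \<kappa>' \<le> c (z + t *\<^sub>R u n)"
  proof (intro eventually_ball_finite F T ballI)
    fix z t assume z: "z \<in> F" and t: "t \<in> T"
    have zM: "z \<in> molecules M" using z F by auto
    show "\<forall>\<^sub>F n in sequentially. c z + \<bar>t\<bar> powr p * \<kappa>' \<le> c (z + t *\<^sub>R u n)"
    proof (cases "t = 0")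
      case False
      \<comment> \<open>Splitting is known for the coefficient 1 of u_n. It is applied to z/t and
        scaled back by p-homogeneity.\<close>
      have zt: "(1 / t) *\<^sub>R z \<in> molecules M" by (rule subspace_scale[OF subspace_molecules zM])
      have "\<forall>\<^sub>F n in sequentially. c ((1 / t) *\<^sub>R z) + c (u n) \<le> c ((1 / t) *\<^sub>R z + u n) + 6 * \<epsilon>"
        by (rule asymptotic_splitting[OF u C \<epsilon> _ zt]) (rule small)
      then show ?thesis
      proof eventually_elim
        case (elim n)
        have "c z + \<bar>t\<bar> powr p * \<kappa>' \<le> \<bar>t\<bar> powr p * (c ((1 / t) *\<^sub>R z) + c (u n) - 6 * \<epsilon>)"
          using False \<kappa>[of n] by (simp add: c_scaleR[OF zM] powr_divide \<kappa>'_def algebra_simps)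
        also have "\<dots> \<le> \<bar>t\<bar> powr p * c ((1 / t) *\<^sub>R z + u n)"
          using elim by (intro mult_left_mono) auto
        also have "\<dots> = c (t *\<^sub>R ((1 / t) *\<^sub>R z + u n))"
          by (intro c_scaleR[symmetric] subspace_add[OF subspace_molecules] zt u)
        also have "t *\<^sub>R ((1 / t) *\<^sub>R z + u n) = z + t *\<^sub>R u n"
          using False by (simp add: scaleR_add_right)
        finally show ?case .
      qed
    qed (use p in auto)
  qed
  then show ?thesis
  proof eventually_elim
    case (elim n)
    show ?case
    proof (intro ballI allI impI)
      fix z and t :: real assume z: "z \<in> S" and t: "\<bar>t\<bar> \<le> 1"
      obtain z' where z': "z' \<in> F" "c (z - z') \<le> \<delta> / 4" using F z by auto
      obtain t' where t': "t' \<in> T" "\<bar>t - t'\<bar> powr p \<le> \<delta> / (4 * Q)" using T(2)[OF t] by blast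
      have mem: "z \<in> molecules M" "z' \<in> molecules M" using z SM z' F by auto
      have tu: "t *\<^sub>R u n \<in> molecules M" for t by (rule subspace_scale[OF subspace_molecules u])
      have tt: "\<bar>t - t'\<bar> powr p * s \<le> \<delta> / 4" if "0 \<le> s" "s \<le> Q" for s
      proof -
        have "\<bar>t - t'\<bar> powr p * s \<le> \<delta> / (4 * Q) * Q" using t' that \<delta> Q by (intro mult_mono) auto
        then show ?thesis using Q by simp
      qed
      have 1: "c z' + \<bar>t'\<bar> powr p * \<kappa>' \<le> c (z' + t' *\<^sub>R u n)" using elim z' t' by blast
      have "c (z' + t' *\<^sub>R u n) \<le> c ((z' + t' *\<^sub>R u n) - (z + t *\<^sub>R u n)) + c (z + t *\<^sub>R u n)"
        by (intro c_le_diff subspace_add[OF subspace_molecules] mem tu)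
      also have "(z' + t' *\<^sub>R u n) - (z + t *\<^sub>R u n) = (z' - z) + (t' - t) *\<^sub>R u n"
        by (simp add: algebra_simps)
      also have "c \<dots> \<le> c (z' - z) + c ((t' - t) *\<^sub>R u n)"
        by (intro c_add subspace_diff[OF subspace_molecules] mem tu)
      also have "c ((t' - t) *\<^sub>R u n) \<le> \<delta> / 4"
        using tt[of "c (u n)"] c_nonneg[OF u] C[of n] Q
        by (simp add: c_scaleR[OF u] abs_minus_commute)
      also have "c (z' - z) \<le> \<delta> / 4" using z' c_diff_commute[OF mem] by simp
      finally have 2: "c (z' + t' *\<^sub>R u n) \<le> \<delta> / 4 + \<delta> / 4 + c (z + t *\<^sub>R u n)" by simp
      have 3: "c z \<le> \<delta> / 4 + c z'" using c_le_diff[OF mem] z' by simp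
      have "\<bar>(\<bar>t\<bar> powr p - \<bar>t'\<bar> powr p) * \<kappa>'\<bar> \<le> \<bar>t - t'\<bar> powr p * \<bar>\<kappa>'\<bar>"
        unfolding abs_mult using abs_powr_diff_le[OF p] by (intro mult_right_mono) auto
      also have "\<dots> \<le> \<delta> / 4" using Q by (intro tt) auto
      finally have "(\<bar>t\<bar> powr p - \<bar>t'\<bar> powr p) * \<kappa>' \<le> \<delta> / 4" by (rule abs_le_D1)
      then have 4: "\<bar>t\<bar> powr p * \<kappa>' \<le> \<delta> / 4 + \<bar>t'\<bar> powr p * \<kappa>'"
        by (simp add: left_diff_distrib)
      show "c z + \<bar>t\<bar> powr p * (\<kappa> - 6 * \<epsilon>) - \<delta> \<le> c (z + t *\<^sub>R u n)"
        using 1 2 3 4 unfolding \<kappa>'_def by linarith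
    qed
  qed
qed

text \<open>The partial sums with coefficients in [-1, 1] form a totally bounded set, so the next
  index can be chosen for all of them at once with error \<epsilon>/2^k. The indices are therefore
  independent of the coefficients, and the errors add up to at most 2\<epsilon>.\<close>

lemma gliding_hump:
  assumes u: "\<And>n. u n \<in> molecules M" and C: "\<And>n. c (u n) \<le> C" and \<epsilon>: "0 < \<epsilon>"
    and small: "\<And>R. 0 < R \<Longrightarrow> \<forall>\<^sub>F n in sequentially. cR R (u n) \<le> \<epsilon>"
    and \<kappa>: "\<And>n. \<kappa> \<le> c (u n)" and \<eta>: "\<eta> \<in> molecules M"
  shows "\<exists>r :: nat \<Rightarrow> nat. strict_mono r \<and>
    (\<forall>k t a. \<bar>t\<bar> \<le> 1 \<longrightarrow> (\<forall>i<k. \<bar>a i\<bar> \<le> 1) \<longrightarrow>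
      (\<Sum>i<k. \<bar>a i\<bar> powr p) * (\<kappa> - 6 * \<epsilon>) - 2 * \<epsilon> \<le> c (t *\<^sub>R \<eta> + (\<Sum>i<k. a i *\<^sub>R u (r i))))"
proof -
  define \<kappa>' where "\<kappa>' = \<kappa> - 6 * \<epsilon>"
  define next_set where "next_set S n = {z + t *\<^sub>R u n |z t. z \<in> S \<and> \<bar>t\<bar> \<le> 1}" for S n
  define Q where "Q k x y \<longleftrightarrow> (snd x < snd y \<and> fst y = next_set (fst x) (snd y) \<and>
    (\<forall>z\<in>fst x. \<forall>t. \<bar>t\<bar> \<le> 1 \<longrightarrow> c z + \<bar>t\<bar> powr p * \<kappa>' - \<epsilon> / 2 ^ k \<le> c (z + t *\<^sub>R u (snd y))))"
    for k :: nat and x y :: "('m \<Rightarrow>\<^sub>0 real) set \<times> nat"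
  \<comment> \<open>The induction starts from a segment in direction \<eta> so that an arbitrary
    multiple of the common limit can be present in the combination.\<close>
  define S0 where "S0 = {z + t *\<^sub>R \<eta> |z t. z \<in> {0} \<and> \<bar>t\<bar> \<le> 1}"
  have "totally_bounded {0}"
    unfolding totally_bounded_def using subspace_0[OF subspace_molecules, of M]
    by (auto intro!: exI[of _ "{0}"])
  then have S0: "totally_bounded S0" unfolding S0_def by (rule totally_bounded_add_segment[OF _ \<eta>])
  have "\<exists>f. f 0 = (S0, 0) \<and> (\<forall>k. totally_bounded (fst (f k)) \<and> Q k (f k) (f (Suc k)))"
  proof -
    \<comment> \<open>Dependent choice does not prescribe the first value; the clause for k = 0 in
      the invariant does.\<close>
    have "\<exists>f. \<forall>k. (totally_bounded (fst (f k)) \<and> (k = 0 \<longrightarrow> f k = (S0, 0))) \<and> Q k (f k) (f (Suc k))"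
    proof (rule dependent_nat_choice)
      show "\<exists>x. totally_bounded (fst x) \<and> (0 = (0::nat) \<longrightarrow> x = (S0, 0 :: nat))" using S0 by auto
      fix x :: "('m \<Rightarrow>\<^sub>0 real) set \<times> nat" and k :: nat
      assume "totally_bounded (fst x) \<and> (k = 0 \<longrightarrow> x = (S0, 0))"
      then have x: "totally_bounded (fst x)" by simp
      have "0 < \<epsilon> / 2 ^ k" using \<epsilon> by simp
      then have "\<forall>\<^sub>F n in sequentially. snd x < n \<and> (\<forall>z\<in>fst x. \<forall>t. \<bar>t\<bar> \<le> 1 \<longrightarrow>
          c z + \<bar>t\<bar> powr p * \<kappa>' - \<epsilon> / 2 ^ k \<le> c (z + t *\<^sub>R u n))"
        unfolding \<kappa>'_def
        by (intro eventually_conj eventually_gt_at_top uniform_splitting[OF u C \<epsilon> _ x \<kappa>] small)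
      then obtain n where "snd x < n" "\<forall>z\<in>fst x. \<forall>t. \<bar>t\<bar> \<le> 1 \<longrightarrow>
          c z + \<bar>t\<bar> powr p * \<kappa>' - \<epsilon> / 2 ^ k \<le> c (z + t *\<^sub>R u n)"
        by (auto simp: eventually_sequentially)
      moreover have "totally_bounded (next_set (fst x) n)"
        unfolding next_set_def by (rule totally_bounded_add_segment[OF x u])
      ultimately show "\<exists>y. (totally_bounded (fst y) \<and> (Suc k = 0 \<longrightarrow> y = (S0, 0))) \<and> Q k x y"
        by (intro exI[of _ "(next_set (fst x) n, n)"]) (simp add: Q_def)
    qed
    then show ?thesis by blast
  qed
  then obtain f where f0: "f 0 = (S0, 0)" and Q: "\<And>k. Q k (f k) (f (Suc k))" by blast
  define r where "r i = snd (f (Suc i))" for i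
  show ?thesis
  proof (intro exI[of _ r] conjI allI impI)
    show "strict_mono r" unfolding strict_mono_Suc_iff r_def using Q by (simp add: Q_def)
    fix k and t :: real and a :: "nat \<Rightarrow> real"
    assume t: "\<bar>t\<bar> \<le> 1" and "\<forall>i<k. \<bar>a i\<bar> \<le> 1"
    \<comment> \<open>The factor 2 - 2/2^k is the sum of the errors 2^(-i) over i < k. The initial
      cost of t \<eta> is only bounded below by zero.\<close>
    then have "t *\<^sub>R \<eta> + (\<Sum>i<k. a i *\<^sub>R u (r i)) \<in> fst (f k) \<and>
      (\<Sum>i<k. \<bar>a i\<bar> powr p) * \<kappa>' - (2 - 2 / 2 ^ k) * \<epsilon> \<le> c (t *\<^sub>R \<eta> + (\<Sum>i<k. a i *\<^sub>R u (r i)))"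
    proof (induction k)
      case 0
      have "t *\<^sub>R \<eta> \<in> molecules M" by (rule subspace_scale[OF subspace_molecules \<eta>])
      then show ?case using t by (auto simp: f0 S0_def c_nonneg)
    next
      case (Suc k)
      let ?z = "t *\<^sub>R \<eta> + (\<Sum>i<k. a i *\<^sub>R u (r i))"
      have IH: "?z \<in> fst (f k)" "(\<Sum>i<k. \<bar>a i\<bar> powr p) * \<kappa>' - (2 - 2 / 2 ^ k) * \<epsilon> \<le> c ?z"
        using Suc by auto
      have ak: "\<bar>a k\<bar> \<le> 1" using Suc.prems by simp
      have eq: "t *\<^sub>R \<eta> + (\<Sum>i<Suc k. a i *\<^sub>R u (r i)) = ?z + a k *\<^sub>R u (r k)" by simp
      have "?z + a k *\<^sub>R u (r k) \<in> next_set (fst (f k)) (r k)"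
        unfolding next_set_def using IH ak by blast
      moreover have "fst (f (Suc k)) = next_set (fst (f k)) (r k)"
        using Q[of k] by (simp add: Q_def r_def)
      moreover have "c ?z + \<bar>a k\<bar> powr p * \<kappa>' - \<epsilon> / 2 ^ k \<le> c (?z + a k *\<^sub>R u (r k))"
        using Q[of k] IH(1) ak unfolding Q_def r_def by blast
      moreover have "(2 - 2 / 2 ^ k) * \<epsilon> = 2 * \<epsilon> - 2 * (\<epsilon> / 2 ^ k)"
        "(2 - 2 / 2 ^ Suc k) * \<epsilon> = 2 * \<epsilon> - \<epsilon> / 2 ^ k"
        by (simp_all add: algebra_simps)
      ultimately show ?case
        unfolding eq using IH(2) by (simp add: distrib_right)
    qed
    moreover have "(2 - 2 / 2 ^ k) * \<epsilon> \<le> 2 * \<epsilon>" using \<epsilon> by (simp add: algebra_simps)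
    ultimately show "(\<Sum>i<k. \<bar>a i\<bar> powr p) * (\<kappa> - 6 * \<epsilon>) - 2 * \<epsilon> \<le> c (t *\<^sub>R \<eta> + (\<Sum>i<k. a i *\<^sub>R u (r i)))"
      unfolding \<kappa>'_def by linarith
  qed
qed

text \<open>Subtracting a weak limit \<eta> leaves weakly small u_n to which the gliding hump
  applies. The multiple of \<eta> that reappears in a combination does no harm, because the lower
  bound holds whatever that multiple is.\<close>

lemma separated_lp_subsequence:
  fixes \<xi> :: "nat \<Rightarrow> 'm \<Rightarrow>\<^sub>0 real"
  assumes mol: "\<And>n. \<xi> n \<in> molecules M" and C: "\<And>n. c (\<xi> n) \<le> C" and \<epsilon>: "0 < \<epsilon>"
    and sep: "\<And>m n. m \<noteq> n \<Longrightarrow> \<Delta> \<le> c (\<xi> m - \<xi> n)"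
  obtains r :: "nat \<Rightarrow> nat" where "strict_mono r"
    "\<And>k a. (\<Delta> / 2 - 8 * \<epsilon>) * (\<Sum>i<k. \<bar>a i\<bar> powr p) \<le> c (\<Sum>i<k. a i *\<^sub>R \<xi> (r i))"
proof -
  obtain r0 :: "nat \<Rightarrow> nat" and \<eta> where r0: "strict_mono r0" and \<eta>: "\<eta> \<in> molecules M"
    and lim: "\<forall>R>0. \<forall>\<^sub>F n in sequentially. cR R (\<xi> (r0 n) - \<eta>) \<le> \<epsilon>"
    using extract_limit[of \<xi>, OF mol C \<epsilon>] by (elim exE conjE)
  define v where "v n = \<xi> (r0 n) - \<eta>" for n
  have v: "v n \<in> molecules M" for n unfolding v_def by (intro subspace_diff[OF subspace_molecules] mol \<eta>)
  have vsep: "\<Delta> \<le> c (v m) + c (v n)" if "m \<noteq> n" for m n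
  proof -
    have "r0 m \<noteq> r0 n" using that strict_mono_eq[OF r0] by simp
    then have "\<Delta> \<le> c (v m - v n)" using sep[of "r0 m" "r0 n"] by (simp add: v_def)
    then show ?thesis using c_diff[OF v v, of m n] by simp
  qed
  \<comment> \<open>By \<open>vsep\<close> no two of the v_n can both have cost below \<Delta>/2, so
    at most one index has to be skipped.\<close>
  obtain N where N: "\<And>n. N \<le> n \<Longrightarrow> \<Delta> / 2 \<le> c (v n)"
  proof (cases "\<exists>m. c (v m) < \<Delta> / 2")
    case True
    then obtain m where m: "c (v m) < \<Delta> / 2" by blast
    show thesis
    proof (rule that[of "Suc m"])
      fix n assume "Suc m \<le> n"
      then show "\<Delta> / 2 \<le> c (v n)" using vsep[of m n] m by simp
    qed
  next
    case False
    then show thesis using that[of 0] not_less by blast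
  qed
  define u where "u n = v (N + n)" for n
  have uC: "c (u n) \<le> C + c \<eta>" for n
    using c_diff[OF mol \<eta>, of "r0 (N + n)"] C[of "r0 (N + n)"] by (simp add: u_def v_def)
  have us: "\<forall>\<^sub>F n in sequentially. cR R (u n) \<le> \<epsilon>" if "0 < R" for R
    using lim[rule_format, OF that] unfolding eventually_sequentially u_def v_def
    by (meson trans_le_add2)
  have "u n \<in> molecules M" and "\<Delta> / 2 \<le> c (u n)" for n
    using v N by (simp_all add: u_def)
  from gliding_hump[of u, OF this(1) uC \<epsilon> us this(2) \<eta>]
  obtain r1 :: "nat \<Rightarrow> nat" where r1: "strict_mono r1"
    and lower: "\<forall>k t a. \<bar>t\<bar> \<le> 1 \<longrightarrow> (\<forall>i<k. \<bar>a i\<bar> \<le> 1) \<longrightarrow>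
      (\<Sum>i<k. \<bar>a i\<bar> powr p) * (\<Delta> / 2 - 6 * \<epsilon>) - 2 * \<epsilon> \<le> c (t *\<^sub>R \<eta> + (\<Sum>i<k. a i *\<^sub>R u (r1 i)))"
    by blast
  define r where "r i = r0 (N + r1 i)" for i
  show thesis
  proof (rule that[of r])
    show "strict_mono r"
      using r0 r1 by (auto simp: strict_mono_def r_def)
    fix k and a :: "nat \<Rightarrow> real"
    define s where "s = (\<Sum>i<k. \<bar>a i\<bar> powr p)"
    have s0: "0 \<le> s" by (simp add: s_def sum_nonneg)
    have sum_mol: "(\<Sum>i<k. b i *\<^sub>R \<xi> (r i)) \<in> molecules M" for b
      by (intro subspace_sum[OF subspace_molecules] subspace_scale[OF subspace_molecules] mol)
    show "(\<Delta> / 2 - 8 * \<epsilon>) * (\<Sum>i<k. \<bar>a i\<bar> powr p) \<le> c (\<Sum>i<k. a i *\<^sub>R \<xi> (r i))"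
    proof (cases "s = 0")
      case True
      then show ?thesis using c_nonneg[OF sum_mol] by (simp add: s_def)
    next
      case False
      then have s: "0 < s" using s0 by simp
      \<comment> \<open>Normalisation to l_p norm 1 keeps all coefficients in [-1, 1] and turns the
        additive error 2\<epsilon> into a multiple of the l_p sum.\<close>
      define b where "b i = a i / s powr (1 / p)" for i
      have bp: "\<bar>b i\<bar> powr p = \<bar>a i\<bar> powr p / s" for i
        using s p by (simp add: b_def powr_divide powr_powr)
      have b_sum: "(\<Sum>i<k. \<bar>b i\<bar> powr p) = 1"
        using s by (simp add: bp s_def flip: sum_divide_distrib)
      have b1: "\<bar>b i\<bar> powr p \<le> 1" if "i < k" for i
        using member_le_sum[of i "{..<k}" "\<lambda>i. \<bar>b i\<bar> powr p"] that b_sum by simp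
      have b2: "\<bar>b i\<bar> \<le> 1" if "i < k" for i
        using b1[OF that] p by (metis abs_ge_zero powr_one_eq_one powr_less_mono2 not_le zero_le_one)
      \<comment> \<open>This sum is the coefficient of \<eta>. It is at most 1 in modulus since t
        \<le> t^p on [0, 1].\<close>
      have "\<bar>\<Sum>i<k. b i\<bar> \<le> (\<Sum>i<k. \<bar>b i\<bar>)" by (rule sum_abs)
      also have "\<dots> \<le> (\<Sum>i<k. \<bar>b i\<bar> powr p)"
      proof (rule sum_mono)
        fix i assume "i \<in> {..<k}"
        then have "\<bar>b i\<bar> powr 1 \<le> \<bar>b i\<bar> powr p" using b2[of i] p by (intro powr_mono') auto
        then show "\<bar>b i\<bar> \<le> \<bar>b i\<bar> powr p" by simp
      qed
      finally have b3: "\<bar>\<Sum>i<k. b i\<bar> \<le> 1" by (simp add: b_sum)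
      have "\<xi> (r i) = \<eta> + u (r1 i)" for i by (simp add: r_def u_def v_def)
      then have "(\<Sum>i<k. b i *\<^sub>R \<xi> (r i)) = (\<Sum>i<k. b i) *\<^sub>R \<eta> + (\<Sum>i<k. b i *\<^sub>R u (r1 i))"
        by (simp add: scaleR_add_right sum.distrib scaleR_sum_left)
      \<comment> \<open>The loss 8\<epsilon> is 6\<epsilon> from the splitting, multiplied by the
        l_p sum 1, plus 2\<epsilon> from the accumulated errors.\<close>
      then have "\<Delta> / 2 - 8 * \<epsilon> \<le> c (\<Sum>i<k. b i *\<^sub>R \<xi> (r i))"
        using lower[rule_format, of "\<Sum>i<k. b i" k b] b3 b2 b_sum by simp
      then have "(\<Delta> / 2 - 8 * \<epsilon>) * s \<le> s * c (\<Sum>i<k. b i *\<^sub>R \<xi> (r i))"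
        using s by (simp add: mult.commute)
      also have "\<dots> = \<bar>s powr (1 / p)\<bar> powr p * c (\<Sum>i<k. b i *\<^sub>R \<xi> (r i))"
        using s p by (simp add: powr_powr)
      also have "\<dots> = c (s powr (1 / p) *\<^sub>R (\<Sum>i<k. b i *\<^sub>R \<xi> (r i)))"
        by (rule c_scaleR[OF sum_mol, symmetric])
      also have "s powr (1 / p) *\<^sub>R (\<Sum>i<k. b i *\<^sub>R \<xi> (r i)) = (\<Sum>i<k. a i *\<^sub>R \<xi> (r i))"
        using s by (simp add: b_def scaleR_sum_right)
      finally show ?thesis by (simp add: s_def)
    qed
  qed
qed

end

section \<open>Completion of the molecules\<close>

text \<open>A left inverse of the identity on the subspace; it supplies a linear choice of
  representatives, so that a quotient can be modelled inside the same vector space.\<close>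

lemma subspace_projection:
  fixes Z :: "'a::real_vector set"
  assumes "subspace Z"
  shows "\<exists>g. linear g \<and> (\<forall>x. g x \<in> Z) \<and> (\<forall>x\<in>Z. g x = x)"
proof -
  obtain g where "range g \<subseteq> Z" "linear g" "\<forall>x\<in>Z. g (id x) = x"
    using linear_exists_left_inverse_on[OF linear_id assms inj_on_id] by (elim exE conjE) 
  then show ?thesis by (intro exI[of _ g]) auto
qed

definition lin_ext :: "('m \<Rightarrow> 'x::real_vector) \<Rightarrow> ('m \<Rightarrow>\<^sub>0 real) \<Rightarrow> 'x" where
  "lin_ext f \<xi> = (\<Sum>x\<in>keys \<xi>. lookup \<xi> x *\<^sub>R f x)"

lemma lin_ext_superset:
  "finite S \<Longrightarrow> keys \<xi> \<subseteq> S \<Longrightarrow> lin_ext f \<xi> = (\<Sum>x\<in>S. lookup \<xi> x *\<^sub>R f x)"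
  unfolding lin_ext_def by (intro sum.mono_neutral_left) (auto simp: in_keys_iff)

lemma linear_lin_ext: "linear (lin_ext f)"
proof (rule linearI)
  show "lin_ext f (\<xi> + \<eta>) = lin_ext f \<xi> + lin_ext f \<eta>" for \<xi> \<eta>
    using keys_add[of \<xi> \<eta>]
    by (simp add: lin_ext_superset[of "keys \<xi> \<union> keys \<eta>"] lookup_add scaleR_add_left sum.distrib)
  show "lin_ext f (t *\<^sub>R \<xi>) = t *\<^sub>R lin_ext f \<xi>" for t \<xi>
    using keys_scaleR_subset[of t \<xi>]
    by (simp add: lin_ext_superset[of "keys \<xi>"] scaleR_sum_right)
qed

lemma lin_ext_single [simp]: "lin_ext f (Poly_Mapping.single x a) = a *\<^sub>R f x"
  by (simp add: lin_ext_def)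

lemma lin_ext_dipole: "lin_ext f (dipole u v) = f u - f v"
  by (simp add: dipole_def linear_diff[OF linear_lin_ext])

lemma lin_ext_flow:
  "lin_ext f (flow g) = (\<Sum>e\<in>keys g. lookup g e *\<^sub>R (f (fst e) - f (snd e)))"
  by (simp add: flow_def linear_sum[OF linear_lin_ext] linear_scale[OF linear_lin_ext] lin_ext_dipole)

section \<open>The completion of the molecules as a p-Banach space inside
  \<open>'m test_univ\<close>\<close>

context transport begin

definition cauchy :: "(nat \<Rightarrow> 'm \<Rightarrow>\<^sub>0 real) \<Rightarrow> bool" where
  "cauchy \<sigma> \<longleftrightarrow> (\<forall>n. \<sigma> n \<in> molecules M) \<and> (\<forall>\<epsilon>>0. \<exists>n0. \<forall>m\<ge>n0. \<forall>n\<ge>n0. c (\<sigma> m - \<sigma> n) < \<epsilon>)"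

text \<open>The completion of the molecules is realised by formal combinations of Cauchy sequences
  modulo combinations of norm zero, the quotient being a linear complement.\<close>

definition cauchy_keys :: "(nat \<Rightarrow> 'm \<Rightarrow> real) set" where
  "cauchy_keys = {s. \<exists>\<sigma>. cauchy \<sigma> \<and> s = (\<lambda>n. lookup (\<sigma> n))}"

definition pre :: "'m test_univ set" where
  "pre = {x. keys x \<subseteq> cauchy_keys}"

text \<open>The n-th term of a formal combination of sequences. Keys from \<open>cauchy_keys\<close>
  are coordinate functions of finitely supported elements, and \<open>Abs_poly_mapping\<close>
  recovers these.\<close>

definition ev :: "nat \<Rightarrow> 'm test_univ \<Rightarrow> 'm \<Rightarrow>\<^sub>0 real" where
  "ev n = lin_ext (\<lambda>s. Abs_poly_mapping (s n))"

definition embed :: "(nat \<Rightarrow> 'm \<Rightarrow>\<^sub>0 real) \<Rightarrow> 'm test_univ" where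
  "embed \<sigma> = Poly_Mapping.single (\<lambda>n. lookup (\<sigma> n)) 1"

text \<open>The p-th power of the future quasi-norm: subadditive and p-homogeneous, it is easier to
  handle than \<open>cnorm\<close>.\<close>

definition pnorm :: "'m test_univ \<Rightarrow> real" where
  "pnorm x = lim (\<lambda>n. c (ev n x))"

lemma linear_ev: "linear (ev n)"
  unfolding ev_def by (rule linear_lin_ext)

lemma ev_embed [simp]: "ev n (embed \<sigma>) = \<sigma> n"
  by (simp add: ev_def embed_def lookup_inverse)

lemma embed_in_pre: "cauchy \<sigma> \<Longrightarrow> embed \<sigma> \<in> pre"
  by (auto simp: embed_def pre_def cauchy_keys_def)

lemma cauchy_const: "\<xi> \<in> molecules M \<Longrightarrow> cauchy (\<lambda>n. \<xi>)"
  by (simp add: cauchy_def)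

lemma cauchy_0: "cauchy (\<lambda>n. 0)"
  by (simp add: cauchy_const subspace_0[OF subspace_molecules])

lemma cauchy_add:
  assumes "cauchy \<sigma>" "cauchy \<tau>"
  shows "cauchy (\<lambda>n. \<sigma> n + \<tau> n)"
  unfolding cauchy_def
proof (intro conjI allI impI)
  have mol: "\<sigma> n \<in> molecules M" "\<tau> n \<in> molecules M" for n using assms by (auto simp: cauchy_def)
  then show "\<sigma> n + \<tau> n \<in> molecules M" for n by (intro subspace_add[OF subspace_molecules])
  fix \<epsilon> :: real assume "0 < \<epsilon>"
  then have "0 < \<epsilon> / 2" by simp
  then obtain n1 n2 where n: "\<And>m n. n1 \<le> m \<Longrightarrow> n1 \<le> n \<Longrightarrow> c (\<sigma> m - \<sigma> n) < \<epsilon> / 2"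
    "\<And>m n. n2 \<le> m \<Longrightarrow> n2 \<le> n \<Longrightarrow> c (\<tau> m - \<tau> n) < \<epsilon> / 2"
    using assms unfolding cauchy_def by meson
  show "\<exists>n0. \<forall>m\<ge>n0. \<forall>n\<ge>n0. c (\<sigma> m + \<tau> m - (\<sigma> n + \<tau> n)) < \<epsilon>"
  proof (intro exI allI impI)
    fix m k assume mk: "max n1 n2 \<le> m" "max n1 n2 \<le> k"
    have "c ((\<sigma> m - \<sigma> k) + (\<tau> m - \<tau> k)) \<le> c (\<sigma> m - \<sigma> k) + c (\<tau> m - \<tau> k)"
      by (intro c_add subspace_diff[OF subspace_molecules] mol)
    then show "c (\<sigma> m + \<tau> m - (\<sigma> k + \<tau> k)) < \<epsilon>"
      using n(1)[of m k] n(2)[of m k] mk by (simp add: algebra_simps)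
  qed
qed

lemma cauchy_scaleR:
  assumes "cauchy \<sigma>"
  shows "cauchy (\<lambda>n. t *\<^sub>R \<sigma> n)"
  unfolding cauchy_def
proof (intro conjI allI impI)
  have mol: "\<sigma> n \<in> molecules M" for n using assms by (auto simp: cauchy_def)
  then show "t *\<^sub>R \<sigma> n \<in> molecules M" for n by (intro subspace_scale[OF subspace_molecules])
  fix \<epsilon> :: real assume \<epsilon>: "0 < \<epsilon>"
  have pos: "0 < \<bar>t\<bar> powr p + 1" by (simp add: add_nonneg_pos)
  then have "0 < \<epsilon> / (\<bar>t\<bar> powr p + 1)" using \<epsilon> by simp
  then obtain n0 where n: "\<And>m n. n0 \<le> m \<Longrightarrow> n0 \<le> n \<Longrightarrow> c (\<sigma> m - \<sigma> n) < \<epsilon> / (\<bar>t\<bar> powr p + 1)"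
    using assms unfolding cauchy_def by meson
  show "\<exists>n0. \<forall>m\<ge>n0. \<forall>n\<ge>n0. c (t *\<^sub>R \<sigma> m - t *\<^sub>R \<sigma> n) < \<epsilon>"
  proof (intro exI allI impI)
    fix m k assume mk: "n0 \<le> m" "n0 \<le> k"
    have d: "\<sigma> m - \<sigma> k \<in> molecules M" by (intro subspace_diff[OF subspace_molecules] mol)
    have "c (t *\<^sub>R \<sigma> m - t *\<^sub>R \<sigma> k) = \<bar>t\<bar> powr p * c (\<sigma> m - \<sigma> k)"
      using c_scaleR[OF d, of t] by (simp add: scaleR_diff_right)
    also have "\<dots> \<le> (\<bar>t\<bar> powr p + 1) * c (\<sigma> m - \<sigma> k)"
      using c_nonneg[OF d] by (intro mult_right_mono) auto
    also have "\<dots> < \<epsilon>" using n[OF mk] pos by (simp add: field_simps)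
    finally show "c (t *\<^sub>R \<sigma> m - t *\<^sub>R \<sigma> k) < \<epsilon>" .
  qed
qed

lemma subspace_pre: "subspace pre"
  unfolding pre_def
proof (rule subspaceI; clarsimp)
  show "t \<in> cauchy_keys" if "t \<in> keys (x + y)" "keys x \<subseteq> cauchy_keys" "keys y \<subseteq> cauchy_keys" for x y t
    using that keys_add[of x y] by blast
  show "t \<in> cauchy_keys" if "t \<in> keys (a *\<^sub>R x)" "keys x \<subseteq> cauchy_keys" for a x t
    using that keys_scaleR_subset[of a x] by blast
qed

lemma cauchy_ev:
  assumes "x \<in> pre"
  shows "cauchy (\<lambda>n. ev n x)"
proof -
  have "cauchy (\<lambda>n. \<Sum>s\<in>S. lookup x s *\<^sub>R Abs_poly_mapping (s n))"
    if "finite S" "S \<subseteq> cauchy_keys" for S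
    using that
  proof (induction S)
    case (insert s S)
    then obtain \<sigma> where \<sigma>: "cauchy \<sigma>" "s = (\<lambda>n. lookup (\<sigma> n))" by (auto simp: cauchy_keys_def)
    have "cauchy (\<lambda>n. lookup x s *\<^sub>R \<sigma> n)" by (rule cauchy_scaleR[OF \<sigma>(1)])
    then have "cauchy (\<lambda>n. lookup x s *\<^sub>R Abs_poly_mapping (s n))" by (simp add: \<sigma>(2) lookup_inverse)
    from cauchy_add[OF this] show ?case using insert by simp
  qed (simp add: cauchy_0)
  then show ?thesis using assms by (simp add: ev_def lin_ext_def pre_def)
qed

lemma ev_in_molecules: "x \<in> pre \<Longrightarrow> ev n x \<in> molecules M"
  using cauchy_ev by (auto simp: cauchy_def)

lemma c_ev_LIM:
  assumes "x \<in> pre"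
  shows "(\<lambda>n. c (ev n x)) \<longlonglongrightarrow> pnorm x"
proof -
  have mol: "ev n x \<in> molecules M" for n by (rule ev_in_molecules[OF assms])
  have "Cauchy (\<lambda>n. c (ev n x))"
  proof (rule CauchyI)
    fix e :: real assume "0 < e"
    then obtain n0 where n0: "\<forall>m\<ge>n0. \<forall>n\<ge>n0. c (ev m x - ev n x) < e"
      using cauchy_ev[OF assms] unfolding cauchy_def by meson
    have "\<bar>c (ev m x) - c (ev n x)\<bar> \<le> c (ev m x - ev n x)" for m n
      using c_le_diff[OF mol mol, of m n] c_le_diff[OF mol mol, of n m] c_diff_commute[OF mol mol, of m n]
      by (simp add: abs_le_iff)
    then show "\<exists>n0. \<forall>m\<ge>n0. \<forall>n\<ge>n0. norm (c (ev m x) - c (ev n x)) < e"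
      using n0 by (intro exI[of _ n0] allI impI) (metis le_less_trans real_norm_def)
  qed
  then show ?thesis
    unfolding pnorm_def by (simp add: Cauchy_convergent_iff convergent_LIMSEQ_iff)
qed

lemma pnorm_nonneg: "x \<in> pre \<Longrightarrow> 0 \<le> pnorm x"
  using c_nonneg ev_in_molecules by (intro LIMSEQ_le_const[OF c_ev_LIM]) auto

lemma pnorm_add:
  assumes "x \<in> pre" "y \<in> pre"
  shows "pnorm (x + y) \<le> pnorm x + pnorm y"
proof (rule LIMSEQ_le)
  show "(\<lambda>n. c (ev n (x + y))) \<longlonglongrightarrow> pnorm (x + y)"
    by (intro c_ev_LIM subspace_add[OF subspace_pre] assms)
  show "(\<lambda>n. c (ev n x) + c (ev n y)) \<longlonglongrightarrow> pnorm x + pnorm y"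
    by (intro tendsto_add c_ev_LIM assms)
  show "\<exists>N. \<forall>n\<ge>N. c (ev n (x + y)) \<le> c (ev n x) + c (ev n y)"
    using assms by (simp add: linear_add[OF linear_ev] c_add ev_in_molecules)
qed

lemma pnorm_scaleR:
  assumes "x \<in> pre"
  shows "pnorm (t *\<^sub>R x) = \<bar>t\<bar> powr p * pnorm x"
proof (rule LIMSEQ_unique)
  show "(\<lambda>n. c (ev n (t *\<^sub>R x))) \<longlonglongrightarrow> pnorm (t *\<^sub>R x)"
    by (intro c_ev_LIM subspace_scale[OF subspace_pre] assms)
  show "(\<lambda>n. c (ev n (t *\<^sub>R x))) \<longlonglongrightarrow> \<bar>t\<bar> powr p * pnorm x"
    using tendsto_mult_left[OF c_ev_LIM[OF assms]] assms
    by (simp add: linear_scale[OF linear_ev] c_scaleR ev_in_molecules)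
qed

lemma pnorm_eqI:
  assumes "x \<in> pre" "\<And>n. ev n x = \<xi>"
  shows "pnorm x = c \<xi>"
proof (rule LIMSEQ_unique[OF c_ev_LIM[OF assms(1)]])
  show "(\<lambda>n. c (ev n x)) \<longlonglongrightarrow> c \<xi>" by (simp add: assms(2))
qed

lemma pnorm_cong:
  assumes "x \<in> pre" "y \<in> pre" "pnorm (x - y) = 0"
  shows "pnorm x = pnorm y"
proof -
  have d: "x - y \<in> pre" by (intro subspace_diff[OF subspace_pre] assms)
  have "pnorm (y - x) = 0" using pnorm_scaleR[OF d, of "-1"] assms(3) by simp
  then show ?thesis
    using pnorm_add[OF d assms(2)] pnorm_add[of "y - x" x] assms
    by (simp add: subspace_diff[OF subspace_pre])
qed

lemma subspace_null: "subspace {x \<in> pre. pnorm x = 0}"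
proof (rule subspaceI)
  have "pnorm 0 = 0" using pnorm_scaleR[of 0 0] subspace_0[OF subspace_pre] by simp
  then show "0 \<in> {x \<in> pre. pnorm x = 0}" using subspace_0[OF subspace_pre] by simp
  show "x + y \<in> {x \<in> pre. pnorm x = 0}" if "x \<in> {x \<in> pre. pnorm x = 0}" "y \<in> {x \<in> pre. pnorm x = 0}" for x y
    using that pnorm_add[of x y] pnorm_nonneg[of "x + y"] by (simp add: subspace_add[OF subspace_pre])
  show "t *\<^sub>R x \<in> {x \<in> pre. pnorm x = 0}" if "x \<in> {x \<in> pre. pnorm x = 0}" for t x
    using that by (simp add: subspace_scale[OF subspace_pre] pnorm_scaleR)
qed

text \<open>A linear projection onto the elements of norm zero. Its kernel within \<open>pre\<close>
  stands for the quotient, and \<open>reduce\<close> picks the representative there.\<close>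

definition null_proj :: "'m test_univ \<Rightarrow> 'm test_univ" where
  "null_proj = (SOME g. linear g \<and> (\<forall>x. g x \<in> {x \<in> pre. pnorm x = 0}) \<and>
     (\<forall>x\<in>{x \<in> pre. pnorm x = 0}. g x = x))"

lemma null_proj:
  shows linear_null_proj: "linear null_proj"
    and null_proj_mem: "null_proj x \<in> pre" "pnorm (null_proj x) = 0"
    and null_proj_id: "x \<in> pre \<Longrightarrow> pnorm x = 0 \<Longrightarrow> null_proj x = x"
proof -
  let ?Z = "{x \<in> pre. pnorm x = 0}"
  have "\<exists>g. linear g \<and> (\<forall>x. g x \<in> ?Z) \<and> (\<forall>x\<in>?Z. g x = x)"
    by (rule subspace_projection[OF subspace_null])
  then have "linear null_proj \<and> (\<forall>x. null_proj x \<in> ?Z) \<and> (\<forall>x\<in>?Z. null_proj x = x)"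
    unfolding null_proj_def by (rule someI_ex)
  then show "linear null_proj" "null_proj x \<in> pre" "pnorm (null_proj x) = 0"
    "x \<in> pre \<Longrightarrow> pnorm x = 0 \<Longrightarrow> null_proj x = x" by auto
qed

definition completion :: "'m test_univ set" where
  "completion = {x \<in> pre. null_proj x = 0}"

definition cnorm :: "'m test_univ \<Rightarrow> real" where
  "cnorm x = pnorm x powr (1 / p)"

definition reduce :: "'m test_univ \<Rightarrow> 'm test_univ" where
  "reduce x = x - null_proj x"

lemma linear_reduce: "linear reduce"
  unfolding reduce_def by (rule linear_compose_sub[OF linear_ident linear_null_proj])

lemma reduce_mem: "x \<in> pre \<Longrightarrow> reduce x \<in> completion"
  by (simp add: reduce_def completion_def subspace_diff[OF subspace_pre] null_proj_mem
      linear_diff[OF linear_null_proj] null_proj_id)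

lemma reduce_id: "x \<in> completion \<Longrightarrow> reduce x = x"
  by (simp add: reduce_def completion_def)

lemma pnorm_reduce: "x \<in> pre \<Longrightarrow> pnorm (reduce x) = pnorm x"
  using null_proj_mem[of x] pnorm_scaleR[OF null_proj_mem(1), of "-1" x]
  by (intro pnorm_cong) (simp_all add: reduce_def subspace_diff[OF subspace_pre])

lemma completion_pre: "x \<in> completion \<Longrightarrow> x \<in> pre"
  by (simp add: completion_def)

lemma subspace_completion: "subspace completion"
  unfolding completion_def
  by (rule subspaceI) (simp_all add: subspace_0[OF subspace_pre] subspace_add[OF subspace_pre]
      subspace_scale[OF subspace_pre] linear_add[OF linear_null_proj]
      linear_scale[OF linear_null_proj] linear_0[OF linear_null_proj])

lemma cnorm_powr: "x \<in> pre \<Longrightarrow> cnorm x powr p = pnorm x"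
  using p by (simp add: cnorm_def powr_powr pnorm_nonneg)

lemma quasi_norm_completion: "quasi_norm_on completion cnorm"
  unfolding quasi_norm_on_def
proof (intro conjI ballI allI)
  show "subspace completion" by (rule subspace_completion)
  show "0 \<le> cnorm x" for x by (simp add: cnorm_def)
  show "cnorm x = 0 \<longleftrightarrow> x = 0" if "x \<in> completion" for x
  proof
    assume "cnorm x = 0"
    then have "pnorm x = 0" by (simp add: cnorm_def)
    then show "x = 0" using that null_proj_id[of x] by (simp add: completion_def)
  next
    assume "x = 0"
    then show "cnorm x = 0" using pnorm_scaleR[of 0 0] subspace_0[OF subspace_pre] by (simp add: cnorm_def)
  qed
  show "cnorm (t *\<^sub>R x) = \<bar>t\<bar> * cnorm x" if "x \<in> completion" for t x
    using that p by (simp add: cnorm_def pnorm_scaleR completion_pre powr_mult pnorm_nonneg powr_powr)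
  have "cnorm (x + y) \<le> 2 powr (1 / p) * (cnorm x + cnorm y)"
    if x: "x \<in> completion" "y \<in> completion" for x y
  proof -
    let ?m = "max (pnorm x) (pnorm y)"
    have nn: "0 \<le> pnorm x" "0 \<le> pnorm y" "0 \<le> pnorm (x + y)"
      using x by (auto intro!: pnorm_nonneg completion_pre subspace_add[OF subspace_completion])
    have "pnorm (x + y) \<le> 2 * ?m" using pnorm_add[OF x[THEN completion_pre]] by simp
    then have "cnorm (x + y) \<le> (2 * ?m) powr (1 / p)"
      unfolding cnorm_def using nn p by (intro powr_mono2) auto
    also have "\<dots> = 2 powr (1 / p) * ?m powr (1 / p)" using nn by (simp add: powr_mult)
    also have "?m powr (1 / p) \<le> cnorm x + cnorm y" by (simp add: cnorm_def max_def)
    finally show ?thesis by simp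
  qed
  then show "\<exists>C. \<forall>x\<in>completion. \<forall>y\<in>completion. cnorm (x + y) \<le> C * (cnorm x + cnorm y)" by blast
qed

text \<open>A diagonal argument: from the n-th element a term \<sigma> n is taken that lies within
  1/(n+1) of all later terms of its Cauchy sequence. Then \<sigma> is itself Cauchy and its class is
  the limit.\<close>

lemma complete_completion: "complete_on completion cnorm"
  unfolding complete_on_def
proof (intro allI impI)
  fix u :: "nat \<Rightarrow> 'm test_univ"
  assume u: "\<forall>n. u n \<in> completion" and cau: "\<forall>\<epsilon>>0. \<exists>n0. \<forall>m\<ge>n0. \<forall>n\<ge>n0. cnorm (u m - u n) < \<epsilon>"
  have upre: "u n \<in> pre" and ud: "u m - u n \<in> pre" for m n
    using u by (auto intro!: completion_pre subspace_diff[OF subspace_completion])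
  have evm: "ev k (u n) \<in> molecules M" for k n by (rule ev_in_molecules[OF upre])
  have cau': "\<exists>n0. \<forall>m\<ge>n0. \<forall>n\<ge>n0. pnorm (u m - u n) < \<epsilon>" if \<epsilon>: "0 < \<epsilon>" for \<epsilon>
  proof -
    have "0 < \<epsilon> powr (1 / p)" using \<epsilon> by simp
    then obtain n0 where n0: "\<forall>m\<ge>n0. \<forall>n\<ge>n0. cnorm (u m - u n) < \<epsilon> powr (1 / p)" using cau by blast
    have "pnorm (u m - u n) < \<epsilon>" if "n0 \<le> m" "n0 \<le> n" for m n
    proof -
      have "cnorm (u m - u n) powr p < (\<epsilon> powr (1 / p)) powr p"
        using n0 that p by (intro powr_less_mono2) (auto simp: cnorm_def)
      then show ?thesis using ud \<epsilon> p by (simp add: cnorm_powr powr_powr)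
    qed
    then show ?thesis by blast
  qed
  have "\<exists>k. \<forall>m\<ge>k. c (ev m (u n) - ev k (u n)) < inverse (real (Suc n))" for n
    using cauchy_ev[OF upre[of n]] unfolding cauchy_def
    by (meson inverse_positive_iff_positive of_nat_0_less_iff order_refl zero_less_Suc)
  then obtain k where k: "\<And>n m. k n \<le> m \<Longrightarrow> c (ev m (u n) - ev (k n) (u n)) < inverse (real (Suc n))"
    by metis
  define \<sigma> where "\<sigma> n = ev (k n) (u n)" for n
  have \<sigma>M: "\<sigma> n \<in> molecules M" for n by (simp add: \<sigma>_def evm)
  have \<sigma>_close: "c (\<sigma> m - \<sigma> n) \<le> inverse (real (Suc m)) + inverse (real (Suc n)) + pnorm (u m - u n)" for m n
  proof -
    have "c (\<sigma> m - \<sigma> n) - inverse (real (Suc m)) - inverse (real (Suc n)) \<le> c (ev i (u m - u n))"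
      if i: "max (k m) (k n) \<le> i" for i
    proof -
      have "\<sigma> m - \<sigma> n = (\<sigma> m - ev i (u m)) + (ev i (u m - u n) + (ev i (u n) - \<sigma> n))"
        by (simp add: linear_diff[OF linear_ev])
      also have "c \<dots> \<le> c (\<sigma> m - ev i (u m)) + (c (ev i (u m - u n)) + c (ev i (u n) - \<sigma> n))"
        by (intro order_trans[OF c_add] add_mono order_refl subspace_add[OF subspace_molecules]
            subspace_diff[OF subspace_molecules] \<sigma>M evm ev_in_molecules ud)
      also have "c (\<sigma> m - ev i (u m)) \<le> inverse (real (Suc m))"
        using k[of m i] i c_diff_commute[OF \<sigma>M evm, of m i m] by (simp add: \<sigma>_def)
      also have "c (ev i (u n) - \<sigma> n) \<le> inverse (real (Suc n))"
        using k[of n i] i by (simp add: \<sigma>_def)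
      finally show ?thesis by simp
    qed
    then have "c (\<sigma> m - \<sigma> n) - inverse (real (Suc m)) - inverse (real (Suc n)) \<le> pnorm (u m - u n)"
      by (intro LIMSEQ_le_const[OF c_ev_LIM[OF ud]]) blast
    then show ?thesis by simp
  qed
  have inv: "\<exists>n0. \<forall>n\<ge>n0. inverse (real (Suc n)) < \<epsilon>" if "0 < \<epsilon>" for \<epsilon>
    using order_tendstoD(2)[OF LIMSEQ_inverse_real_of_nat that] by (simp add: eventually_sequentially)
  have \<sigma>: "cauchy \<sigma>"
    unfolding cauchy_def
  proof (intro conjI allI impI \<sigma>M)
    fix \<epsilon> :: real assume "0 < \<epsilon>"
    then have e3: "0 < \<epsilon> / 3" by simp
    obtain n1 where n1: "\<forall>m\<ge>n1. \<forall>n\<ge>n1. pnorm (u m - u n) < \<epsilon> / 3" using cau'[OF e3] by blast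
    obtain n2 where n2: "\<forall>n\<ge>n2. inverse (real (Suc n)) < \<epsilon> / 3" using inv[OF e3] by blast
    show "\<exists>n0. \<forall>m\<ge>n0. \<forall>n\<ge>n0. c (\<sigma> m - \<sigma> n) < \<epsilon>"
    proof (intro exI allI impI)
      fix m n assume mn: "max n1 n2 \<le> m" "max n1 n2 \<le> n"
      have "inverse (real (Suc m)) < \<epsilon> / 3" "inverse (real (Suc n)) < \<epsilon> / 3"
        "pnorm (u m - u n) < \<epsilon> / 3"
        using n1 n2 mn by auto
      then show "c (\<sigma> m - \<sigma> n) < \<epsilon>" using \<sigma>_close[of m n] by linarith
    qed
  qed
  define x where "x = reduce (embed \<sigma>)"
  have x: "x \<in> completion" unfolding x_def by (intro reduce_mem embed_in_pre \<sigma>)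
  have ue: "u n - embed \<sigma> \<in> pre" for n by (intro subspace_diff[OF subspace_pre] upre embed_in_pre \<sigma>)
  \<comment> \<open>Reduction preserves \<open>pnorm\<close> and fixes each u n, so the limit may be
    computed with the unreduced class of \<sigma>.\<close>
  have "pnorm (u n - x) = pnorm (u n - embed \<sigma>)" for n
    using pnorm_reduce[OF ue[of n]] u by (simp add: linear_diff[OF linear_reduce] reduce_id x_def)
  moreover have "(\<lambda>n. pnorm (u n - embed \<sigma>)) \<longlonglongrightarrow> 0"
  proof (rule LIMSEQ_I)
    fix \<epsilon> :: real assume "0 < \<epsilon>"
    then have e4: "0 < \<epsilon> / 4" by simp
    obtain n1 where n1: "\<forall>m\<ge>n1. \<forall>n\<ge>n1. c (\<sigma> m - \<sigma> n) < \<epsilon> / 4"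
      using \<sigma> e4 unfolding cauchy_def by blast
    obtain n2 where n2: "\<forall>n\<ge>n2. inverse (real (Suc n)) < \<epsilon> / 4" using inv[OF e4] by blast
    have "norm (pnorm (u n - embed \<sigma>) - 0) < \<epsilon>" if n: "max n1 n2 \<le> n" for n
    proof -
      have "c (ev i (u n - embed \<sigma>)) \<le> \<epsilon> / 2" if i: "max n1 (k n) \<le> i" for i
      proof -
        have "ev i (u n - embed \<sigma>) = (ev i (u n) - \<sigma> n) + (\<sigma> n - \<sigma> i)"
          by (simp add: linear_diff[OF linear_ev])
        also have "c \<dots> \<le> c (ev i (u n) - \<sigma> n) + c (\<sigma> n - \<sigma> i)"
          by (intro c_add subspace_diff[OF subspace_molecules] \<sigma>M evm)
        also have "c (ev i (u n) - \<sigma> n) \<le> inverse (real (Suc n))"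
          using k[of n i] i by (simp add: \<sigma>_def)
        also have "inverse (real (Suc n)) \<le> \<epsilon> / 4" using n2 n by (simp add: less_imp_le)
        also have "c (\<sigma> n - \<sigma> i) \<le> \<epsilon> / 4" using n1 n i by (simp add: less_imp_le)
        finally show ?thesis by simp
      qed
      then have "pnorm (u n - embed \<sigma>) \<le> \<epsilon> / 2"
        by (intro LIMSEQ_le_const2[OF c_ev_LIM[OF ue]]) blast
      then show ?thesis using pnorm_nonneg[OF ue[of n]] \<open>0 < \<epsilon>\<close> by simp
    qed
    then show "\<exists>n0. \<forall>n\<ge>n0. norm (pnorm (u n - embed \<sigma>) - 0) < \<epsilon>" by blast
  qed
  ultimately have "(\<lambda>n. pnorm (u n - x)) \<longlonglongrightarrow> 0" by simp
  then have "(\<lambda>n. pnorm (u n - x) powr (1 / p)) \<longlonglongrightarrow> 0 powr (1 / p)"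
    using p u x
    by (intro tendsto_powr2 tendsto_const)
      (auto intro!: always_eventually pnorm_nonneg completion_pre subspace_diff[OF subspace_completion])
  then show "\<exists>x\<in>completion. (\<lambda>n. cnorm (u n - x)) \<longlonglongrightarrow> 0"
    using x by (auto simp: cnorm_def)
qed

lemma s_banach_completion: "s_banach p completion cnorm"
  unfolding s_banach_def
  using p quasi_norm_completion complete_completion pnorm_add
  by (simp add: cnorm_powr completion_pre subspace_add[OF subspace_pre])

end

section \<open>The norm of a Lipschitz-free space\<close>

lemma quasi_norm_0: "quasi_norm_on V N \<Longrightarrow> N 0 = 0"
  unfolding quasi_norm_on_def using subspace_0 by blast

lemma quasi_norm_uminus:
  assumes "quasi_norm_on V N" "x \<in> V"
  shows "N (- x) = N x"
proof -
  have "N ((-1) *\<^sub>R x) = \<bar>-1\<bar> * N x" using assms unfolding quasi_norm_on_def by blast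
  then show ?thesis by simp
qed

text \<open>A real supremum bounds its members only if the family is bounded above, which follows
  from boundedness of \<open>T\<close>. Where \<open>N v = 0\<close> the quotient says nothing and
  the bound on \<open>T\<close> is used directly.\<close>

lemma op_norm_bound:
  assumes N: "quasi_norm_on V N" and N': "quasi_norm_on W N'" and T: "bounded_linear_on V N W N' T"
    and le: "op_norm_on V N N' T \<le> C" and v: "v \<in> V"
  shows "N' (T v) \<le> C * N v"
proof -
  have N_nonneg: "0 \<le> N x" if "x \<in> V" for x using N that by (simp add: quasi_norm_on_def)
  obtain B where B: "\<And>x. x \<in> V \<Longrightarrow> N' (T x) \<le> B * N x"
    using T unfolding bounded_linear_on_def by blast
  \<comment> \<open>The maximum with 0 covers a negative \<open>B\<close> and the degenerate
    quotient, which has the value 0.\<close>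
  have "N' (T x) / N x \<le> max B 0" if x: "x \<in> V" for x
  proof (cases "N x = 0")
    case False
    then have "0 < N x" using N_nonneg[OF x] by simp
    then show ?thesis using B[OF x] by (simp add: pos_divide_le_eq le_max_iff_disj)
  qed simp
  then have "bdd_above ((\<lambda>x. N' (T x) / N x) ` V)" by (intro bdd_aboveI[of _ "max B 0"]) auto
  then have "N' (T v) / N v \<le> C"
    using le v unfolding op_norm_on_def by (meson cSUP_upper order_trans)
  moreover have "N' (T v) = 0" if "N v = 0"
  proof -
    have "0 \<le> N' (T v)" using T N' v by (auto simp: bounded_linear_on_def quasi_norm_on_def)
    then show ?thesis using B[OF v] that by simp
  qed
  ultimately show ?thesis
    using N_nonneg[OF v] by (cases "N v = 0") (auto simp: pos_divide_le_eq)
qed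

lemma bounded_linear_on_sum:
  assumes T: "bounded_linear_on V N W N' T" and V: "subspace V" and f: "\<And>i. i \<in> I \<Longrightarrow> f i \<in> V"
  shows "T (\<Sum>i\<in>I. a i *\<^sub>R f i) = (\<Sum>i\<in>I. a i *\<^sub>R T (f i))"
proof -
  have add: "T (x + y) = T x + T y" and scale: "T (c *\<^sub>R x) = c *\<^sub>R T x"
    if "x \<in> V" "y \<in> V" for x y c
    using T that by (simp_all add: bounded_linear_on_def)
  have T0: "T 0 = 0" using scale[of 0 0 0] subspace_0[OF V] by simp
  show ?thesis using f
  proof (induction I rule: infinite_finite_induct)
    case (insert i I)
    then have "T (\<Sum>i\<in>insert i I. a i *\<^sub>R f i) = T (a i *\<^sub>R f i) + T (\<Sum>i\<in>I. a i *\<^sub>R f i)"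
      using V by (simp add: add subspace_scale subspace_sum)
    then show ?case using insert by (simp add: scale[of "f i" "f i"])
  qed (auto simp: T0)
qed

lemma s_banach_sum:
  assumes V: "s_banach p V N" and f: "\<And>i. i \<in> I \<Longrightarrow> f i \<in> V"
  shows "N (\<Sum>i\<in>I. a i *\<^sub>R f i) powr p \<le> (\<Sum>i\<in>I. \<bar>a i\<bar> powr p * N (f i) powr p)"
proof -
  have q: "quasi_norm_on V N" and sub: "subspace V"
    using V by (auto simp: s_banach_def quasi_norm_on_def)
  have scale: "N (t *\<^sub>R x) powr p = \<bar>t\<bar> powr p * N x powr p" if "x \<in> V" for t x
    using q that by (simp add: quasi_norm_on_def powr_mult)
  show ?thesis using f
  proof (induction I rule: infinite_finite_induct)
    case (insert i I)
    have "N (\<Sum>i\<in>insert i I. a i *\<^sub>R f i) powr p \<le> N (a i *\<^sub>R f i) powr p + N (\<Sum>i\<in>I. a i *\<^sub>R f i) powr p"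
      using insert V sub by (simp add: s_banach_def subspace_scale subspace_sum)
    then show ?case using insert by (simp add: scale)
  qed (auto simp: quasi_norm_0[OF q])
qed

text \<open>Because \<delta> vanishes at the base point, each \<delta> x is the image of the dipole
  from x to b, so molecules reach the whole span.\<close>

lemma span_eq_lin_ext:
  assumes b: "b \<in> M" "\<delta> b = 0" and u: "u \<in> span (\<delta> ` M)"
  shows "\<exists>\<xi>\<in>molecules M. u = lin_ext \<delta> \<xi>"
proof -
  have "\<delta> x \<in> lin_ext \<delta> ` molecules M" if "x \<in> M" for x
    using b that by (intro image_eqI[of _ _ "dipole x b"] dipole_in_molecules) (auto simp: lin_ext_dipole)
  moreover have "subspace (lin_ext \<delta> ` molecules M)"
    by (rule linear_subspace_image[OF linear_lin_ext subspace_molecules])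
  ultimately have "span (\<delta> ` M) \<subseteq> lin_ext \<delta> ` molecules M" by (intro span_minimal) auto
  then show ?thesis using u by blast
qed

text \<open>The weight is tied to the p-metric on \<open>M\<close> only. In the application it is
  (d^q)^(p/q), which has this value while exhibiting the snowflake structure.\<close>

locale free_space = transport p w M for p w and M :: "'m set" +
  fixes d :: "'m \<Rightarrow> 'm \<Rightarrow> real" and b and V :: "'x::real_vector set" and N \<delta>
  assumes free: "lipschitz_free_space p M d b V N \<delta>"
    and b: "b \<in> M" and d_nonneg: "\<And>x y. 0 \<le> d x y"
    and w_eq: "\<And>x y. x \<in> M \<Longrightarrow> y \<in> M \<Longrightarrow> w (x, y) = d x y powr p"
begin

lemmas free_conj = free[unfolded lipschitz_free_space_def]

lemmas s_banach_V = free_conj[THEN conjunct1]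
  and \<delta>_image = free_conj[THEN conjunct2, THEN conjunct1]
  and \<delta>_b = free_conj[THEN conjunct2, THEN conjunct2, THEN conjunct1]
  and \<delta>_isometric = free_conj[THEN conjunct2, THEN conjunct2, THEN conjunct2, THEN conjunct1]
  and closed_span =
    free_conj[THEN conjunct2, THEN conjunct2, THEN conjunct2, THEN conjunct2, THEN conjunct1]
  and universal =
    free_conj[THEN conjunct2, THEN conjunct2, THEN conjunct2, THEN conjunct2, THEN conjunct2]

lemma \<delta>_in: "x \<in> M \<Longrightarrow> \<delta> x \<in> V"
  using \<delta>_image by blast

lemma N_\<delta>: "x \<in> M \<Longrightarrow> y \<in> M \<Longrightarrow> N (\<delta> x - \<delta> y) = d x y"
  using \<delta>_isometric by blast

lemma qnorm_V: "quasi_norm_on V N"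
  using s_banach_V by (simp add: s_banach_def)

lemma subspace_V: "subspace V"
  using qnorm_V by (simp add: quasi_norm_on_def)

lemma lin_ext_in_V:
  assumes "\<xi> \<in> molecules M"
  shows "lin_ext \<delta> \<xi> \<in> V"
proof -
  obtain g where g: "keys g \<subseteq> M \<times> M" "\<xi> = flow g" using assms by (auto simp: molecules_def)
  show ?thesis
    unfolding g(2) lin_ext_flow
    by (intro subspace_sum[OF subspace_V] subspace_scale[OF subspace_V] subspace_diff[OF subspace_V] \<delta>_in)
      (use g(1) in auto)
qed

lemma N_lin_ext_le:
  assumes "\<xi> \<in> molecules M"
  shows "N (lin_ext \<delta> \<xi>) powr p \<le> c \<xi>"
proof (rule dense_ge)
  fix t assume "c \<xi> < t"
  then obtain g where g: "g \<in> flows M \<xi>" "cost p w g < t" using c_approx[OF assms] by blast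
  have gM: "fst e \<in> M" "snd e \<in> M" if "e \<in> keys g" for e using g(1) that by (auto simp: flows_def)
  have "N (lin_ext \<delta> \<xi>) powr p = N (\<Sum>e\<in>keys g. lookup g e *\<^sub>R (\<delta> (fst e) - \<delta> (snd e))) powr p"
    using g(1) lin_ext_flow[of \<delta> g] by (simp add: flows_def)
  also have "\<dots> \<le> (\<Sum>e\<in>keys g. \<bar>lookup g e\<bar> powr p * N (\<delta> (fst e) - \<delta> (snd e)) powr p)"
    by (intro s_banach_sum[OF s_banach_V] subspace_diff[OF subspace_V] \<delta>_in gM)
  also have "\<dots> = cost p w g"
    unfolding cost_def using gM w_eq by (intro sum.cong) (auto simp: N_\<delta> simp flip: w_eq)
  finally show "N (lin_ext \<delta> \<xi>) powr p \<le> t" using g(2) by simp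
qed

text \<open>The universal property is applied to the canonical map into the completion.\<close>

lemma c_le_N_lin_ext:
  assumes \<xi>: "\<xi> \<in> molecules M"
  shows "c \<xi> \<le> N (lin_ext \<delta> \<xi>) powr p"
proof -
  have cdip: "cauchy (\<lambda>n. dipole x b)" if "x \<in> M" for x
    using that b by (intro cauchy_const dipole_in_molecules)
  \<comment> \<open>The point x becomes the constant sequence of the molecule x - b;
    \<open>f\<close> is the corresponding class in the completion.\<close>
  define f0 where "f0 x = embed (\<lambda>n. dipole x b)" for x
  define f where "f x = reduce (f0 x)" for x
  have f0: "f0 x \<in> pre" if "x \<in> M" for x unfolding f0_def by (intro embed_in_pre cdip that)
  have f: "f x \<in> completion" if "x \<in> M" for x unfolding f_def by (intro reduce_mem f0 that)
  have fd: "cnorm (f x - f y) \<le> d x y" if x: "x \<in> M" "y \<in> M" for x y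
  proof -
    have pre: "f0 x - f0 y \<in> pre" by (intro subspace_diff[OF subspace_pre] f0 x)
    have "pnorm (f x - f y) = pnorm (f0 x - f0 y)"
      unfolding f_def linear_diff[OF linear_reduce, symmetric] by (rule pnorm_reduce[OF pre])
    also have "\<dots> = c (dipole x b - dipole y b)"
      by (rule pnorm_eqI[OF pre]) (simp add: linear_diff[OF linear_ev] f0_def)
    also have "dipole x b - dipole y b = 1 *\<^sub>R dipole x y" by (simp add: dipole_def)
    also have "c \<dots> \<le> d x y powr p" using c_dipole[OF x, of 1] w_eq[OF x] by simp
    finally have "pnorm (f x - f y) \<le> d x y powr p" .
    then have "cnorm (f x - f y) \<le> (d x y powr p) powr (1 / p)"
      unfolding cnorm_def using p x
      by (intro powr_mono2 pnorm_nonneg subspace_diff[OF subspace_pre] completion_pre f) auto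
    then show ?thesis using p d_nonneg by (simp add: powr_powr)
  qed
  have fb: "f b = 0"
  proof -
    have "pnorm (f0 b) = c 0" by (rule pnorm_eqI[OF f0[OF b]]) (simp add: f0_def)
    then show ?thesis using f0[OF b] by (simp add: f_def reduce_def null_proj_id)
  qed
  have "pointed_lipschitz M d b completion cnorm f"
    unfolding pointed_lipschitz_def using f fb fd by (auto intro!: exI[of _ 1])
  with s_banach_completion universal obtain T where
    T: "bounded_linear_on V N completion cnorm T" "\<forall>x\<in>M. T (\<delta> x) = f x"
      "op_norm_on V N cnorm T = lip_const M d cnorm f"
    by meson
  \<comment> \<open>Degenerate quotients are 0, and all others are at most 1 by \<open>fd\<close>.
    Thus the extension \<open>T\<close> is a contraction, which gives the lower bound for
    \<open>N\<close>.\<close>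
  have "lip_const M d cnorm f \<le> 1"
    unfolding lip_const_def
  proof (rule cSUP_least)
    show "M \<times> M \<noteq> {}" using b by auto
    show "(case z of (x, y) \<Rightarrow> cnorm (f x - f y) / d x y) \<le> 1" if "z \<in> M \<times> M" for z
      using that fd d_nonneg by (cases z) (auto simp: divide_le_eq_1 less_le)
  qed
  then have T_le: "cnorm (T v) \<le> N v" if "v \<in> V" for v
    using op_norm_bound[OF qnorm_V quasi_norm_completion T(1), of 1 v] T(3) that by simp
  obtain g where g: "keys g \<subseteq> M \<times> M" "\<xi> = flow g" using \<xi> by (auto simp: molecules_def)
  have gM: "fst e \<in> M" "snd e \<in> M" if "e \<in> keys g" for e using g(1) that by auto
  let ?x = "\<Sum>e\<in>keys g. lookup g e *\<^sub>R (f0 (fst e) - f0 (snd e))"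
  have Td: "T (\<delta> x - \<delta> y) = f x - f y" if "x \<in> M" "y \<in> M" for x y
    using bounded_linear_on_sum[OF T(1) subspace_V, of "{True, False}" "\<lambda>i. if i then \<delta> x else \<delta> y"
        "\<lambda>i. if i then 1 else -1"] that T(2) by (simp add: \<delta>_in)
  have "T (lin_ext \<delta> \<xi>) = (\<Sum>e\<in>keys g. lookup g e *\<^sub>R T (\<delta> (fst e) - \<delta> (snd e)))"
    unfolding g(2) lin_ext_flow
    by (intro bounded_linear_on_sum[OF T(1) subspace_V] subspace_diff[OF subspace_V] \<delta>_in gM)
  also have "\<dots> = (\<Sum>e\<in>keys g. lookup g e *\<^sub>R (f (fst e) - f (snd e)))"
    using gM by (intro sum.cong) (auto simp: Td)
  also have "\<dots> = reduce ?x"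
    by (simp add: f_def linear_sum[OF linear_reduce] linear_scale[OF linear_reduce]
        linear_diff[OF linear_reduce])
  finally have T\<xi>: "T (lin_ext \<delta> \<xi>) = reduce ?x" .
  have xpre: "?x \<in> pre"
    by (intro subspace_sum[OF subspace_pre] subspace_scale[OF subspace_pre]
        subspace_diff[OF subspace_pre] f0 gM)
  \<comment> \<open>The base point cancels in each difference, so \<open>?x\<close> evaluates to the
    constant sequence \<xi> and its \<open>pnorm\<close> is exactly \<open>c \<xi>\<close>.\<close>
  have "ev n ?x = \<xi>" for n
    unfolding g(2) flow_def
    by (simp add: linear_sum[OF linear_ev] linear_scale[OF linear_ev] linear_diff[OF linear_ev] f0_def)
      (simp add: dipole_def)
  then have "c \<xi> = pnorm ?x" using pnorm_eqI[OF xpre] by metis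
  also have "\<dots> = cnorm (T (lin_ext \<delta> \<xi>)) powr p"
    unfolding T\<xi> using pnorm_reduce[OF xpre] cnorm_powr[OF completion_pre[OF reduce_mem[OF xpre]]] by simp
  also have "\<dots> \<le> N (lin_ext \<delta> \<xi>) powr p"
    using p T_le[OF lin_ext_in_V[OF \<xi>]] by (intro powr_mono2) (auto simp: cnorm_def)
  finally show ?thesis .
qed

lemma N_lin_ext: "\<xi> \<in> molecules M \<Longrightarrow> N (lin_ext \<delta> \<xi>) powr p = c \<xi>"
  using N_lin_ext_le c_le_N_lin_ext by (simp add: antisym)

lemma N_powr_triangle: "x \<in> V \<Longrightarrow> y \<in> V \<Longrightarrow> N (x + y) powr p \<le> N x powr p + N y powr p"
  using s_banach_V by (simp add: s_banach_def)

lemma N_nonneg: "x \<in> V \<Longrightarrow> 0 \<le> N x"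
  using qnorm_V by (simp add: quasi_norm_on_def)

lemma N_minus_commute: "x \<in> V \<Longrightarrow> y \<in> V \<Longrightarrow> N (x - y) = N (y - x)"
  using quasi_norm_uminus[OF qnorm_V, of "x - y"] subspace_diff[OF subspace_V] by simp

lemma N_powr_le_diff:
  "x \<in> V \<Longrightarrow> y \<in> V \<Longrightarrow> N x powr p \<le> N (x - y) powr p + N y powr p"
  using N_powr_triangle[of "x - y" y] subspace_diff[OF subspace_V] by simp

lemma molecule_approximation:
  assumes x: "x \<in> V" and \<epsilon>: "0 < \<epsilon>"
  obtains \<xi> where "\<xi> \<in> molecules M" "N (x - lin_ext \<delta> \<xi>) powr p \<le> \<epsilon>"
proof -
  have "0 < \<epsilon> powr (1 / p)" using \<epsilon> by simp
  moreover have "x \<in> closed_span_in V N (\<delta> ` M)" using x closed_span by simp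
  ultimately obtain u where u: "u \<in> span (\<delta> ` M)" "N (x - u) < \<epsilon> powr (1 / p)"
    unfolding closed_span_in_def by blast
  obtain \<xi> where \<xi>: "\<xi> \<in> molecules M" "u = lin_ext \<delta> \<xi>"
    using span_eq_lin_ext[OF b \<delta>_b u(1)] by blast
  have "N (x - u) powr p \<le> (\<epsilon> powr (1 / p)) powr p"
    using u \<xi> x p lin_ext_in_V[OF \<xi>(1)] N_nonneg[of "x - u"] subspace_diff[OF subspace_V]
    by (intro powr_mono2) auto
  then show thesis using that[OF \<xi>(1)] \<xi>(2) \<epsilon> p by (simp add: powr_powr)
qed

end

text \<open>Both powers of 16 have negative exponents, so the bracket is 1 plus nonnegative
  terms.\<close>

lemma schur_const_ge_1:
  assumes "0 < p" "p < q" "1 \<le> \<Gamma>"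
  shows "1 \<le> schur_const \<Gamma> p q"
proof -
  have "16 powr (p - q) < 16 powr (0::real)" "16 powr (- p) < 16 powr (0::real)"
    using assms by (intro powr_less_mono; simp)+
  then have "0 \<le> 1 / (1 - 16 powr (p - q))" "0 \<le> 1 / (1 - 16 powr (- p))" by simp_all
  then have "1 powr (1 / p) \<le> (1 / (1 - 16 powr (p - q)) + 1 + 1 / (1 - 16 powr (- p))) powr (1 / p)"
    using assms by (intro powr_mono2) auto
  then have "1 * 1 \<le> schur_const \<Gamma> p q"
    unfolding schur_const_def using assms by (intro mult_mono) auto
  then show ?thesis by simp
qed

text \<open>The lower estimate with p-th power constant s^p/2 holds up to any prescribed error. As
  the definition asks only for \<open>K\<^sub>0 > C \<ge> 1\<close>, the factor
  \<open>K\<^sub>0\<close> leaves room for that error.\<close>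

lemma free_space_strong_schur:
  fixes K :: "'m set" and V :: "'x::real_vector set"
  assumes p: "0 < p" "p < q" "q \<le> 1" and C: "1 \<le> C"
    and K: "pointed_s_metric q K d b" "s_compact q K d" and free: "lipschitz_free_space p K d b V N \<delta>"
  shows "strong_schur p C V N"
proof -
  have d: "\<And>x y. 0 \<le> d x y" and b: "b \<in> K" and met: "Metric_space K (\<lambda>x y. d x y powr q)"
    using K by (auto simp: pointed_s_metric_def s_metric_def)
  have q: "0 < q" using p by simp
  interpret snowflake K "\<lambda>x y. d x y powr q" p "p / q"
  proof -
    interpret Metric_space K "\<lambda>x y. d x y powr q" by (rule met)
    show "snowflake K (\<lambda>x y. d x y powr q) p (p / q)"
      by unfold_locales (use p K(2) b in \<open>auto simp: s_compact_def\<close>)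
  qed
  interpret free_space p \<omega> K d b V N \<delta>
    by unfold_locales (use free b d p q in \<open>auto simp: \<omega>_def powr_powr\<close>)
  show ?thesis
    unfolding strong_schur_def
  proof (intro conjI allI impI C s_banach_V)
    fix s K\<^sub>0 :: real and A
    assume s: "0 < s" and K0: "C < K\<^sub>0"
      and A: "infinite A \<and> A \<subseteq> {x \<in> V. N x = 1} \<and> (\<forall>x\<in>A. \<forall>y\<in>A. x \<noteq> y \<longrightarrow> s \<le> N (x - y))"
    \<comment> \<open>The p-th power of the constant demanded by the strong Schur property.\<close>
    define \<tau> where "\<tau> = s powr p / (2 * K\<^sub>0 powr p)"
    have K0p: "1 < K\<^sub>0 powr p"
      using powr_less_mono2[of p 1 K\<^sub>0] C K0 p by simp
    \<comment> \<open>The gap is spent in ten equal parts: one on the separation after approximation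
      by molecules, eight on \<open>separated_lp_subsequence\<close>, one on returning from the
      molecules to the given vectors.\<close>
    define \<epsilon> where "\<epsilon> = (s powr p / 2 - \<tau>) / 10"
    have "\<tau> < s powr p / 2"
      unfolding \<tau>_def using s K0p by (intro divide_strict_left_mono) auto
    then have \<epsilon>: "0 < \<epsilon>" by (simp add: \<epsilon>_def)
    obtain x :: "nat \<Rightarrow> 'x" where x: "inj x" "range x \<subseteq> A"
      using infinite_countable_subset[OF conjunct1[OF A]] by (elim exE conjE)
    have xA: "x n \<in> A" for n by (rule subsetD[OF x(2) rangeI])
    then have xV: "x n \<in> V" and x1: "N (x n) = 1" for n
      using subsetD[OF A[THEN conjunct2, THEN conjunct1], OF xA[of n]] by simp_all
    have "\<exists>\<xi>. \<xi> \<in> molecules K \<and> N (x n - lin_ext \<delta> \<xi>) powr p \<le> \<epsilon>" for n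
      using molecule_approximation[OF xV \<epsilon>] by metis
    then obtain \<xi> where \<xi>: "\<And>n. \<xi> n \<in> molecules K"
      and close: "\<And>n. N (x n - lin_ext \<delta> (\<xi> n)) powr p \<le> \<epsilon>" by metis
    define y where "y n = lin_ext \<delta> (\<xi> n)" for n
    have yV: "y n \<in> V" for n unfolding y_def by (intro lin_ext_in_V \<xi>)
    have close': "N (x n - y n) powr p \<le> \<epsilon>" "N (y n - x n) powr p \<le> \<epsilon>" for n
      using close[of n] N_minus_commute[OF xV yV, of n n] by (auto simp: y_def)
    have bound: "c (\<xi> n) \<le> 1 + \<epsilon>" for n
      using N_powr_le_diff[OF yV xV, of n n] close'[of n] N_lin_ext[OF \<xi>] x1 by (simp add: y_def)
    have sep: "s powr p - 2 * \<epsilon> \<le> c (\<xi> m - \<xi> n)" if "m \<noteq> n" for m n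
    proof -
      have "x m \<noteq> x n" using that x(1) by (auto dest: injD)
      then have "s powr p \<le> N (x m - x n) powr p"
        using A xA s p by (intro powr_mono2) auto
      also have "x m - x n = (x m - y m) + ((y m - y n) + (y n - x n))" by simp
      also have "N \<dots> powr p \<le> N (x m - y m) powr p + (N (y m - y n) powr p + N (y n - x n) powr p)"
        by (intro order_trans[OF N_powr_triangle] add_mono order_refl subspace_diff[OF subspace_V]
            subspace_add[OF subspace_V] xV yV)
      finally have "s powr p \<le> 2 * \<epsilon> + N (y m - y n) powr p"
        using close'(1)[of m] close'(2)[of n] by simp
      also have "y m - y n = lin_ext \<delta> (\<xi> m - \<xi> n)" by (simp add: y_def linear_diff[OF linear_lin_ext])
      also have "N \<dots> powr p = c (\<xi> m - \<xi> n)"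
        by (intro N_lin_ext subspace_diff[OF subspace_molecules] \<xi>)
      finally show ?thesis by simp
    qed
    obtain r :: "nat \<Rightarrow> nat" where r: "strict_mono r"
      and low: "\<And>k a. ((s powr p - 2 * \<epsilon>) / 2 - 8 * \<epsilon>) * (\<Sum>i<k. \<bar>a i\<bar> powr p)
        \<le> c (\<Sum>i<k. a i *\<^sub>R \<xi> (r i))"
      using separated_lp_subsequence[of \<xi>, OF \<xi> bound \<epsilon> sep] by blast
    have coef: "(s powr p - 2 * \<epsilon>) / 2 - 8 * \<epsilon> = \<tau> + \<epsilon>" by (simp add: \<epsilon>_def field_simps)
    have xr: "inj (\<lambda>i. x (r i))"
      by (rule inj_onI) (simp add: inj_eq[OF x(1)] strict_mono_eq[OF r])
    have lower: "\<tau> * (\<Sum>i<k. \<bar>a i\<bar> powr p) \<le> N (\<Sum>i<k. a i *\<^sub>R x (r i)) powr p" for a :: "nat \<Rightarrow> real" and k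
    proof -
      let ?S = "\<Sum>i<k. \<bar>a i\<bar> powr p"
      let ?X = "\<Sum>i<k. a i *\<^sub>R x (r i)" and ?Y = "\<Sum>i<k. a i *\<^sub>R y (r i)"
      have XY: "?X \<in> V" "?Y \<in> V"
        by (intro subspace_sum[OF subspace_V] subspace_scale[OF subspace_V] xV yV)+
      have "((s powr p - 2 * \<epsilon>) / 2 - 8 * \<epsilon>) * ?S \<le> c (\<Sum>i<k. a i *\<^sub>R \<xi> (r i))" by (rule low)
      also have "\<dots> = N (lin_ext \<delta> (\<Sum>i<k. a i *\<^sub>R \<xi> (r i))) powr p"
        by (intro N_lin_ext[symmetric] subspace_sum[OF subspace_molecules]
            subspace_scale[OF subspace_molecules] \<xi>)
      also have "lin_ext \<delta> (\<Sum>i<k. a i *\<^sub>R \<xi> (r i)) = ?Y"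
        by (simp add: y_def linear_sum[OF linear_lin_ext] linear_scale[OF linear_lin_ext])
      also have "N ?Y powr p \<le> N (?Y - ?X) powr p + N ?X powr p" by (rule N_powr_le_diff[OF XY(2,1)])
      also have "?Y - ?X = (\<Sum>i<k. a i *\<^sub>R (y (r i) - x (r i)))"
        by (simp add: scaleR_diff_right sum_subtractf)
      also have "N \<dots> powr p \<le> (\<Sum>i<k. \<bar>a i\<bar> powr p * N (y (r i) - x (r i)) powr p)"
        by (intro s_banach_sum[OF s_banach_V] subspace_diff[OF subspace_V] xV yV)
      also have "\<dots> \<le> (\<Sum>i<k. \<bar>a i\<bar> powr p * \<epsilon>)"
        by (intro sum_mono mult_left_mono close') auto
      also have "\<dots> = \<epsilon> * ?S" by (simp add: sum_distrib_left mult.commute)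
      finally show ?thesis unfolding coef by (simp add: distrib_right)
    qed
    show "\<exists>B\<subseteq>A. infinite B \<and> (\<forall>F a. finite F \<and> F \<subseteq> B \<longrightarrow>
        s / (K\<^sub>0 * 2 powr (1 / p)) * (\<Sum>x\<in>F. \<bar>a x\<bar> powr p) powr (1 / p) \<le> N (\<Sum>x\<in>F. a x *\<^sub>R x))"
    proof (intro exI[of _ "range (\<lambda>i. x (r i))"] conjI allI impI)
      show "range (\<lambda>i. x (r i)) \<subseteq> A" using xA by auto
      show "infinite (range (\<lambda>i. x (r i)))" by (rule range_inj_infinite[OF xr])
      fix F and a :: "'x \<Rightarrow> real"
      assume F: "finite F \<and> F \<subseteq> range (\<lambda>i. x (r i))"
      define I where "I = (\<lambda>i. x (r i)) -` F"
      have I: "finite I" "(\<lambda>i. x (r i)) ` I = F"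
        using F finite_vimageI[OF _ xr] by (auto simp: I_def)
      obtain k where k: "I \<subseteq> {..<k}" using finite_nat_iff_bounded I(1) by blast
      \<comment> \<open>The estimate is available for initial segments of the subsequence;
        coefficients outside the chosen finite set are filled with zeros.\<close>
      define a' where "a' i = (if i \<in> I then a (x (r i)) else 0)" for i
      have inj: "inj_on (\<lambda>i. x (r i)) I" using xr by (rule inj_on_subset) simp
      have "(\<Sum>i<k. \<bar>a' i\<bar> powr p) = (\<Sum>i\<in>I. \<bar>a (x (r i))\<bar> powr p)"
        using k p by (intro sum.mono_neutral_cong_right) (auto simp: a'_def)
      also have "\<dots> = (\<Sum>x\<in>F. \<bar>a x\<bar> powr p)"
        unfolding I(2)[symmetric] sum.reindex[OF inj] by simp
      finally have S: "(\<Sum>i<k. \<bar>a' i\<bar> powr p) = (\<Sum>x\<in>F. \<bar>a x\<bar> powr p)" .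
      have "(\<Sum>i<k. a' i *\<^sub>R x (r i)) = (\<Sum>i\<in>I. a (x (r i)) *\<^sub>R x (r i))"
        using k by (intro sum.mono_neutral_cong_right) (auto simp: a'_def)
      also have "\<dots> = (\<Sum>x\<in>F. a x *\<^sub>R x)"
        unfolding I(2)[symmetric] sum.reindex[OF inj] by simp
      finally have X: "(\<Sum>i<k. a' i *\<^sub>R x (r i)) = (\<Sum>x\<in>F. a x *\<^sub>R x)" .
      have XV: "(\<Sum>x\<in>F. a x *\<^sub>R x) \<in> V"
        unfolding X[symmetric] by (intro subspace_sum[OF subspace_V] subspace_scale[OF subspace_V] xV)
      let ?S = "\<Sum>x\<in>F. \<bar>a x\<bar> powr p"
      have "s / (K\<^sub>0 * 2 powr (1 / p)) * ?S powr (1 / p) = (\<tau> * ?S) powr (1 / p)"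
        unfolding \<tau>_def using s K0 C p
        by (simp add: powr_mult powr_divide powr_powr sum_nonneg mult.commute)
      also have "\<dots> \<le> (N (\<Sum>x\<in>F. a x *\<^sub>R x) powr p) powr (1 / p)"
        using lower[of a' k] s p unfolding S X
        by (intro powr_mono2) (auto simp: \<tau>_def sum_nonneg)
      also have "\<dots> = N (\<Sum>x\<in>F. a x *\<^sub>R x)" using p N_nonneg[OF XV] by (simp add: powr_powr)
      finally show "s / (K\<^sub>0 * 2 powr (1 / p)) * ?S powr (1 / p) \<le> N (\<Sum>x\<in>F. a x *\<^sub>R x)" .
    qed
  qed
qed

theorem theorem4p7:
  fixes p q \<Gamma> :: real
  assumes "0 < p" and "p < q" and "q \<le> 1"
    and "amenability_constant p \<Gamma>"
  shows "(\<forall>(K :: 'm set) d b (V :: 'x::real_vector set) N \<delta>.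
            pointed_s_metric q K d b \<and> s_compact q K d \<and>
            lipschitz_free_space p K d b V N \<delta> \<longrightarrow>
            strong_schur p (schur_const \<Gamma> p q) V N) \<and>
         (\<forall>(K :: 'm set) d b (V :: 'x set) N \<delta>.
            Metric_space K d \<and> compact_space (Metric_space.mtopology K d) \<and> b \<in> K \<and>
            lipschitz_free_space p K d b V N \<delta> \<longrightarrow>
            strong_schur p (schur_const \<Gamma> p 1) V N)"
proof (intro conjI allI impI)
  have \<Gamma>: "1 \<le> \<Gamma>" using assms(4) by (simp add: amenability_constant_def)
  show "strong_schur p (schur_const \<Gamma> p q) V N"
    if "pointed_s_metric q K d b \<and> s_compact q K d \<and> lipschitz_free_space p K d b V N \<delta>"
    for K :: "'m set" and d b and V :: "'x set" and N \<delta>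
    using that by (elim conjE) (rule free_space_strong_schur[OF assms(1-3) schur_const_ge_1[OF assms(1,2) \<Gamma>]])
  show "strong_schur p (schur_const \<Gamma> p 1) V N"
    if K: "Metric_space K d \<and> compact_space (Metric_space.mtopology K d) \<and> b \<in> K \<and>
      lipschitz_free_space p K d b V N \<delta>"
    for K :: "'m set" and d b and V :: "'x set" and N \<delta>
  proof -
    \<comment> \<open>The identity of d^1 and d requires nonnegativity at all points, also off the
      carrier; the metric space locale provides it.\<close>
    have d: "0 \<le> d x y" for x y by (rule Metric_space.nonneg[of K]) (use K in blast)
    then have "(\<lambda>x y. d x y powr 1) = d" by simp
    then have "pointed_s_metric 1 K d b" "s_compact 1 K d"
      using K d by (simp_all add: pointed_s_metric_def s_metric_def s_compact_def)
    moreover have p: "p < 1" using assms by simp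
    moreover have "lipschitz_free_space p K d b V N \<delta>" using K by blast
    ultimately show ?thesis
      by (intro free_space_strong_schur[OF assms(1) p order_refl schur_const_ge_1[OF assms(1) p \<Gamma>]])
  qed
qed

end
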